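(* Assume $\sigma>0$, $\int_{|x|\le1}|x|\nu(dx)<\infty$ and $d_+>0$. Then there exists a constant $C>0$ such that, for $t$ close enough to $T$, $$0\le b^{BS}(t)-b(t)\le C\sqrt{T-t}.$$
   Context: Let $X$ be a real Lévy process with characteristic triplet $(\sigma^2,\gamma,\nu)$ and Lévy–Itô decomposition $X_t=\gamma t+\sigma B_t+Y_t$, $B$ a standard Brownian motion; $(\mathcal F_t)$ the usual augmentation of its natural filtration. Fix $T>0$, $K>0$, $r>0$, $\delta\ge0$. Assume $\int_{|x|\ge1}e^x\nu(dx)<\infty$ and $\frac{\sigma^2}{2}+\gamma+\int(e^x-1-x\mathbf 1_{|x|\le1})\nu(dx)=0$. For $x\ge0$ let $S^x_t=xe^{(r-\delta)t+X_t}$; $P(t,x)=\sup_{\tau\in\mathcal T_{0,T-t}}\mathbb E[e^{-r\tau}(K-S^x_\tau)_+]$ (American put, $\mathcal T_{0,s}$ = stopping times in $[0,s]$), and $b(t)=\inf\{x\ge0:P(t,x)>(K-x)_+\}$ its critical price. Let $d_+=r-\delta-\int(e^y-1)_+\nu(dy)$. The associated Black–Scholes model is $S^{BS,x}_t=xe^{(r-\delta-\sigma^2/2)t+\sigma B_t}$, with American put price $P^{BS}(t,x)=\sup_{\tau\in\mathcal T_{0,T-t}}\mathbb E[e^{-r\tau}(K-S^{BS,x}_\tau)_+]$ and critical price $b^{BS}(t)=\inf\{x\ge0:P^{BS}(t,x)>(K-x)_+\}$. *)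

theory Defs
  imports "HOL-Probability.Probability"
begin

definition levy_process :: "'a measure \<Rightarrow> (real \<Rightarrow> 'a \<Rightarrow> real) \<Rightarrow> bool" where
  "levy_process M X \<longleftrightarrow>
     prob_space M \<and>
     (\<forall>s. X s \<in> borel_measurable M) \<and>
     (\<forall>\<omega>\<in>space M. X 0 \<omega> = 0) \<and>
     (\<forall>\<omega>\<in>space M. \<forall>s\<ge>0. continuous (at_right s) (\<lambda>u. X u \<omega>)) \<and>
     (\<forall>\<omega>\<in>space M. \<forall>s>0. \<exists>l. ((\<lambda>u. X u \<omega>) \<longlongrightarrow> l) (at_left s)) \<and>
     (\<forall>(t::nat \<Rightarrow> real) n. 0 \<le> t 0 \<and> mono t \<longrightarrow>
        prob_space.indep_vars M (\<lambda>_. borel) (\<lambda>i \<omega>. X (t (Suc i)) \<omega> - X (t i) \<omega>) {..<n}) \<and>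
     (\<forall>s\<ge>0. \<forall>h\<ge>0. distr M borel (\<lambda>\<omega>. X (s + h) \<omega> - X s \<omega>) = distr M borel (X h))"

definition levy_exponent :: "real \<Rightarrow> real \<Rightarrow> real measure \<Rightarrow> real \<Rightarrow> complex" where
  "levy_exponent \<sigma> \<gamma> \<nu> u =
     \<i> * complex_of_real (\<gamma> * u) - complex_of_real (\<sigma>\<^sup>2 * u\<^sup>2 / 2)
     + (CLINT y|\<nu>. iexp (u * y) - 1 - \<i> * complex_of_real (u * y * indicator {y. \<bar>y\<bar> \<le> 1} y))"

definition levy_measure :: "real measure \<Rightarrow> bool" where
  "levy_measure \<nu> \<longleftrightarrow> sets \<nu> = sets borel \<and> emeasure \<nu> {0} = 0
     \<and> integrable \<nu> (\<lambda>y. min 1 (y\<^sup>2))"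

definition levy_triplet :: "'a measure \<Rightarrow> (real \<Rightarrow> 'a \<Rightarrow> real) \<Rightarrow> real \<Rightarrow> real \<Rightarrow> real measure \<Rightarrow> bool" where
  "levy_triplet M X \<sigma> \<gamma> \<nu> \<longleftrightarrow> levy_process M X \<and> levy_measure \<nu> \<and>
     (\<forall>s\<ge>0. \<forall>u. char (distr M borel (X s)) u = exp (complex_of_real s * levy_exponent \<sigma> \<gamma> \<nu> u))"

definition nat_gen :: "'a measure \<Rightarrow> (real \<Rightarrow> 'a \<Rightarrow> real) \<Rightarrow> real \<Rightarrow> 'a set set" where
  "nat_gen M X u = {{\<omega>\<in>space M. X s \<omega> \<in> A} | s A. s \<in> {0..u} \<and> A \<in> sets borel}"

definition usual_filtration :: "'a measure \<Rightarrow> (real \<Rightarrow> 'a \<Rightarrow> real) \<Rightarrow> real \<Rightarrow> 'a measure" where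
  "usual_filtration M X t =
     sigma (space M) (\<Inter>u\<in>{t<..}. sets (sigma (space M) (nat_gen M X u \<union> null_sets (completion M))))"

definition american_put ::
  "'a measure \<Rightarrow> (real \<Rightarrow> 'a measure) \<Rightarrow> (real \<Rightarrow> real \<Rightarrow> 'a \<Rightarrow> real)
    \<Rightarrow> real \<Rightarrow> real \<Rightarrow> real \<Rightarrow> real \<Rightarrow> real \<Rightarrow> real" where
  "american_put M F S r K T t x =
     (SUP \<tau> \<in> {\<tau>. stopping_time F \<tau> \<and> (\<forall>\<omega>\<in>space M. 0 \<le> \<tau> \<omega> \<and> \<tau> \<omega> \<le> T - t)}.
        integral\<^sup>L (completion M) (\<lambda>\<omega>. exp (- r * \<tau> \<omega>) * max 0 (K - S x (\<tau> \<omega>) \<omega>)))"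

definition critical_price :: "(real \<Rightarrow> real \<Rightarrow> real) \<Rightarrow> real \<Rightarrow> real \<Rightarrow> real" where
  "critical_price P K t = Inf {x. 0 \<le> x \<and> P t x > max 0 (K - x)}"

definition brownian_motion :: "'a measure \<Rightarrow> (real \<Rightarrow> 'a measure) \<Rightarrow> (real \<Rightarrow> 'a \<Rightarrow> real) \<Rightarrow> bool" where
  "brownian_motion M F B \<longleftrightarrow>
     (\<forall>s. B s \<in> borel_measurable (F s)) \<and>
     (\<forall>\<omega>\<in>space M. B 0 \<omega> = 0) \<and>
     (\<forall>\<omega>\<in>space M. continuous_on {0..} (\<lambda>s. B s \<omega>)) \<and>
     (\<forall>s u. 0 \<le> s \<and> s < u \<longrightarrow>
        distr (completion M) borel (\<lambda>\<omega>. B u \<omega> - B s \<omega>) = density lborel (normal_density 0 (sqrt (u - s))) \<and>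
        (\<forall>A\<in>sets (F s). \<forall>D\<in>sets borel.
           measure (completion M) (A \<inter> {\<omega>\<in>space M. B u \<omega> - B s \<omega> \<in> D})
             = measure (completion M) A * measure (completion M) {\<omega>\<in>space M. B u \<omega> - B s \<omega> \<in> D}))"

end

theory Submission
  imports Defs
begin

text \<open>
  Both American puts are limits of Bermudan puts on the grids of mesh \<open>h = (T - t) / n\<close>, whose values are
  computed by iterating \<open>V \<mapsto> max ((K - x)\<^sub>+) (e\<^sup>-\<^sup>r\<^sup>h E V(x S\<^sub>h))\<close>. So only the one-step laws matter. That of
  the Levy model is a weak limit of laws of \<open>S\<^sup>B\<^sup>S\<^sub>h \<cdot> Y\<close>, where \<open>Y > 0\<close> is independent of \<open>S\<^sup>B\<^sup>S\<^sub>h\<close>, has mean \<open>1\<close>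
  and satisfies \<open>E \<bar>Y - 1\<bar> = O(h)\<close>. Jensen's inequality gives \<open>P\<^sup>B\<^sup>S \<le> P\<close>, hence \<open>b \<le> b\<^sup>B\<^sup>S\<close>, and
  the \<open>O(h)\<close> bound gives \<open>P \<le> P\<^sup>B\<^sup>S + C\<^sub>1 (T - t) x\<close>.

  For the upper bound on the gap let \<open>z + C \<surd>(T - t) < b\<^sup>B\<^sup>S(t)\<close> and consider the barrier
  \<open>W(v) = K - v + \<beta> ((v - z)\<^sub>+)\<^sup>2\<close>, frozen beyond a point \<open>x\<close> slightly below \<open>b\<^sup>B\<^sup>S(t)\<close>. If \<open>C\<close> is large, then
  \<open>W \<ge> K - v + C\<^sub>1 (T - t) K \<ge> P(t, v)\<close> at distance \<open>\<ge> C \<surd>(T - t)\<close> from \<open>z\<close>. Below that, waiting for a time \<open>h\<close> costs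
  \<open>(r - \<delta>) K h\<close>, while the upward jumps over \<open>x\<close> gain at most \<open>K h \<integral>(e\<^sup>y - 1)\<^sub>+ d\<nu>\<close> and the quadratic term
  \<open>O(\<beta> h)\<close>. As \<open>d\<^sub>+ > 0\<close>, a small \<open>\<beta>\<close> makes \<open>W\<close> a supersolution, so \<open>P(t, z) \<le> W(z) = K - z\<close>.
\<close>

section \<open>Bermudan puts and stopping on a grid\<close>

text \<open>\<open>X\<close> is known only through its characteristic function and \<open>B\<close>
  only as a Brownian motion of the same filtration, so no decomposition of the paths is available
  and the two models are compared in law. Bermudan values see only the law of one step, which makes
  this sufficient; in return the bounds for one step must add up to something of order
  \<open>T - t\<close> over \<open>n\<close> steps.

  Freezing the barrier beyond \<open>x\<close> serves three ends. Jumps are only known to have a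
  first exponential moment, so a quadratic function of the price after a jump need not be
  integrable. Bounded continuous functions are what weak limits can be tested on. And prices do not
  increase with the starting point, so domination at \<open>x\<close> extends to everything beyond
  it. The cost of freezing is the overshoot \<open>(v - x)\<^sub>+\<close>, from which the integral
  in \<open>d_+\<close> arises. The supersolution property is used only below a second level between
  \<open>z\<close> and \<open>x\<close>: the gap to \<open>x\<close> makes the overshoot due to the
  Brownian part negligible. The square root balances the quadratic term at distance \<open>s\<close>
  from \<open>z\<close> against a price difference proportional to \<open>T - t\<close>.\<close>

fun bermudan_put :: "real measure \<Rightarrow> real \<Rightarrow> real \<Rightarrow> nat \<Rightarrow> real \<Rightarrow> real" where
  "bermudan_put m d K 0 x = max 0 (K - x)"
| "bermudan_put m d K (Suc n) x =
     max (max 0 (K - x)) (d * (\<integral>y. bermudan_put m d K n (x * exp y) \<partial>m))"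

lemma borel_measurable_bermudan_put:
  assumes "prob_space m" "sets m = sets borel"
  shows "bermudan_put m d K n \<in> borel_measurable borel"
proof (induction n)
  case 0
  show ?case by simp
next
  case (Suc n)
  interpret prob_space m by fact
  note [measurable_cong] = assms(2)
  note [measurable] = Suc.IH
  have "(\<lambda>x. \<integral>y. bermudan_put m d K n (x * exp y) \<partial>m) \<in> borel_measurable borel"
    by measurable
  then show ?case by simp
qed

lemma bermudan_put_nonneg: "0 \<le> bermudan_put m d K n x"
  by (cases n) auto

lemma bermudan_put_ge_payoff: "max 0 (K - x) \<le> bermudan_put m d K n x"
  by (cases n) auto

lemma bermudan_put_le:
  assumes "prob_space m" "sets m = sets borel" "0 \<le> d" "d \<le> 1" "0 \<le> K" "0 \<le> x"
  shows "bermudan_put m d K n x \<le> K"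
  using \<open>0 \<le> x\<close>
proof (induction n arbitrary: x)
  case 0
  then show ?case using assms by simp
next
  case (Suc n)
  interpret prob_space m by fact
  note [measurable_cong] = assms(2)
  note [measurable] = borel_measurable_bermudan_put[OF assms(1,2)]
  have "(\<integral>y. bermudan_put m d K n (x * exp y) \<partial>m) \<le> K"
    using Suc.IH Suc.prems
    by (intro integral_le_const integrable_const_bound[where B=K])
       (auto simp: bermudan_put_nonneg abs_of_nonneg)
  then have "d * (\<integral>y. bermudan_put m d K n (x * exp y) \<partial>m) \<le> 1 * K"
    using assms by (intro mult_mono) (auto intro!: integral_nonneg simp: bermudan_put_nonneg)
  then show ?case using assms Suc.prems by simp
qed

text \<open>The payoff is one of the terms of the maximum, which settles the first step, and the
  recursion is monotone. This lets a bound on the value with all \<open>n\<close> steps left serve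
  at every earlier stage of an induction.\<close>

lemma bermudan_put_Suc_mono:
  assumes "prob_space m" "sets m = sets borel" "0 \<le> d" "d \<le> 1" "0 \<le> K" "0 \<le> x"
  shows "bermudan_put m d K n x \<le> bermudan_put m d K (Suc n) x"
  using \<open>0 \<le> x\<close>
proof (induction n arbitrary: x)
  case 0
  then show ?case by simp
next
  case (Suc n)
  interpret prob_space m by fact
  note [measurable_cong] = assms(2)
  note [measurable] = borel_measurable_bermudan_put[OF assms(1,2)]
  have int: "integrable m (\<lambda>y. bermudan_put m d K k (x * exp y))" for k
    using Suc.prems bermudan_put_le[OF assms(1-5)]
    by (intro integrable_const_bound[where B=K]) (auto simp: bermudan_put_nonneg abs_of_nonneg)
  have "(\<integral>y. bermudan_put m d K n (x * exp y) \<partial>m) \<le> (\<integral>y. bermudan_put m d K (Suc n) (x * exp y) \<partial>m)"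
    using Suc.IH Suc.prems by (intro integral_mono int) auto
  then have "d * (\<integral>y. bermudan_put m d K n (x * exp y) \<partial>m) \<le> d * (\<integral>y. bermudan_put m d K (Suc n) (x * exp y) \<partial>m)"
    using assms(3) by (rule mult_left_mono)
  then show ?case unfolding bermudan_put.simps(2)[of m d K "Suc n"] bermudan_put.simps(2)[of m d K n]
    by (intro max.mono order_refl)
qed

text \<open>Collects what pricing uses of a log-price \<open>L\<close>: adapted right-continuous
  paths and increments over a time \<open>h\<close> that are independent of the past with law
  \<open>\<mu> h\<close>. Both models are instances, with the completion of \<open>M\<close> as
  \<open>N\<close>, so the passage from Bermudan to American puts is done once.\<close>

locale levy_stopping = prob_space N for N :: "'a measure" +
  fixes F :: "real \<Rightarrow> 'a measure" and L :: "real \<Rightarrow> 'a \<Rightarrow> real" and \<mu> :: "real \<Rightarrow> real measure"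
  assumes space_F: "space (F s) = space N"
    and F_subset: "sets (F s) \<subseteq> sets N"
    and F_mono: "s \<le> u \<Longrightarrow> sets (F s) \<subseteq> sets (F u)"
    and adapted: "0 \<le> s \<Longrightarrow> L s \<in> borel_measurable (F s)"
    and L_0: "\<omega> \<in> space N \<Longrightarrow> L 0 \<omega> = 0"
    and right_cont: "\<omega> \<in> space N \<Longrightarrow> 0 \<le> s \<Longrightarrow> continuous (at_right s) (\<lambda>u. L u \<omega>)"
    and prob_\<mu>: "0 < h \<Longrightarrow> prob_space (\<mu> h)"
    and sets_\<mu>: "sets (\<mu> h) = sets borel"
    and increments: "0 \<le> s \<Longrightarrow> 0 < h \<Longrightarrow> A \<in> sets (F s) \<Longrightarrow> D \<in> sets borel \<Longrightarrow>
      measure N (A \<inter> {\<omega>\<in>space N. L (s + h) \<omega> - L s \<omega> \<in> D}) = measure N A * measure (\<mu> h) D"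
begin

lemma F_measurableD: "f \<in> measurable (F s) B \<Longrightarrow> f \<in> measurable N B"
  using F_subset[of s] space_F[of s] by (auto simp: measurable_def)

lemma L_measurable: "0 \<le> s \<Longrightarrow> L s \<in> borel_measurable N"
  using adapted F_measurableD by blast

text \<open>Independence makes the joint law of \<open>\<omega>\<close> and the increment a product
  measure, and Fubini integrates the increment out. Indicators of events in \<open>F s\<close> take
  the place of a conditional expectation.\<close>

lemma markov_property:
  fixes \<phi> :: "real \<Rightarrow> real"
  assumes s: "0 \<le> s" and h: "0 < h" and A: "A \<in> sets (F s)"
    and [measurable]: "\<phi> \<in> borel_measurable borel" and bd: "\<And>y. \<bar>\<phi> y\<bar> \<le> C"
  shows "(\<integral>\<omega>. indicator A \<omega> * \<phi> (L (s + h) \<omega>) \<partial>N)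
    = (\<integral>\<omega>. indicator A \<omega> * (\<integral>y. \<phi> (L s \<omega> + y) \<partial>\<mu> h) \<partial>N)"
proof -
  define D where "D \<omega> = L (s + h) \<omega> - L s \<omega>" for \<omega>
  interpret \<mu>: prob_space "\<mu> h" using h by (rule prob_\<mu>)
  note [measurable_cong] = sets_\<mu>
  have LsF[measurable]: "L s \<in> borel_measurable (F s)" using s by (rule adapted)
  have LsN[measurable]: "L s \<in> borel_measurable N" using s by (rule L_measurable)
  have LshN[measurable]: "L (s + h) \<in> borel_measurable N" using s h by (intro L_measurable) auto
  have D[measurable]: "D \<in> borel_measurable N" unfolding D_def by measurable
  have id: "(\<lambda>\<omega>. \<omega>) \<in> measurable N (F s)"
    using F_subset[of s] space_F[of s] by (auto simp: measurable_def dest: sets.sets_into_space)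
  have pair[measurable]: "(\<lambda>\<omega>. (\<omega>, D \<omega>)) \<in> measurable N (F s \<Otimes>\<^sub>M borel)"
    using id by measurable
  \<comment> \<open>The identity pushes \<open>N\<close> forward to its restriction to
    \<open>F s\<close>, so that independence can be expressed as a product measure with first factor
    on \<open>F s\<close>.\<close>
  define Ns where "Ns = distr N (F s) (\<lambda>\<omega>. \<omega>)"
  interpret Ns: prob_space Ns unfolding Ns_def using id by (rule prob_space_distr)
  have sets_Ns[measurable_cong]: "sets Ns = sets (F s)" by (simp add: Ns_def)
  have joint: "Ns \<Otimes>\<^sub>M \<mu> h = distr N (F s \<Otimes>\<^sub>M borel) (\<lambda>\<omega>. (\<omega>, D \<omega>))"
  proof (rule pair_measure_eqI)
    show "sigma_finite_measure Ns" "sigma_finite_measure (\<mu> h)" by unfold_locales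
    show "sets (Ns \<Otimes>\<^sub>M \<mu> h) = sets (distr N (F s \<Otimes>\<^sub>M borel) (\<lambda>\<omega>. (\<omega>, D \<omega>)))"
      by (simp add: sets_Ns sets_\<mu> cong: sets_pair_measure_cong)
    fix A' B assume "A' \<in> sets Ns" "B \<in> sets (\<mu> h)"
    then have A': "A' \<in> sets (F s)" and B: "B \<in> sets borel" by (auto simp: sets_Ns sets_\<mu>)
    have A'N: "A' \<in> sets N" using A' F_subset by auto
    have "(\<lambda>\<omega>. (\<omega>, D \<omega>)) -` (A' \<times> B) \<inter> space N = A' \<inter> {\<omega>\<in>space N. L (s + h) \<omega> - L s \<omega> \<in> B}"
      using sets.sets_into_space[OF A'N] by (auto simp: D_def)
    then have "emeasure (distr N (F s \<Otimes>\<^sub>M borel) (\<lambda>\<omega>. (\<omega>, D \<omega>))) (A' \<times> B)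
        = emeasure N (A' \<inter> {\<omega>\<in>space N. L (s + h) \<omega> - L s \<omega> \<in> B})"
      using A' B by (subst emeasure_distr) auto
    also have "\<dots> = ennreal (measure N A') * ennreal (measure (\<mu> h) B)"
      using increments[OF s h A' B] by (simp add: emeasure_eq_measure ennreal_mult)
    also have "measure N A' = measure Ns A'"
      unfolding Ns_def using A' id sets.sets_into_space[OF A'N]
      by (subst measure_distr) (auto intro!: arg_cong[where f="measure N"])
    finally show "emeasure Ns A' * emeasure (\<mu> h) B
        = emeasure (distr N (F s \<Otimes>\<^sub>M borel) (\<lambda>\<omega>. (\<omega>, D \<omega>))) (A' \<times> B)"
      by (simp add: Ns.emeasure_eq_measure \<mu>.emeasure_eq_measure)
  qed
  define \<Phi> where "\<Phi> = (\<lambda>(\<omega>, y). indicator A \<omega> * \<phi> (L s \<omega> + y))"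
  have A_meas[measurable]: "A \<in> sets (F s)" by fact
  have Phi[measurable]: "\<Phi> \<in> borel_measurable (F s \<Otimes>\<^sub>M borel)"
    unfolding \<Phi>_def by measurable
  interpret P: pair_prob_space Ns "\<mu> h" by unfold_locales
  have C: "0 \<le> C" using bd[of 0] by linarith
  have int: "integrable (Ns \<Otimes>\<^sub>M \<mu> h) \<Phi>"
    by (rule P.integrable_const_bound[where B=C])
       (auto simp: \<Phi>_def indicator_def bd C split: prod.splits)
  have "(\<integral>\<omega>. indicator A \<omega> * \<phi> (L (s + h) \<omega>) \<partial>N) = (\<integral>\<omega>. \<Phi> (\<omega>, D \<omega>) \<partial>N)"
    by (simp add: \<Phi>_def D_def)
  also have "\<dots> = integral\<^sup>L (Ns \<Otimes>\<^sub>M \<mu> h) \<Phi>"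
    unfolding joint by (subst integral_distr) auto
  also have "\<dots> = (\<integral>\<omega>. (\<integral>y. \<Phi> (\<omega>, y) \<partial>\<mu> h) \<partial>Ns)"
    by (rule P.integral_fst'[OF int, symmetric])
  also have "\<dots> = (\<integral>\<omega>. (\<integral>y. \<Phi> (\<omega>, y) \<partial>\<mu> h) \<partial>N)"
    unfolding Ns_def by (subst integral_distr[OF id]) auto
  finally show ?thesis by (simp add: \<Phi>_def)
qed

lemma continuation_value:
  fixes \<phi> :: "real \<Rightarrow> real"
  assumes s: "0 \<le> s" and h: "0 < h" and A: "A \<in> sets (F s)" and x: "0 \<le> x"
    and m[measurable]: "\<phi> \<in> borel_measurable borel" and bd: "\<And>y. 0 \<le> y \<Longrightarrow> \<bar>\<phi> y\<bar> \<le> C"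
  shows "(\<integral>\<omega>. indicator A \<omega> * \<phi> (x * exp (L (s + h) \<omega>)) \<partial>N)
    = (\<integral>\<omega>. indicator A \<omega> * (\<integral>y. \<phi> (x * exp (L s \<omega>) * exp y) \<partial>\<mu> h) \<partial>N)"
  using markov_property[OF s h A, of "\<lambda>y. \<phi> (x * exp y)" C] x bd
  by (simp add: exp_add mult.assoc)

end

section \<open>Dynamic programming on a grid\<close>

context levy_stopping
begin

lemma continuation_value_bermudan:
  assumes k: "0 < h" and A: "A \<in> sets (F (real k * h))" and x: "0 \<le> x" and K: "0 \<le> K" and r: "0 \<le> r"
  shows "(\<integral>\<omega>. indicator A \<omega> * (exp (- r * (real (Suc k) * h)) *
             bermudan_put (\<mu> h) (exp (- r * h)) K j (x * exp (L (real (Suc k) * h) \<omega>))) \<partial>N)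
    = (\<integral>\<omega>. indicator A \<omega> * (exp (- r * (real k * h)) * (exp (- r * h) *
             (\<integral>y. bermudan_put (\<mu> h) (exp (- r * h)) K j (x * exp (L (real k * h) \<omega>) * exp y) \<partial>\<mu> h))) \<partial>N)"
proof -
  let ?b = "bermudan_put (\<mu> h) (exp (- r * h)) K j"
  have b: "\<bar>?b y\<bar> \<le> K" if "0 \<le> y" for y
    using bermudan_put_le[OF prob_\<mu>[OF k] sets_\<mu>, of "exp (- r * h)" K y j] that k r K
    by (simp add: bermudan_put_nonneg abs_of_nonneg)
  have eq: "(\<integral>\<omega>. indicator A \<omega> * ?b (x * exp (L (real k * h + h) \<omega>)) \<partial>N)
    = (\<integral>\<omega>. indicator A \<omega> * (\<integral>y. ?b (x * exp (L (real k * h) \<omega>) * exp y) \<partial>\<mu> h) \<partial>N)"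
    using k by (intro continuation_value[OF _ k A x _ b] borel_measurable_bermudan_put prob_\<mu> sets_\<mu>) auto
  have s: "real (Suc k) * h = real k * h + h" by (simp add: algebra_simps)
  have e: "exp (- r * (real k * h + h)) = exp (- r * (real k * h)) * exp (- r * h)"
    by (simp add: exp_add[symmetric] algebra_simps)
  have "(\<integral>\<omega>. indicator A \<omega> * (exp (- r * (real (Suc k) * h)) * ?b (x * exp (L (real (Suc k) * h) \<omega>))) \<partial>N)
      = exp (- r * (real k * h)) * exp (- r * h) * (\<integral>\<omega>. indicator A \<omega> * ?b (x * exp (L (real k * h + h) \<omega>)) \<partial>N)"
    unfolding s e by (subst integral_mult_right_zero[symmetric]) (simp add: ac_simps)
  also have "\<dots> = exp (- r * (real k * h)) * exp (- r * h) * (\<integral>\<omega>. indicator A \<omega> * (\<integral>y. ?b (x * exp (L (real k * h) \<omega>) * exp y) \<partial>\<mu> h) \<partial>N)"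
    by (simp only: eq)
  also have "\<dots> = (\<integral>\<omega>. indicator A \<omega> * (exp (- r * (real k * h)) * (exp (- r * h) *
             (\<integral>y. ?b (x * exp (L (real k * h) \<omega>) * exp y) \<partial>\<mu> h))) \<partial>N)"
    by (subst integral_mult_right_zero[symmetric]) (simp add: ac_simps)
  finally show ?thesis .
qed

definition grid_payoff :: "real \<Rightarrow> real \<Rightarrow> real \<Rightarrow> real \<Rightarrow> ('a \<Rightarrow> nat) \<Rightarrow> 'a \<Rightarrow> real" where
  "grid_payoff r K h x i \<omega> = exp (- r * (real (i \<omega>) * h)) * max 0 (K - x * exp (L (real (i \<omega>) * h) \<omega>))"

definition grid_stopping :: "real \<Rightarrow> ('a \<Rightarrow> nat) \<Rightarrow> bool" where
  "grid_stopping h i \<longleftrightarrow> (\<forall>k. {\<omega>\<in>space N. i \<omega> \<le> k} \<in> sets (F (real k * h)))"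

lemma grid_stopping_measurable:
  assumes "grid_stopping h i"
  shows "i \<in> measurable N (count_space UNIV)"
proof (subst measurable_count_space_eq2_countable; safe?)
  have le: "{\<omega>\<in>space N. i \<omega> \<le> k} \<in> sets N" for k
    using assms F_subset unfolding grid_stopping_def by blast
  fix k
  show "i -` {k} \<inter> space N \<in> sets N"
  proof (cases k)
    case 0
    have "i -` {0} \<inter> space N = {\<omega>\<in>space N. i \<omega> \<le> 0}" by auto
    then show ?thesis using le[of 0] 0 by simp
  next
    case (Suc l)
    have "i -` {Suc l} \<inter> space N = {\<omega>\<in>space N. i \<omega> \<le> Suc l} - {\<omega>\<in>space N. i \<omega> \<le> l}" by auto
    then show ?thesis using le[of l] le[of "Suc l"] Suc by simp
  qed
qed auto

lemma grid_payoff_measurable: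
  assumes "grid_stopping h i" "0 \<le> h"
  shows "grid_payoff r K h x i \<in> borel_measurable N"
proof -
  note [measurable] = grid_stopping_measurable[OF assms(1)]
  have [measurable]: "L (real k * h) \<in> borel_measurable N" for k
    using assms by (intro L_measurable) auto
  have "(\<lambda>\<omega>. (\<lambda>k \<omega>. exp (- r * (real k * h)) * max 0 (K - x * exp (L (real k * h) \<omega>))) (i \<omega>) \<omega>)
      \<in> borel_measurable N"
    by (rule measurable_compose_countable) measurable
  then show ?thesis by (simp add: grid_payoff_def[abs_def])
qed

lemma discounted_payoff_bounds:
  fixes r K t p :: real
  assumes "0 \<le> r" "0 \<le> K" "0 \<le> t" "0 \<le> p" "p \<le> K"
  shows "0 \<le> exp (- r * t) * p" "exp (- r * t) * p \<le> K"
proof -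
  have "exp (- r * t) * p \<le> 1 * K"
    using assms by (intro mult_mono) auto
  then show "exp (- r * t) * p \<le> K" by simp
qed (use assms in auto)

lemma grid_payoff_bounds:
  assumes "0 \<le> r" "0 \<le> K" "0 \<le> h" "0 \<le> x"
  shows "0 \<le> grid_payoff r K h x i \<omega>" "grid_payoff r K h x i \<omega> \<le> K"
  unfolding grid_payoff_def by (rule discounted_payoff_bounds[where K=K]; use assms in auto)+

lemma integrable_indicator_bounded:
  assumes "A \<in> sets N" "f \<in> borel_measurable N" "\<And>\<omega>. 0 \<le> f \<omega> \<and> f \<omega> \<le> K"
  shows "integrable N (\<lambda>\<omega>. indicator A \<omega> * f \<omega> :: real)"
proof (rule integrable_const_bound[where B=K])
  have "norm (indicator A \<omega> * f \<omega>) \<le> K" for \<omega>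
    using assms(3)[of \<omega>] by (cases "\<omega> \<in> A") auto
  then show "AE \<omega> in N. norm (indicator A \<omega> * f \<omega>) \<le> K" by simp
qed (use assms in measurable)

lemma grid_bermudan_measurable:
  assumes h: "0 < h"
  shows "(\<lambda>\<omega>. c * bermudan_put (\<mu> h) d K j (x * exp (L (real k * h) \<omega>))) \<in> borel_measurable N"
proof -
  note [measurable] = borel_measurable_bermudan_put[OF prob_\<mu>[OF h] sets_\<mu>]
  have [measurable]: "L (real k * h) \<in> borel_measurable N"
    using h by (intro L_measurable) auto
  show ?thesis by measurable
qed

lemma grid_bermudan_bounds:
  assumes h: "0 < h" and x: "0 \<le> x" and K: "0 \<le> K" and r: "0 \<le> r"
  shows "0 \<le> exp (- r * (real k * h)) * bermudan_put (\<mu> h) (exp (- r * h)) K j (x * exp y) \<and>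
     exp (- r * (real k * h)) * bermudan_put (\<mu> h) (exp (- r * h)) K j (x * exp y) \<le> K"
  by (intro conjI discounted_payoff_bounds[where K=K] bermudan_put_nonneg bermudan_put_le[OF prob_\<mu> sets_\<mu>])
     (use assms in auto)

lemma integral_split_set:
  fixes f :: "'a \<Rightarrow> real"
  assumes A: "A \<in> sets N" and E: "E \<in> sets N" and f: "f \<in> borel_measurable N"
    and bd: "\<And>\<omega>. 0 \<le> f \<omega> \<and> f \<omega> \<le> K"
  shows "(\<integral>\<omega>. indicator A \<omega> * f \<omega> \<partial>N)
    = (\<integral>\<omega>. indicator (A \<inter> E) \<omega> * f \<omega> \<partial>N) + (\<integral>\<omega>. indicator (A - E) \<omega> * f \<omega> \<partial>N)"
proof -
  have i: "integrable N (\<lambda>\<omega>. indicator A' \<omega> * f \<omega>)" if "A' \<in> sets N" for A'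
    using that f bd by (rule integrable_indicator_bounded)
  have "A \<inter> E \<in> sets N" "A - E \<in> sets N" using A E by auto
  note int = i[OF this(1)] i[OF this(2)]
  have "(\<integral>\<omega>. indicator A \<omega> * f \<omega> \<partial>N)
      = (\<integral>\<omega>. indicator (A \<inter> E) \<omega> * f \<omega> + indicator (A - E) \<omega> * f \<omega> \<partial>N)"
    by (rule Bochner_Integration.integral_cong) (auto simp: indicator_def)
  then show ?thesis using Bochner_Integration.integral_add[OF int] by simp
qed

text \<open>Backward induction, localised to an event \<open>A\<close> known at time
  \<open>k h\<close>. On the part of \<open>A\<close> where \<open>i\<close> stops at
  \<open>k\<close> the payoff is bounded by the value; on the rest \<open>i\<close> is at least
  \<open>k + 1\<close>, the induction hypothesis applies at the next date, and the resulting value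
  is carried back by the continuation identity.\<close>

lemma grid_stopping_le_bermudan:
  assumes h: "0 < h" and x: "0 \<le> x" and K: "0 \<le> K" and r: "0 \<le> r"
    and i: "grid_stopping h i"
    and A: "A \<in> sets (F (real k * h))" and ki: "\<And>\<omega>. \<omega> \<in> A \<Longrightarrow> k \<le> i \<omega> \<and> i \<omega> \<le> k + j"
  shows "(\<integral>\<omega>. indicator A \<omega> * grid_payoff r K h x i \<omega> \<partial>N)
    \<le> (\<integral>\<omega>. indicator A \<omega> * (exp (- r * (real k * h)) *
          bermudan_put (\<mu> h) (exp (- r * h)) K j (x * exp (L (real k * h) \<omega>))) \<partial>N)"
  using A ki
proof (induction j arbitrary: A k)
  case 0
  have "(\<integral>\<omega>. indicator A \<omega> * grid_payoff r K h x i \<omega> \<partial>N)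
    = (\<integral>\<omega>. indicator A \<omega> * (exp (- r * (real k * h)) *
          bermudan_put (\<mu> h) (exp (- r * h)) K 0 (x * exp (L (real k * h) \<omega>))) \<partial>N)"
    by (rule Bochner_Integration.integral_cong) (use 0(2) in \<open>force simp: grid_payoff_def indicator_def\<close>)+
  then show ?case by simp
next
  case (Suc j)
  define b where "b = bermudan_put (\<mu> h) (exp (- r * h)) K"
  define E where "E = {\<omega>\<in>space N. i \<omega> \<le> k}"
  have EF: "E \<in> sets (F (real k * h))" using i by (simp add: grid_stopping_def E_def)
  have EN: "E \<in> sets N" and AN: "A \<in> sets N" using EF Suc.prems(1) F_subset by auto
  have "h * real k \<le> h * real (Suc k)" using h by (intro mult_left_mono) auto
  then have kk: "real k * h \<le> real (Suc k) * h" by (simp add: mult.commute)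
  have pm: "grid_payoff r K h x i \<in> borel_measurable N"
    using i h by (intro grid_payoff_measurable) auto
  have pb: "0 \<le> grid_payoff r K h x i \<omega> \<and> grid_payoff r K h x i \<omega> \<le> K" for \<omega>
    using grid_payoff_bounds r K h x by auto
  let ?B = "\<lambda>k j \<omega>. exp (- r * (real k * h)) * b j (x * exp (L (real k * h) \<omega>))"
  have bm: "?B k j \<in> borel_measurable N" for k j
    unfolding b_def using h by (rule grid_bermudan_measurable)
  have bb: "0 \<le> ?B k j \<omega> \<and> ?B k j \<omega> \<le> K" for k j \<omega>
    unfolding b_def using h x K r by (rule grid_bermudan_bounds)
  have "(\<integral>\<omega>. indicator (A \<inter> E) \<omega> * grid_payoff r K h x i \<omega> \<partial>N) \<le> (\<integral>\<omega>. indicator (A \<inter> E) \<omega> * ?B k (Suc j) \<omega> \<partial>N)"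
  proof (rule integral_mono)
    fix \<omega>
    show "indicator (A \<inter> E) \<omega> * grid_payoff r K h x i \<omega> \<le> indicator (A \<inter> E) \<omega> * ?B k (Suc j) \<omega>"
    proof (cases "\<omega> \<in> A \<inter> E")
      case True
      then have "i \<omega> = k" using Suc.prems(2)[of \<omega>] by (auto simp: E_def)
      then show ?thesis
        using bermudan_put_ge_payoff[of K "x * exp (L (real k * h) \<omega>)"]
        by (auto simp: grid_payoff_def b_def intro!: mult_left_mono)
    qed simp
  qed (use EN AN pm pb bm bb in \<open>auto intro!: integrable_indicator_bounded[where K=K]\<close>)
  moreover have "(\<integral>\<omega>. indicator (A - E) \<omega> * grid_payoff r K h x i \<omega> \<partial>N) \<le> (\<integral>\<omega>. indicator (A - E) \<omega> * ?B k (Suc j) \<omega> \<partial>N)"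
  proof -
    have A2: "A - E \<in> sets (F (real k * h))" using EF Suc.prems(1) by auto
    then have "A - E \<in> sets (F (real (Suc k) * h))" using F_mono[OF kk] by auto
    then have "(\<integral>\<omega>. indicator (A - E) \<omega> * grid_payoff r K h x i \<omega> \<partial>N) \<le> (\<integral>\<omega>. indicator (A - E) \<omega> * ?B (Suc k) j \<omega> \<partial>N)"
      unfolding b_def
    proof (rule Suc.IH)
      fix \<omega> assume w: "\<omega> \<in> A - E"
      then show "Suc k \<le> i \<omega> \<and> i \<omega> \<le> Suc k + j"
        using Suc.prems(2)[of \<omega>] sets.sets_into_space[OF AN] by (auto simp: E_def)
    qed
    also have "\<dots> = (\<integral>\<omega>. indicator (A - E) \<omega> * (exp (- r * (real k * h)) * (exp (- r * h) *
             (\<integral>y. b j (x * exp (L (real k * h) \<omega>) * exp y) \<partial>\<mu> h))) \<partial>N)"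
      unfolding b_def using h A2 x K r by (rule continuation_value_bermudan)
    also have "\<dots> \<le> (\<integral>\<omega>. indicator (A - E) \<omega> * ?B k (Suc j) \<omega> \<partial>N)"
    proof (rule integral_mono')
      show "integrable N (\<lambda>\<omega>. indicator (A - E) \<omega> * ?B k (Suc j) \<omega>)"
        using EN AN bm bb by (auto intro!: integrable_indicator_bounded[where K=K])
      show "0 \<le> indicator (A - E) \<omega> * ?B k (Suc j) \<omega>" for \<omega>
        using bb[of k "Suc j" \<omega>] by simp
    qed (auto simp: b_def indicator_def intro!: mult_left_mono)
    finally show ?thesis .
  qed
  ultimately show ?case
    using integral_split_set[OF AN EN pm pb] integral_split_set[OF AN EN bm[of k "Suc j"] bb[of k "Suc j"]]
    by (simp add: b_def)
qed

text \<open>Stopping at the first date at which the payoff is at least the continuation value is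
  optimal. A single rule serves all events \<open>A\<close> of the starting date.\<close>

lemma ex_grid_stopping_ge_bermudan:
  assumes h: "0 < h" and x: "0 \<le> x" and K: "0 \<le> K" and r: "0 \<le> r"
  shows "\<exists>i. grid_stopping h i \<and> (\<forall>\<omega>. k \<le> i \<omega> \<and> i \<omega> \<le> k + j) \<and>
    (\<forall>A\<in>sets (F (real k * h)).
      (\<integral>\<omega>. indicator A \<omega> * (exp (- r * (real k * h)) *
          bermudan_put (\<mu> h) (exp (- r * h)) K j (x * exp (L (real k * h) \<omega>))) \<partial>N)
      \<le> (\<integral>\<omega>. indicator A \<omega> * grid_payoff r K h x i \<omega> \<partial>N))"
proof (induction j arbitrary: k)
  case 0
  have "space N \<in> sets (F s)" for s
    using sets.top[of "F s"] by (simp add: space_F)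
  then have "grid_stopping h (\<lambda>_. k)"
    by (auto simp: grid_stopping_def)
  then show ?case by (intro exI[of _ "\<lambda>_. k"]) (simp add: grid_payoff_def)
next
  case (Suc j)
  obtain i where i: "grid_stopping h i" and ik: "\<And>\<omega>. Suc k \<le> i \<omega> \<and> i \<omega> \<le> Suc k + j"
    and ige: "\<And>A. A \<in> sets (F (real (Suc k) * h)) \<Longrightarrow>
      (\<integral>\<omega>. indicator A \<omega> * (exp (- r * (real (Suc k) * h)) *
          bermudan_put (\<mu> h) (exp (- r * h)) K j (x * exp (L (real (Suc k) * h) \<omega>))) \<partial>N)
      \<le> (\<integral>\<omega>. indicator A \<omega> * grid_payoff r K h x i \<omega> \<partial>N)"
    using Suc.IH[of "Suc k"] by blast
  define b where "b = bermudan_put (\<mu> h) (exp (- r * h)) K"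
  interpret \<mu>: prob_space "\<mu> h" using h by (rule prob_\<mu>)
  note [measurable_cong] = sets_\<mu>
  have [measurable]: "b j \<in> borel_measurable borel" for j
    unfolding b_def by (intro borel_measurable_bermudan_put prob_\<mu> h sets_\<mu>)
  have [measurable]: "L (real k * h) \<in> borel_measurable (F (real k * h))"
    using h by (intro adapted) auto
  \<comment> \<open>The region of immediate exercise. It is an event of
    \<open>F (real k * h)\<close>, hence the modified rule \<open>i'\<close> is still a grid
    stopping time.\<close>
  define E where "E = {\<omega>\<in>space (F (real k * h)). exp (- r * h) * (\<integral>y. b j (x * exp (L (real k * h) \<omega>) * exp y) \<partial>\<mu> h)
       \<le> max 0 (K - x * exp (L (real k * h) \<omega>))}"
  have "(\<lambda>\<omega>. (\<integral>y. b j (x * exp (L (real k * h) \<omega>) * exp y) \<partial>\<mu> h)) \<in> borel_measurable (F (real k * h))"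
    by measurable
  then have EF: "E \<in> sets (F (real k * h))" unfolding E_def by measurable
  define i' where "i' \<omega> = (if \<omega> \<in> E then k else i \<omega>)" for \<omega>
  have kk: "real k * h \<le> real l * h" if "k \<le> l" for l using h that by (auto intro: mult_right_mono)
  have i': "grid_stopping h i'"
    unfolding grid_stopping_def
  proof
    fix l
    show "{\<omega>\<in>space N. i' \<omega> \<le> l} \<in> sets (F (real l * h))"
    proof (cases "k \<le> l")
      case True
      have "E \<in> sets (F (real l * h))" using EF F_mono[OF kk[OF True]] by auto
      moreover have "{\<omega>\<in>space N. i \<omega> \<le> l} \<in> sets (F (real l * h))" using i by (simp add: grid_stopping_def)
      moreover have "{\<omega>\<in>space N. i' \<omega> \<le> l} = E \<union> {\<omega>\<in>space N. i \<omega> \<le> l}"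
        using True by (auto simp: i'_def E_def space_F)
      ultimately show ?thesis by simp
    next
      case False
      then have "\<not> i' \<omega> \<le> l" for \<omega>
        using ik[of \<omega>] by (auto simp: i'_def)
      then show ?thesis by simp
    qed
  qed
  have i'k: "k \<le> i' \<omega> \<and> i' \<omega> \<le> k + Suc j" for \<omega>
    using ik[of \<omega>] by (auto simp: i'_def)
  let ?B = "\<lambda>k j \<omega>. exp (- r * (real k * h)) * b j (x * exp (L (real k * h) \<omega>))"
  have bm: "?B k j \<in> borel_measurable N" for k j
    unfolding b_def using h by (rule grid_bermudan_measurable)
  have bb: "0 \<le> ?B k j \<omega> \<and> ?B k j \<omega> \<le> K" for k j \<omega>
    unfolding b_def using h x K r by (rule grid_bermudan_bounds)
  have pm: "grid_payoff r K h x i' \<in> borel_measurable N"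
    using i' h by (intro grid_payoff_measurable) auto
  have pb: "0 \<le> grid_payoff r K h x i' \<omega> \<and> grid_payoff r K h x i' \<omega> \<le> K" for \<omega>
    using grid_payoff_bounds r K h x by auto
  have "(\<integral>\<omega>. indicator A \<omega> * ?B k (Suc j) \<omega> \<partial>N) \<le> (\<integral>\<omega>. indicator A \<omega> * grid_payoff r K h x i' \<omega> \<partial>N)"
    if A: "A \<in> sets (F (real k * h))" for A
  proof -
    have EN: "E \<in> sets N" and AN: "A \<in> sets N" using EF A F_subset by auto
    have 1: "(\<integral>\<omega>. indicator (A \<inter> E) \<omega> * ?B k (Suc j) \<omega> \<partial>N) = (\<integral>\<omega>. indicator (A \<inter> E) \<omega> * grid_payoff r K h x i' \<omega> \<partial>N)"
      by (rule Bochner_Integration.integral_cong)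
         (auto simp: indicator_def i'_def grid_payoff_def E_def b_def max_def)
    have A2: "A - E \<in> sets (F (real k * h))" using EF A by auto
    have "(\<integral>\<omega>. indicator (A - E) \<omega> * ?B k (Suc j) \<omega> \<partial>N)
       = (\<integral>\<omega>. indicator (A - E) \<omega> * (exp (- r * (real k * h)) * (exp (- r * h) *
             (\<integral>y. b j (x * exp (L (real k * h) \<omega>) * exp y) \<partial>\<mu> h))) \<partial>N)"
      by (rule Bochner_Integration.integral_cong)
         (auto simp: indicator_def E_def space_F b_def max_def)
    also have "\<dots> = (\<integral>\<omega>. indicator (A - E) \<omega> * ?B (Suc k) j \<omega> \<partial>N)"
      unfolding b_def using h A2 x K r by (rule continuation_value_bermudan[symmetric])
    also have "\<dots> \<le> (\<integral>\<omega>. indicator (A - E) \<omega> * grid_payoff r K h x i \<omega> \<partial>N)"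
      unfolding b_def using A2 F_mono[OF kk[of "Suc k"]] by (intro ige) auto
    also have "\<dots> = (\<integral>\<omega>. indicator (A - E) \<omega> * grid_payoff r K h x i' \<omega> \<partial>N)"
      by (rule Bochner_Integration.integral_cong) (auto simp: indicator_def i'_def grid_payoff_def)
    finally show ?thesis
      using 1 integral_split_set[OF AN EN pm pb] integral_split_set[OF AN EN bm[of k "Suc j"] bb[of k "Suc j"]]
      by simp
  qed
  then show ?case using i' i'k unfolding b_def by blast
qed

end

section \<open>American puts as limits of Bermudan puts\<close>

context levy_stopping
begin

text \<open>Along finer and finer grids the rounded stopping times have payoffs bounded by
  \<open>K\<close> that converge pointwise, so dominated convergence carries the Bermudan bounds
  over to \<open>\<tau>\<close>.\<close>

lemma stopping_time_payoff_le:
  assumes \<tau>: "stopping_time F \<tau>" and \<tau>_bd: "\<And>\<omega>. \<omega> \<in> space N \<Longrightarrow> 0 \<le> \<tau> \<omega> \<and> \<tau> \<omega> \<le> \<theta>"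
    and \<theta>: "0 < \<theta>" and x: "0 \<le> x" and K: "0 \<le> K" and r: "0 \<le> r"
    and le: "eventually (\<lambda>n. bermudan_put (\<mu> (\<theta> / real n)) (exp (- r * (\<theta> / real n))) K n x \<le> c) sequentially"
  shows "(\<integral>\<omega>. exp (- r * \<tau> \<omega>) * max 0 (K - x * exp (L (\<tau> \<omega>) \<omega>)) \<partial>N) \<le> c"
proof -
  \<comment> \<open>Rounding up, not down: \<open>i n \<omega> \<le> k\<close> then means
    \<open>\<tau> \<omega> \<le> k \<theta> / n\<close>, which is known at that time, and the grid
    times approach \<open>\<tau> \<omega>\<close> from the right, where the paths are
    continuous.\<close>
  define i where "i n \<omega> = nat \<lceil>\<tau> \<omega> * real n / \<theta>\<rceil>" for n \<omega>
  have stop: "grid_stopping (\<theta> / real n) (i n)" if n: "0 < n" for n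
    unfolding grid_stopping_def
  proof
    fix k
    have "{\<omega>\<in>space N. i n \<omega> \<le> k} = {\<omega>\<in>space (F (real k * (\<theta> / real n))). \<tau> \<omega> \<le> real k * (\<theta> / real n)}"
      unfolding space_F
    proof (rule Collect_cong)
      fix \<omega>
      have "i n \<omega> \<le> k \<longleftrightarrow> \<tau> \<omega> * real n / \<theta> \<le> real k"
        unfolding i_def by (rule nat_ceiling_le_eq)
      also have "\<dots> \<longleftrightarrow> \<tau> \<omega> \<le> real k * (\<theta> / real n)"
        using n \<theta> by (simp add: field_simps)
      finally show "(\<omega> \<in> space N \<and> i n \<omega> \<le> k) = (\<omega> \<in> space N \<and> \<tau> \<omega> \<le> real k * (\<theta> / real n))" by simp
    qed
    then show "{\<omega>\<in>space N. i n \<omega> \<le> k} \<in> sets (F (real k * (\<theta> / real n)))"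
      using stopping_timeD[OF \<tau>, of "real k * (\<theta> / real n)"] by (simp add: pred_def)
  qed
  let ?p = "\<lambda>n. grid_payoff r K (\<theta> / real n) x (i n)"
  have meas: "?p n \<in> borel_measurable N" if "0 < n" for n
    using stop[OF that] \<theta> by (intro grid_payoff_measurable) auto
  have lim: "(\<lambda>n. ?p n \<omega>) \<longlonglongrightarrow> exp (- r * \<tau> \<omega>) * max 0 (K - x * exp (L (\<tau> \<omega>) \<omega>))" if w: "\<omega> \<in> space N" for \<omega>
  proof -
    have \<tau>0: "0 \<le> \<tau> \<omega>" using \<tau>_bd[OF w] by auto
    \<comment> \<open>The shift to \<open>Suc n\<close> excludes the mesh
      \<open>\<theta> / 0\<close>, whose value is \<open>0\<close> by convention.\<close>
    define t where "t n = real (i (Suc n) \<omega>) * (\<theta> / real (Suc n))" for n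
    have t_ge: "\<tau> \<omega> \<le> t n" for n
    proof -
      have "\<tau> \<omega> * real (Suc n) / \<theta> \<le> real (i (Suc n) \<omega>)" unfolding i_def by linarith
      then show ?thesis using \<theta> by (simp add: t_def field_simps)
    qed
    have t_le: "t n \<le> \<tau> \<omega> + \<theta> / real (Suc n)" for n
    proof -
      have "0 \<le> \<tau> \<omega> * real (Suc n) / \<theta>" using \<tau>0 \<theta> by simp
      then have "real (i (Suc n) \<omega>) \<le> \<tau> \<omega> * real (Suc n) / \<theta> + 1" unfolding i_def by linarith
      then have "real (i (Suc n) \<omega>) * (\<theta> / real (Suc n)) \<le> (\<tau> \<omega> * real (Suc n) / \<theta> + 1) * (\<theta> / real (Suc n))"
        using \<theta> by (intro mult_right_mono) auto
      also have "\<dots> = \<tau> \<omega> + \<theta> / real (Suc n)"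
        using \<theta> by (subst distrib_right) (simp del: of_nat_Suc)
      finally show ?thesis by (simp add: t_def)
    qed
    have "(\<lambda>n. \<tau> \<omega> + \<theta> / real (Suc n)) \<longlonglongrightarrow> \<tau> \<omega> + 0"
      by (intro tendsto_add tendsto_const LIMSEQ_Suc[OF lim_const_over_n])
    then have upper: "(\<lambda>n. \<tau> \<omega> + \<theta> / real (Suc n)) \<longlonglongrightarrow> \<tau> \<omega>" by simp
    have t: "t \<longlonglongrightarrow> \<tau> \<omega>"
      by (rule tendsto_sandwich[OF _ _ tendsto_const upper]) (simp_all add: t_ge t_le del: of_nat_Suc)
    have "continuous (at (\<tau> \<omega>) within {\<tau> \<omega>..}) (\<lambda>u. L u \<omega>)"
      using right_cont[OF w \<tau>0] by (simp add: at_within_Ici_at_right)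
    then have L: "(\<lambda>n. L (t n) \<omega>) \<longlonglongrightarrow> L (\<tau> \<omega>) \<omega>"
      by (rule continuous_within_tendsto_compose') (use t_ge t in auto)
    have "(\<lambda>n. exp (- r * t n) * max 0 (K - x * exp (L (t n) \<omega>))) \<longlonglongrightarrow> exp (- r * \<tau> \<omega>) * max 0 (K - x * exp (L (\<tau> \<omega>) \<omega>))"
      by (intro tendsto_intros t L)
    then have "(\<lambda>n. ?p (Suc n) \<omega>) \<longlonglongrightarrow> exp (- r * \<tau> \<omega>) * max 0 (K - x * exp (L (\<tau> \<omega>) \<omega>))"
      by (simp add: grid_payoff_def t_def)
    then show ?thesis by (rule LIMSEQ_imp_Suc)
  qed
  \<comment> \<open>The stopped payoff inherits measurability from the grid payoffs as their
    pointwise limit, so no joint measurability of \<open>L\<close> in time and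
    \<open>\<omega>\<close> is called for.\<close>
  have lim_meas: "(\<lambda>\<omega>. exp (- r * \<tau> \<omega>) * max 0 (K - x * exp (L (\<tau> \<omega>) \<omega>))) \<in> borel_measurable N"
  proof (rule borel_measurable_LIMSEQ_metric)
    show "?p (Suc n) \<in> borel_measurable N" for n by (rule meas) simp
    show "(\<lambda>n. ?p (Suc n) \<omega>) \<longlonglongrightarrow> exp (- r * \<tau> \<omega>) * max 0 (K - x * exp (L (\<tau> \<omega>) \<omega>))"
      if "\<omega> \<in> space N" for \<omega>
      using lim[OF that] by (rule LIMSEQ_Suc)
  qed
  have "(\<lambda>n. \<integral>\<omega>. ?p (Suc n) \<omega> \<partial>N) \<longlonglongrightarrow> (\<integral>\<omega>. exp (- r * \<tau> \<omega>) * max 0 (K - x * exp (L (\<tau> \<omega>) \<omega>)) \<partial>N)"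
  proof (rule integral_dominated_convergence[where w="\<lambda>_. K"])
    show "AE \<omega> in N. (\<lambda>n. ?p (Suc n) \<omega>) \<longlonglongrightarrow> exp (- r * \<tau> \<omega>) * max 0 (K - x * exp (L (\<tau> \<omega>) \<omega>))"
      using lim by (intro AE_I2 LIMSEQ_Suc) auto
    show "AE \<omega> in N. norm (?p (Suc n) \<omega>) \<le> K" for n
      using grid_payoff_bounds[OF r K _ x] \<theta> by (intro AE_I2) (simp add: abs_of_nonneg)
    show "?p (Suc n) \<in> borel_measurable N" for n by (rule meas) simp
  qed (rule lim_meas, simp)
  moreover have "eventually (\<lambda>n. (\<integral>\<omega>. ?p (Suc n) \<omega> \<partial>N) \<le> c) sequentially"
  proof -
    have "(\<integral>\<omega>. ?p (Suc n) \<omega> \<partial>N) \<le> bermudan_put (\<mu> (\<theta> / real (Suc n))) (exp (- r * (\<theta> / real (Suc n)))) K (Suc n) x" for n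
    proof -
      define h where "h = \<theta> / real (Suc n)"
      have h: "0 < h" using \<theta> by (simp add: h_def)
      have sp: "space N \<in> sets (F (real 0 * h))" using sets.top[of "F (real 0 * h)"] by (simp add: space_F)
      have "(\<integral>\<omega>. ?p (Suc n) \<omega> \<partial>N) = (\<integral>\<omega>. indicator (space N) \<omega> * ?p (Suc n) \<omega> \<partial>N)"
        by (rule Bochner_Integration.integral_cong) auto
      also have "\<dots> \<le> (\<integral>\<omega>. indicator (space N) \<omega> * (exp (- r * (real 0 * h)) *
          bermudan_put (\<mu> h) (exp (- r * h)) K (Suc n) (x * exp (L (real 0 * h) \<omega>))) \<partial>N)"
        unfolding h_def[symmetric]
      proof (rule grid_stopping_le_bermudan[OF h x K r _ sp])
        show "grid_stopping h (i (Suc n))" unfolding h_def by (rule stop) simp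
        fix \<omega> assume "\<omega> \<in> space N"
        then have "\<tau> \<omega> \<le> \<theta>" using \<tau>_bd by auto
        then have "\<tau> \<omega> * real (Suc n) / \<theta> \<le> real (Suc n)"
          using \<theta> mult_right_mono[of "\<tau> \<omega>" \<theta> "real (Suc n)"]
          by (simp add: pos_divide_le_eq mult.commute del: of_nat_Suc)
        then have "i (Suc n) \<omega> \<le> Suc n" unfolding i_def by (subst nat_ceiling_le_eq)
        then show "0 \<le> i (Suc n) \<omega> \<and> i (Suc n) \<omega> \<le> 0 + Suc n" by simp
      qed
      also have "\<dots> = (\<integral>\<omega>. bermudan_put (\<mu> h) (exp (- r * h)) K (Suc n) x \<partial>N)"
        by (rule Bochner_Integration.integral_cong) (simp_all add: L_0 del: bermudan_put.simps)
      finally show ?thesis by (simp add: h_def prob_space del: bermudan_put.simps)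
    qed
    moreover have "eventually (\<lambda>n. bermudan_put (\<mu> (\<theta> / real (Suc n))) (exp (- r * (\<theta> / real (Suc n)))) K (Suc n) x \<le> c) sequentially"
      using le by (subst eventually_sequentially_Suc)
    ultimately show ?thesis
      by (auto elim!: eventually_mono intro: order_trans simp del: bermudan_put.simps)
  qed
  ultimately show ?thesis by (rule tendsto_upperbound) simp
qed

lemma ex_stopping_time_ge_bermudan:
  assumes \<theta>: "0 < \<theta>" and n: "0 < n" and x: "0 \<le> x" and K: "0 \<le> K" and r: "0 \<le> r"
  shows "\<exists>\<tau>. stopping_time F \<tau> \<and> (\<forall>\<omega>. 0 \<le> \<tau> \<omega> \<and> \<tau> \<omega> \<le> \<theta>) \<and>
    bermudan_put (\<mu> (\<theta> / real n)) (exp (- r * (\<theta> / real n))) K n x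
      \<le> (\<integral>\<omega>. exp (- r * \<tau> \<omega>) * max 0 (K - x * exp (L (\<tau> \<omega>) \<omega>)) \<partial>N)"
proof -
  define h where "h = \<theta> / real n"
  have h: "0 < h" using \<theta> n by (simp add: h_def)
  have sp: "space N \<in> sets (F s)" for s using sets.top[of "F s"] by (simp add: space_F)
  obtain i where i: "grid_stopping h i" and ik: "\<And>\<omega>. i \<omega> \<le> n"
    and ige: "\<And>A. A \<in> sets (F (real 0 * h)) \<Longrightarrow>
      (\<integral>\<omega>. indicator A \<omega> * (exp (- r * (real 0 * h)) *
          bermudan_put (\<mu> h) (exp (- r * h)) K n (x * exp (L (real 0 * h) \<omega>))) \<partial>N)
      \<le> (\<integral>\<omega>. indicator A \<omega> * grid_payoff r K h x i \<omega> \<partial>N)"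
    using ex_grid_stopping_ge_bermudan[OF h x K r, of 0 n] by auto
  define \<tau> where "\<tau> \<omega> = real (i \<omega>) * h" for \<omega>
  have "stopping_time F \<tau>"
  proof (rule stopping_timeI)
    fix t
    show "Measurable.pred (F t) (\<lambda>\<omega>. \<tau> \<omega> \<le> t)"
    proof (cases "0 \<le> t")
      case True
      \<comment> \<open>The last grid index not after \<open>t\<close>. As \<open>\<tau>\<close>
        takes values on the grid, \<open>\<tau> \<omega> \<le> t\<close> says that
        \<open>i \<omega> \<le> k\<close>, an event already known at
        \<open>k h \<le> t\<close>.\<close>
      define k where "k = nat \<lfloor>t / h\<rfloor>"
      have k: "real k * h \<le> t"
      proof -
        have "real k \<le> t / h" using True h unfolding k_def by simp
        then show ?thesis using h by (simp add: field_simps)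
      qed
      have "{\<omega>\<in>space (F t). \<tau> \<omega> \<le> t} = {\<omega>\<in>space N. i \<omega> \<le> k}"
        unfolding space_F
      proof (rule Collect_cong)
        fix \<omega>
        have "\<tau> \<omega> \<le> t \<longleftrightarrow> real (i \<omega>) \<le> t / h" using h by (simp add: \<tau>_def field_simps)
        also have "\<dots> \<longleftrightarrow> i \<omega> \<le> k"
          using True h by (simp add: k_def le_nat_iff le_floor_iff)
        finally show "(\<omega> \<in> space N \<and> \<tau> \<omega> \<le> t) = (\<omega> \<in> space N \<and> i \<omega> \<le> k)" by simp
      qed
      moreover have "{\<omega>\<in>space N. i \<omega> \<le> k} \<in> sets (F t)"
        using i F_mono[OF k] by (auto simp: grid_stopping_def)
      ultimately show ?thesis by (simp add: pred_def)
    next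
      case False
      then have "\<not> \<tau> \<omega> \<le> t" for \<omega>
        using h by (auto simp: \<tau>_def not_le intro!: less_le_trans[of t 0])
      then show ?thesis by simp
    qed
  qed
  moreover have "0 \<le> \<tau> \<omega> \<and> \<tau> \<omega> \<le> \<theta>" for \<omega>
  proof -
    have "real (i \<omega>) * h \<le> real n * h" using ik[of \<omega>] h by (intro mult_right_mono) auto
    then show ?thesis using \<theta> n by (simp add: \<tau>_def h_def)
  qed
  moreover have "bermudan_put (\<mu> h) (exp (- r * h)) K n x
      \<le> (\<integral>\<omega>. exp (- r * \<tau> \<omega>) * max 0 (K - x * exp (L (\<tau> \<omega>) \<omega>)) \<partial>N)"
  proof -
    have "bermudan_put (\<mu> h) (exp (- r * h)) K n x = (\<integral>\<omega>. bermudan_put (\<mu> h) (exp (- r * h)) K n x \<partial>N)"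
      by (simp add: prob_space)
    also have "\<dots> = (\<integral>\<omega>. indicator (space N) \<omega> * (exp (- r * (real 0 * h)) *
          bermudan_put (\<mu> h) (exp (- r * h)) K n (x * exp (L (real 0 * h) \<omega>))) \<partial>N)"
      by (rule Bochner_Integration.integral_cong) (simp_all add: L_0)
    also have "\<dots> \<le> (\<integral>\<omega>. indicator (space N) \<omega> * grid_payoff r K h x i \<omega> \<partial>N)"
      by (rule ige) (rule sp)
    also have "\<dots> = (\<integral>\<omega>. exp (- r * \<tau> \<omega>) * max 0 (K - x * exp (L (\<tau> \<omega>) \<omega>)) \<partial>N)"
      by (rule Bochner_Integration.integral_cong) (simp_all add: \<tau>_def grid_payoff_def)
    finally show ?thesis .
  qed
  ultimately show ?thesis unfolding h_def by blast
qed

end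

lemma american_put_le:
  assumes "levy_stopping (completion M) F L \<mu>" and "t < T" and x: "0 \<le> x" and K: "0 \<le> K" and r: "0 \<le> r"
    and le: "eventually (\<lambda>n. bermudan_put (\<mu> ((T - t) / real n)) (exp (- r * ((T - t) / real n))) K n x \<le> c) sequentially"
  shows "american_put M F (\<lambda>x s \<omega>. x * exp (L s \<omega>)) r K T t x \<le> c"
proof -
  interpret levy_stopping "completion M" F L \<mu> by fact
  \<comment> \<open>A supremum of reals over an empty set is unspecified, so some stopping time must
    be exhibited; a grid with one step provides it.\<close>
  obtain \<tau> where "stopping_time F \<tau>" "\<forall>\<omega>. 0 \<le> \<tau> \<omega> \<and> \<tau> \<omega> \<le> T - t"
    using ex_stopping_time_ge_bermudan[of "T - t" 1 x K r] assms by auto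
  then have ne: "{\<tau>. stopping_time F \<tau> \<and> (\<forall>\<omega>\<in>space M. 0 \<le> \<tau> \<omega> \<and> \<tau> \<omega> \<le> T - t)} \<noteq> {}"
    by auto
  show ?thesis
    unfolding american_put_def
  proof (rule cSUP_least[OF ne])
    fix \<tau> assume "\<tau> \<in> {\<tau>. stopping_time F \<tau> \<and> (\<forall>\<omega>\<in>space M. 0 \<le> \<tau> \<omega> \<and> \<tau> \<omega> \<le> T - t)}"
    then show "(\<integral>\<omega>. exp (- r * \<tau> \<omega>) * max 0 (K - x * exp (L (\<tau> \<omega>) \<omega>)) \<partial>completion M) \<le> c"
      using \<open>t < T\<close> by (intro stopping_time_payoff_le[OF _ _ _ x K r le]) auto
  qed
qed

lemma bermudan_le_american_put:
  assumes "levy_stopping (completion M) F L \<mu>" and t: "t < T" and x: "0 \<le> x" and K: "0 \<le> K" and r: "0 \<le> r" and n: "0 < n"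
  shows "bermudan_put (\<mu> ((T - t) / real n)) (exp (- r * ((T - t) / real n))) K n x
     \<le> american_put M F (\<lambda>x s \<omega>. x * exp (L s \<omega>)) r K T t x"
proof -
  interpret levy_stopping "completion M" F L \<mu> by fact
  let ?S = "{\<tau>. stopping_time F \<tau> \<and> (\<forall>\<omega>\<in>space M. 0 \<le> \<tau> \<omega> \<and> \<tau> \<omega> \<le> T - t)}"
  let ?I = "\<lambda>\<tau>. integral\<^sup>L (completion M) (\<lambda>\<omega>. exp (- r * \<tau> \<omega>) * max 0 (K - x * exp (L (\<tau> \<omega>) \<omega>)))"
  obtain \<tau> where \<tau>: "\<tau> \<in> ?S"
    and le: "bermudan_put (\<mu> ((T - t) / real n)) (exp (- r * ((T - t) / real n))) K n x \<le> ?I \<tau>"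
    using ex_stopping_time_ge_bermudan[of "T - t" n x K r] assms by auto
  \<comment> \<open>A supremum of reals is an upper bound only for families bounded above. Here
    \<open>K\<close> bounds every payoff, again by comparison with Bermudan values.\<close>
  have "bdd_above (?I ` ?S)"
  proof (rule bdd_aboveI2)
    fix \<tau> assume \<tau>S: "\<tau> \<in> ?S"
    have ev: "eventually (\<lambda>n. bermudan_put (\<mu> ((T - t) / real n)) (exp (- r * ((T - t) / real n))) K n x \<le> K) sequentially"
      using eventually_gt_at_top[of 0]
    proof eventually_elim
      case (elim n)
      then show ?case using t r by (intro bermudan_put_le prob_\<mu> sets_\<mu> x K) auto
    qed
    show "?I \<tau> \<le> K"
      using t \<tau>S by (intro stopping_time_payoff_le[OF _ _ _ x K r ev]) auto
  qed
  then have "?I \<tau> \<le> (SUP \<tau>\<in>?S. ?I \<tau>)" using \<tau> by (intro cSUP_upper)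
  then show ?thesis using le unfolding american_put_def by linarith
qed

section \<open>Increments and the usual filtration\<close>

text \<open>The sets in \<open>nat_gen\<close> constrain a single time and are not closed under
  intersection. These are, and they generate the same sigma-algebra, so independence need only be
  checked on them.\<close>

definition cylinder_events :: "'a measure \<Rightarrow> (real \<Rightarrow> 'a \<Rightarrow> real) \<Rightarrow> real \<Rightarrow> 'a set set" where
  "cylinder_events M X u =
     {{\<omega>\<in>space M. \<forall>v\<in>J. X v \<omega> \<in> A v} | J A. finite J \<and> J \<subseteq> {0..u} \<and> (\<forall>v. A v \<in> sets borel)}"

lemma Int_stable_cylinder_events: "Int_stable (cylinder_events M X u)"
proof (rule Int_stableI)
  fix a b assume "a \<in> cylinder_events M X u" "b \<in> cylinder_events M X u"
  then obtain J A J' A' where a: "a = {\<omega>\<in>space M. \<forall>v\<in>J. X v \<omega> \<in> A v}" "finite J" "J \<subseteq> {0..u}" "\<And>v. A v \<in> sets borel"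
    and b: "b = {\<omega>\<in>space M. \<forall>v\<in>J'. X v \<omega> \<in> A' v}" "finite J'" "J' \<subseteq> {0..u}" "\<And>v. A' v \<in> sets borel"
    by (auto simp: cylinder_events_def)
  define C where "C v = (if v \<in> J then A v else UNIV) \<inter> (if v \<in> J' then A' v else UNIV)" for v
  have "a \<inter> b = {\<omega>\<in>space M. \<forall>v\<in>J \<union> J'. X v \<omega> \<in> C v}" using a(1) b(1) by (auto simp: C_def)
  moreover have "C v \<in> sets borel" for v using a(4) b(4) by (auto simp: C_def)
  ultimately show "a \<inter> b \<in> cylinder_events M X u"
    unfolding cylinder_events_def using a b by (intro CollectI exI[of _ "J \<union> J'"] exI[of _ C]) auto
qed

lemma nat_gen_subset_cylinder_events: "nat_gen M X u \<subseteq> cylinder_events M X u"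
proof
  fix a assume "a \<in> nat_gen M X u"
  then obtain s A where "a = {\<omega>\<in>space M. X s \<omega> \<in> A}" "s \<in> {0..u}" "A \<in> sets borel"
    by (auto simp: nat_gen_def)
  then show "a \<in> cylinder_events M X u"
    unfolding cylinder_events_def by (intro CollectI exI[of _ "{s}"] exI[of _ "\<lambda>_. A"]) auto
qed

text \<open>The values of \<open>X\<close> at finitely many times up to \<open>s\<close> are partial
  sums of increments along an ordered grid, and the increment from \<open>s\<close> to
  \<open>u\<close> is one further, independent increment of that grid.\<close>

lemma levy_process_cylinder_indep:
  assumes X: "levy_process M X" and s: "0 \<le> s" "s \<le> u"
    and a: "a \<in> cylinder_events M X s" and D: "D \<in> sets borel"
  shows "measure M (a \<inter> {\<omega>\<in>space M. X u \<omega> - X s \<omega> \<in> D})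
    = measure M a * measure M {\<omega>\<in>space M. X u \<omega> - X s \<omega> \<in> D}"
proof -
  interpret prob_space M using X by (simp add: levy_process_def)
  have [measurable]: "X v \<in> borel_measurable M" for v using X by (simp add: levy_process_def)
  obtain J A where aJ: "a = {\<omega>\<in>space M. \<forall>v\<in>J. X v \<omega> \<in> A v}" and J: "finite J" "J \<subseteq> {0..s}" and A: "\<And>v. A v \<in> sets borel"
    using a by (auto simp: cylinder_events_def)
  \<comment> \<open>With \<open>0\<close> in the grid the partial sums start where the process
    vanishes; with \<open>s\<close> in it the step after the last grid point runs exactly from
    \<open>s\<close> to \<open>u\<close>.\<close>
  define J' where "J' = insert 0 (insert s J)"
  define l where "l = sorted_list_of_set J'"
  have fin: "finite J'" using J by (simp add: J'_def)
  have set_l: "set l = J'" and sl: "sorted l" using fin by (simp_all add: l_def)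
  have J's: "J' \<subseteq> {0..s}" using J s by (auto simp: J'_def)
  have lne: "l \<noteq> []" using set_l by (auto simp: J'_def)
  define n where "n = length l - 1"
  have len: "length l = Suc n" using lne by (simp add: n_def)
  \<comment> \<open>\<open>levy_process\<close> speaks of monotone sequences indexed by all
    naturals, so the finite list is continued by the constant \<open>u\<close>.\<close>
  define t where "t i = (if i < length l then l ! i else u)" for i
  have l_in: "l ! i \<in> {0..s}" if "i < length l" for i
    using that J's set_l nth_mem[OF that] by auto
  have mono: "mono t"
  proof (rule monoI)
    fix i j :: nat assume "i \<le> j"
    then show "t i \<le> t j"
      using sorted_nth_mono[OF sl] l_in[of i] s by (auto simp: t_def)
  qed
  have t0: "t 0 = 0"
  proof -
    obtain i where "i < length l" "l ! i = 0" using set_l by (metis J'_def in_set_conv_nth insertI1)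
    then have "l ! 0 \<le> 0" using sorted_nth_mono[OF sl, of 0 i] by auto
    then show ?thesis using l_in[of 0] len by (auto simp: t_def)
  qed
  have tn: "t n = s"
  proof -
    obtain i where "i < length l" "l ! i = s" using set_l by (metis J'_def in_set_conv_nth insertI1 insertI2)
    then have "s \<le> l ! n" using sorted_nth_mono[OF sl, of i n] len by auto
    then show ?thesis using l_in[of n] len by (auto simp: t_def)
  qed
  have tSn: "t (Suc n) = u" by (simp add: t_def len)
  define Y where "Y i \<omega> = X (t (Suc i)) \<omega> - X (t i) \<omega>" for i \<omega>
  have "indep_vars (\<lambda>_. borel) Y {..<Suc n}"
    using X t0 mono unfolding levy_process_def Y_def by auto
  then have ind: "indep_var (PiM {..<n} (\<lambda>_. borel)) (\<lambda>\<omega>. restrict (\<lambda>i. Y i \<omega>) {..<n})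
      (PiM {n} (\<lambda>_. borel)) (\<lambda>\<omega>. restrict (\<lambda>i. Y i \<omega>) {n})"
    by (rule indep_var_restrict) auto
  have "\<exists>k\<le>n. t k = v" if "v \<in> J" for v
  proof -
    have "v \<in> set l" using that by (simp add: set_l J'_def)
    then obtain k where "k < length l" "l ! k = v" by (auto simp: in_set_conv_nth)
    then show ?thesis using len by (intro exI[of _ k]) (auto simp: t_def)
  qed
  then obtain k where k: "\<And>v. v \<in> J \<Longrightarrow> k v \<le> n \<and> t (k v) = v" by metis
  have tele: "X v \<omega> = (\<Sum>i<k v. Y i \<omega>)" if "v \<in> J" "\<omega> \<in> space M" for v \<omega>
  proof -
    have "(\<Sum>i<k v. Y i \<omega>) = X (t (k v)) \<omega> - X (t 0) \<omega>"
      unfolding Y_def by (rule sum_lessThan_telescope)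
    then show ?thesis using k[OF that(1)] that(2) t0 X by (simp add: levy_process_def)
  qed
  define Xa where "Xa = {f\<in>space (PiM {..<n} (\<lambda>_. borel)). \<forall>v\<in>J. (\<Sum>i<k v. f i :: real) \<in> A v}"
  define Xb where "Xb = {f\<in>space (PiM {n} (\<lambda>_. borel :: real measure)). f n \<in> D}"
  have "Xa \<in> sets (PiM {..<n} (\<lambda>_. borel))"
  proof -
    have [measurable]: "(\<lambda>f. \<Sum>i<k v. f i :: real) \<in> borel_measurable (PiM {..<n} (\<lambda>_. borel))" if "v \<in> J" for v
      using k[OF that] by (intro borel_measurable_sum measurable_component_singleton) auto
    show ?thesis
      unfolding Xa_def using J(1) A
      by (intro sets.sets_Collect_finite_All) (auto intro: measurable_sets_Collect)
  qed
  moreover have "Xb \<in> sets (PiM {n} (\<lambda>_. borel))"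
    unfolding Xb_def using D by (auto intro!: measurable_sets_Collect[where N=borel] measurable_component_singleton)
  ultimately have *: "prob ((\<lambda>x. (restrict (\<lambda>i. Y i x) {..<n}, restrict (\<lambda>i. Y i x) {n})) -` (Xa \<times> Xb) \<inter> space M) =
    prob ((\<lambda>x. restrict (\<lambda>i. Y i x) {..<n}) -` Xa \<inter> space M) * prob ((\<lambda>x. restrict (\<lambda>i. Y i x) {n}) -` Xb \<inter> space M)"
    using indep_varD[OF ind] by blast
  have sum_restrict: "(\<Sum>i<k v. restrict (\<lambda>i. Y i \<omega>) {..<n} i) = (\<Sum>i<k v. Y i \<omega>)" if "v \<in> J" for v \<omega>
    using k[OF that] by (intro sum.cong) auto
  have ea: "(\<lambda>x. restrict (\<lambda>i. Y i x) {..<n}) -` Xa \<inter> space M = a"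
    unfolding Xa_def aJ using tele sum_restrict by (auto simp: space_PiM)
  have eb: "(\<lambda>x. restrict (\<lambda>i. Y i x) {n}) -` Xb \<inter> space M = {\<omega>\<in>space M. X u \<omega> - X s \<omega> \<in> D}"
    unfolding Xb_def by (auto simp: space_PiM Y_def tn tSn)
  have "(\<lambda>x. (restrict (\<lambda>i. Y i x) {..<n}, restrict (\<lambda>i. Y i x) {n})) -` (Xa \<times> Xb) \<inter> space M
     = ((\<lambda>x. restrict (\<lambda>i. Y i x) {..<n}) -` Xa \<inter> space M) \<inter> ((\<lambda>x. restrict (\<lambda>i. Y i x) {n}) -` Xb \<inter> space M)"
    by auto
  then show ?thesis using * unfolding ea eb by simp
qed

lemma levy_process_nat_gen_indep:
  assumes X: "levy_process M X" and s: "0 \<le> s" "s \<le> u"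
    and a: "a \<in> sigma_sets (space M) (nat_gen M X s)" and D: "D \<in> sets borel"
  shows "measure M (a \<inter> {\<omega>\<in>space M. X u \<omega> - X s \<omega> \<in> D})
    = measure M a * measure M {\<omega>\<in>space M. X u \<omega> - X s \<omega> \<in> D}"
proof -
  interpret prob_space M using X by (simp add: levy_process_def)
  have X_meas[measurable]: "X v \<in> borel_measurable M" for v using X by (simp add: levy_process_def)
  let ?B = "{{\<omega>\<in>space M. X u \<omega> - X s \<omega> \<in> D}}"
  have "indep_set (sigma_sets (space M) (cylinder_events M X s)) (sigma_sets (space M) ?B)"
  proof (rule indep_set_sigma_sets)
    show "indep_set (cylinder_events M X s) ?B"
    proof (rule indep_setI)
      show "cylinder_events M X s \<subseteq> events"
      proof
        fix a assume "a \<in> cylinder_events M X s"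
        then obtain J A where "a = {\<omega>\<in>space M. \<forall>v\<in>J. X v \<omega> \<in> A v}" "finite J" "\<And>v. A v \<in> sets borel"
          by (auto simp: cylinder_events_def)
        then show "a \<in> events"
          by (auto intro!: sets.sets_Collect_finite_All measurable_sets_Collect[OF X_meas])
      qed
      show "?B \<subseteq> events" using D by (auto intro!: measurable_sets_Collect[where N=borel])
    qed (use levy_process_cylinder_indep[OF X s _ D] in auto)
  qed (rule Int_stable_cylinder_events, simp add: Int_stable_def)
  moreover have "a \<in> sigma_sets (space M) (cylinder_events M X s)"
    using a sigma_sets_mono'[OF nat_gen_subset_cylinder_events, of "space M" M X s] by auto
  ultimately show ?thesis by (auto intro: indep_setD)
qed

text \<open>The sets that agree with a set of the generated sigma-algebra up to a null set are
  closed under complements and countable unions. Hence adding null sets to the generators changes no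
  probability, and independence survives the augmentation.\<close>

lemma sigma_sets_null_sets_approx:
  assumes G: "G \<subseteq> sets M" and A: "A \<in> sigma_sets (space M) (G \<union> null_sets (completion M))"
  shows "\<exists>A0\<in>sigma_sets (space M) G. (A - A0) \<union> (A0 - A) \<in> null_sets (completion M)"
  using A
proof (induction rule: sigma_sets.induct)
  case (Basic a)
  then show ?case
  proof
    assume "a \<in> G"
    then show ?thesis by (intro bexI[of _ a]) (auto intro: sigma_sets.Basic)
  next
    assume "a \<in> null_sets (completion M)"
    then show ?thesis by (intro bexI[of _ "{}"]) (auto intro: sigma_sets.Empty)
  qed
next
  case Empty
  then show ?case by (intro bexI[of _ "{}"]) (auto intro: sigma_sets.Empty)
next
  case (Compl a)
  then obtain A0 where A0: "A0 \<in> sigma_sets (space M) G" "(a - A0) \<union> (A0 - a) \<in> null_sets (completion M)" by auto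
  have "A0 \<in> sets M" using sets.sigma_sets_subset[OF G] A0(1) by auto
  then have sub: "A0 \<subseteq> space M" by (rule sets.sets_into_space)
  have "a - A0 \<subseteq> space M"
    using A0(2) sets.sets_into_space[of _ "completion M"] by (metis null_setsD2 space_completion le_sup_iff)
  then have "((space M - a) - (space M - A0)) \<union> ((space M - A0) - (space M - a)) = (a - A0) \<union> (A0 - a)"
    using sub by auto
  then show ?case using A0 by (intro bexI[of _ "space M - A0"]) (auto intro: sigma_sets.Compl)
next
  case (Union a)
  then obtain A0 where A0: "\<And>i. A0 i \<in> sigma_sets (space M) G" "\<And>i. (a i - A0 i) \<union> (A0 i - a i) \<in> null_sets (completion M)"
    by metis
  have sub: "((\<Union>i. a i) - (\<Union>i. A0 i)) \<union> ((\<Union>i. A0 i) - (\<Union>i. a i)) \<subseteq> (\<Union>i. (a i - A0 i) \<union> (A0 i - a i))"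
    by auto
  have "(\<Union>i. (a i - A0 i) \<union> (A0 i - a i)) \<in> null_sets (completion M)"
    using A0(2) by (rule null_sets_UN)
  from null_sets_completion_subset[OF sub this] show ?case
    using A0(1) by (intro bexI[of _ "\<Union>i. A0 i"]) (auto intro: sigma_sets.Union)
qed

lemma char_distr_tendsto:
  assumes "prob_space N" and [measurable]: "\<And>n. D n \<in> borel_measurable N" "D' \<in> borel_measurable N"
    and lim: "\<And>\<omega>. \<omega> \<in> space N \<Longrightarrow> (\<lambda>n. D n \<omega>) \<longlonglongrightarrow> D' \<omega>"
  shows "(\<lambda>n. char (distr N borel (D n)) t) \<longlonglongrightarrow> char (distr N borel D') t"
proof -
  interpret prob_space N by fact
  have "(\<lambda>n. CLINT \<omega>|N. iexp (t * D n \<omega>)) \<longlonglongrightarrow> (CLINT \<omega>|N. iexp (t * D' \<omega>))"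
  proof (rule integral_dominated_convergence[where w="\<lambda>_. 1"])
    show "AE \<omega> in N. (\<lambda>n. iexp (t * D n \<omega>)) \<longlonglongrightarrow> iexp (t * D' \<omega>)"
      using lim by (intro AE_I2 tendsto_intros) auto
  qed auto
  then show ?thesis by (simp add: char_def integral_distr)
qed

section \<open>The augmented filtration and its limit from the right\<close>

lemma nat_gen_subset_sets: "(\<And>s. X s \<in> borel_measurable M) \<Longrightarrow> nat_gen M X u \<subseteq> sets M"
  unfolding nat_gen_def by (auto intro: measurable_sets_Collect)

definition augmented :: "'a measure \<Rightarrow> (real \<Rightarrow> 'a \<Rightarrow> real) \<Rightarrow> real \<Rightarrow> 'a set set" where
  "augmented M X u = sigma_sets (space M) (nat_gen M X u \<union> null_sets (completion M))"

context
  fixes M :: "'a measure" and X :: "real \<Rightarrow> 'a \<Rightarrow> real"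
  assumes X_meas: "\<And>s. X s \<in> borel_measurable M"
begin

lemma augmented_gen_Pow: "nat_gen M X u \<union> null_sets (completion M) \<subseteq> Pow (space M)"
proof -
  have "nat_gen M X u \<subseteq> Pow (space M)" by (auto simp: nat_gen_def)
  moreover have "null_sets (completion M) \<subseteq> Pow (space M)"
    using sets.space_closed[of "completion M"] by (auto simp: null_sets_def)
  ultimately show ?thesis by blast
qed

lemma sets_augmented: "sets (sigma (space M) (nat_gen M X u \<union> null_sets (completion M))) = augmented M X u"
  unfolding augmented_def by (rule sets_measure_of[OF augmented_gen_Pow])

lemma augmented_subset: "augmented M X u \<subseteq> sets (completion M)"
proof -
  have "nat_gen M X u \<union> null_sets (completion M) \<subseteq> sets (completion M)"
    using nat_gen_subset_sets[of X M u] X_meas sets_completionI_sets by auto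
  then show ?thesis
    unfolding augmented_def using sets.sigma_sets_subset[of _ "completion M"] by simp
qed

text \<open>An intersection of sigma-algebras is one already, so the outer \<open>sigma\<close> in
  the definition adds no sets.\<close>

lemma sets_usual_filtration: "sets (usual_filtration M X t) = (\<Inter>u\<in>{t<..}. augmented M X u)"
proof -
  have Pow: "(\<Inter>u\<in>{t<..}. augmented M X u) \<subseteq> Pow (space M)"
  proof -
    have "(\<Inter>u\<in>{t<..}. augmented M X u) \<subseteq> augmented M X (t + 1)" by auto
    also have "\<dots> \<subseteq> Pow (space M)"
      using augmented_subset[of "t + 1"] sets.space_closed[of "completion M"] by auto
    finally show ?thesis .
  qed
  have "sets (usual_filtration M X t) = sigma_sets (space M) (\<Inter>u\<in>{t<..}. augmented M X u)"
    unfolding usual_filtration_def sets_augmented using Pow by (rule sets_measure_of)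
  also have "\<dots> = (\<Inter>u\<in>{t<..}. augmented M X u)"
  proof
    show "sigma_sets (space M) (\<Inter>u\<in>{t<..}. augmented M X u) \<subseteq> (\<Inter>u\<in>{t<..}. augmented M X u)"
    proof (rule INT_greatest)
      fix u assume u: "u \<in> {t<..}"
      interpret sigma_algebra "space M" "augmented M X u"
        unfolding augmented_def using augmented_gen_Pow by (rule sigma_algebra_sigma_sets)
      show "sigma_sets (space M) (\<Inter>u\<in>{t<..}. augmented M X u) \<subseteq> augmented M X u"
        using u by (intro sigma_sets_subset) auto
    qed
  qed auto
  finally show ?thesis .
qed

lemma space_usual_filtration: "space (usual_filtration M X t) = space M"
  unfolding usual_filtration_def by (simp add: space_measure_of_conv)

lemma usual_filtration_subset: "sets (usual_filtration M X t) \<subseteq> sets (completion M)"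
  unfolding sets_usual_filtration using augmented_subset[of "t + 1"] by (auto dest!: bspec[of _ _ "t + 1"])

lemma usual_filtration_mono: "s \<le> u \<Longrightarrow> sets (usual_filtration M X s) \<subseteq> sets (usual_filtration M X u)"
  unfolding sets_usual_filtration by auto

lemma usual_filtration_adapted: "0 \<le> s \<Longrightarrow> X s \<in> borel_measurable (usual_filtration M X s)"
proof (rule measurableI)
  fix A :: "real set" assume s: "0 \<le> s" and A: "A \<in> sets borel"
  have "X s -` A \<inter> space M = {\<omega>\<in>space M. X s \<omega> \<in> A}" by auto
  moreover have "{\<omega>\<in>space M. X s \<omega> \<in> A} \<in> nat_gen M X u" if "s < u" for u
    using s A that unfolding nat_gen_def by (intro CollectI exI[of _ s] exI[of _ A]) auto
  ultimately show "X s -` A \<inter> space (usual_filtration M X s) \<in> sets (usual_filtration M X s)"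
    unfolding space_usual_filtration sets_usual_filtration augmented_def by (auto intro: sigma_sets.Basic)
qed auto

end

lemma levy_process_augmented_indep:
  assumes X: "levy_process M X" and s: "0 \<le> s" "s \<le> u"
    and A: "A \<in> augmented M X s" and D: "D \<in> sets borel"
  shows "measure (completion M) (A \<inter> {\<omega>\<in>space M. X u \<omega> - X s \<omega> \<in> D})
    = measure (completion M) A * measure (completion M) {\<omega>\<in>space M. X u \<omega> - X s \<omega> \<in> D}"
proof -
  interpret prob_space M using X by (simp add: levy_process_def)
  interpret c: prob_space "completion M" by (rule prob_space_completion)
  have X_meas[measurable]: "X v \<in> borel_measurable M" for v using X by (simp add: levy_process_def)
  obtain A0 where A0: "A0 \<in> sigma_sets (space M) (nat_gen M X s)" and null: "(A - A0) \<union> (A0 - A) \<in> null_sets (completion M)"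
    using sigma_sets_null_sets_approx[OF nat_gen_subset_sets[of X, OF X_meas] A[unfolded augmented_def]] by auto
  have A0M: "A0 \<in> sets M" using A0 sets.sigma_sets_subset[OF nat_gen_subset_sets[of X, OF X_meas]] by auto
  have AM: "A \<in> sets (completion M)" using A augmented_subset[of X, OF X_meas] by auto
  define E where "E = {\<omega>\<in>space M. X u \<omega> - X s \<omega> \<in> D}"
  have E: "E \<in> sets M" unfolding E_def using D by (auto intro!: measurable_sets_Collect[where N=borel])
  have AE: "AE \<omega> in completion M. \<omega> \<in> A \<longleftrightarrow> \<omega> \<in> A0"
    by (rule AE_I'[OF null]) auto
  have 1: "measure (completion M) (A \<inter> E) = measure (completion M) (A0 \<inter> E)"
    using AE AM A0M E by (intro measure_eq_AE) (auto intro: sets_completionI_sets)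
  have 2: "measure (completion M) A = measure (completion M) A0"
    using AE AM A0M E by (intro measure_eq_AE) (auto intro: sets_completionI_sets)
  show ?thesis
    using levy_process_nat_gen_indep[OF X s A0 D] A0M E
    unfolding E_def[symmetric] 1 2 by simp
qed

text \<open>The conditional law of an increment given an event of the right-continuous filtration is
  identified through its characteristic function, which allows the limit from the right.\<close>

lemma levy_process_usual_indep:
  assumes X: "levy_process M X" and s: "0 \<le> s" and h: "0 < h"
    and A: "A \<in> sets (usual_filtration M X s)" and D: "D \<in> sets borel"
  shows "measure (completion M) (A \<inter> {\<omega>\<in>space M. X (s + h) \<omega> - X s \<omega> \<in> D})
    = measure (completion M) A * measure (completion M) {\<omega>\<in>space M. X (s + h) \<omega> - X s \<omega> \<in> D}"
proof -
  interpret prob_space M using X by (simp add: levy_process_def)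
  interpret c: prob_space "completion M" by (rule prob_space_completion)
  have X_meas: "X v \<in> borel_measurable M" for v using X by (simp add: levy_process_def)
  have [measurable]: "X v \<in> borel_measurable (completion M)" for v using X_meas by (rule measurable_completion)
  have AM[measurable]: "A \<in> sets (completion M)" using A usual_filtration_subset[of X, OF X_meas] by auto
  show ?thesis
  proof (cases "measure (completion M) A = 0")
    case True
    have "measure (completion M) (A \<inter> {\<omega>\<in>space M. X (s + h) \<omega> - X s \<omega> \<in> D}) \<le> measure (completion M) A"
      by (rule c.finite_measure_mono) auto
    then show ?thesis using True by (simp add: measure_le_0_iff)
  next
    case False
    define Q where "Q = uniform_measure (completion M) A"
    have A_pos: "emeasure (completion M) A \<noteq> 0" using False by (simp add: c.emeasure_eq_measure)
    interpret Q: prob_space Q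
      unfolding Q_def using A_pos by (intro prob_space_uniform_measure) auto
    have [measurable_cong]: "sets Q = sets (completion M)" by (simp add: Q_def)
    have Q_measure: "measure Q B = measure (completion M) (A \<inter> B) / measure (completion M) A"
      if "B \<in> sets (completion M)" for B
      unfolding Q_def using AM that A_pos by (intro measure_uniform_measure) auto
    have Qsp: "space Q = space M" by (simp add: Q_def)
    \<comment> \<open>Times strictly after \<open>s\<close>, because \<open>A\<close> belongs to the
      augmented sigma-algebra of each such time but not necessarily to that of \<open>s\<close>. The
      offset keeps the denominator nonzero and \<open>v n\<close> before
      \<open>s + h\<close>.\<close>
    define v where "v n = s + h / real (n + 2)" for n
    have v: "s < v n" "v n \<le> s + h" for n
      using h by (auto simp: v_def field_simps)
    have v_lim: "v \<longlonglongrightarrow> s"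
    proof -
      have "(\<lambda>n. s + h / real (n + 2)) \<longlonglongrightarrow> s + 0"
        by (intro tendsto_add tendsto_const LIMSEQ_ignore_initial_segment[OF lim_const_over_n])
      then show ?thesis by (simp add: v_def[abs_def])
    qed
    let ?D = "\<lambda>n \<omega>. X (s + h) \<omega> - X (v n) \<omega>" and ?D' = "\<lambda>\<omega>. X (s + h) \<omega> - X s \<omega>"
    have lim: "(\<lambda>n. ?D n \<omega>) \<longlonglongrightarrow> ?D' \<omega>" if "\<omega> \<in> space M" for \<omega>
    proof -
      have "continuous (at_right s) (\<lambda>u. X u \<omega>)" using X s that by (simp add: levy_process_def)
      then have "continuous (at s within {s..}) (\<lambda>u. X u \<omega>)" by (simp add: at_within_Ici_at_right)
      then have "(\<lambda>n. X (v n) \<omega>) \<longlonglongrightarrow> X s \<omega>"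
        by (rule continuous_within_tendsto_compose') (use v v_lim in \<open>auto intro: less_imp_le\<close>)
      then show ?thesis by (intro tendsto_intros)
    qed
    have eq: "distr Q borel (?D n) = distr (completion M) borel (?D n)" for n
    proof (rule measure_eqI)
      fix B assume "B \<in> sets (distr Q borel (?D n))"
      then have B: "B \<in> sets borel" by simp
      have set: "?D n -` B \<inter> space M = {\<omega>\<in>space M. X (s + h) \<omega> - X (v n) \<omega> \<in> B}" by auto
      have "A \<in> augmented M X (v n)"
        using A v(1)[of n] by (auto simp: sets_usual_filtration[of X, OF X_meas])
      from levy_process_augmented_indep[OF X _ v(2) this B] s v(1)[of n]
      have ind: "measure (completion M) (A \<inter> (?D n -` B \<inter> space M)) = measure (completion M) A * measure (completion M) (?D n -` B \<inter> space M)"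
        unfolding set by auto
      have Bs: "?D n -` B \<inter> space M \<in> sets (completion M)"
        using B measurable_sets[of "?D n" "completion M" borel B] by simp
      show "emeasure (distr Q borel (?D n)) B = emeasure (distr (completion M) borel (?D n)) B"
        using B Bs Q_measure[OF Bs] False ind
        by (simp add: emeasure_distr Q.emeasure_eq_measure c.emeasure_eq_measure Qsp)
    qed simp
    have "distr Q borel ?D' = distr (completion M) borel ?D'"
    proof (rule Levy_uniqueness)
      show "real_distribution (distr Q borel ?D')" "real_distribution (distr (completion M) borel ?D')"
        by (auto intro!: Q.real_distribution_distr c.real_distribution_distr)
      show "char (distr Q borel ?D') = char (distr (completion M) borel ?D')"
      proof
        fix t
        have "(\<lambda>n. char (distr Q borel (?D n)) t) \<longlonglongrightarrow> char (distr Q borel ?D') t"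
          by (rule char_distr_tendsto) (use lim Qsp in \<open>auto intro: Q.prob_space_axioms\<close>)
        moreover have "(\<lambda>n. char (distr (completion M) borel (?D n)) t) \<longlonglongrightarrow> char (distr (completion M) borel ?D') t"
          by (rule char_distr_tendsto) (use lim in \<open>auto intro: c.prob_space_axioms\<close>)
        ultimately show "char (distr Q borel ?D') t = char (distr (completion M) borel ?D') t"
          unfolding eq by (rule LIMSEQ_unique)
      qed
    qed
    then have "measure (distr Q borel ?D') D = measure (distr (completion M) borel ?D') D" by simp
    moreover have set: "?D' -` D \<inter> space M = {\<omega>\<in>space M. X (s + h) \<omega> - X s \<omega> \<in> D}" by auto
    moreover have "?D' -` D \<inter> space M \<in> sets (completion M)"
      using D measurable_sets[of "?D'" "completion M" borel D] by simp
    ultimately show ?thesis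
      using D Q_measure[of "?D' -` D \<inter> space M"] False by (simp add: measure_distr Qsp field_simps)
  qed
qed

section \<open>The two price models as instances of \<open>levy_stopping\<close>\<close>

lemma levy_process_stopping:
  assumes X: "levy_process M X"
  shows "levy_stopping (completion M) (usual_filtration M X) (\<lambda>s \<omega>. c * s + X s \<omega>)
    (\<lambda>h. distr M borel (\<lambda>\<omega>. c * h + X h \<omega>))"
proof -
  interpret prob_space M using X by (simp add: levy_process_def)
  have X_meas[measurable]: "X v \<in> borel_measurable M" for v using X by (simp add: levy_process_def)
  interpret c: prob_space "completion M" by (rule prob_space_completion)
  show ?thesis
  proof (rule levy_stopping.intro[OF c.prob_space_axioms levy_stopping_axioms.intro], goal_cases)
    case (1 s)
    then show ?case using space_usual_filtration[of X, OF X_meas] by simp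
  next
    case (2 s)
    then show ?case by (rule usual_filtration_subset[of X, OF X_meas])
  next
    case (3 s u)
    then show ?case by (rule usual_filtration_mono[of X, OF X_meas])
  next
    case (4 s)
    then show ?case using usual_filtration_adapted[of X, OF X_meas, of s] by measurable
  next
    case (5 \<omega>)
    then show ?case using X by (simp add: levy_process_def)
  next
    case (6 \<omega> s)
    then have "continuous (at_right s) (\<lambda>u. X u \<omega>)" using X by (simp add: levy_process_def)
    then show ?case by (intro continuous_intros)
  next
    case (7 h)
    then show ?case by (intro prob_space_distr) simp
  next
    case (8 h)
    then show ?case by simp
  next
    case (9 s h A D)
    define D' where "D' = (\<lambda>y. c * h + y) -` D"
    have D': "D' \<in> sets borel" using 9 measurable_sets[of "\<lambda>y. c * h + y" borel borel D] by (simp add: D'_def)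
    have set: "{\<omega> \<in> space (completion M). c * (s + h) + X (s + h) \<omega> - (c * s + X s \<omega>) \<in> D}
      = {\<omega> \<in> space M. X (s + h) \<omega> - X s \<omega> \<in> D'}"
      by (auto simp: D'_def algebra_simps)
    have meas: "{\<omega> \<in> space M. X (s + h) \<omega> - X s \<omega> \<in> D'} \<in> sets M"
      using D' by (auto intro!: measurable_sets_Collect[where N=borel])
    have "measure (completion M) {\<omega> \<in> space M. X (s + h) \<omega> - X s \<omega> \<in> D'}
      = measure (distr M borel (\<lambda>\<omega>. X (s + h) \<omega> - X s \<omega>)) D'"
      using D' meas by (subst measure_distr) (auto intro!: arg_cong[where f="measure M"])
    also have "distr M borel (\<lambda>\<omega>. X (s + h) \<omega> - X s \<omega>) = distr M borel (X h)"
      using X 9 by (simp add: levy_process_def)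
    also have "measure (distr M borel (X h)) D' = measure (distr M borel (\<lambda>\<omega>. c * h + X h \<omega>)) D"
      using 9 D' by (simp add: measure_distr D'_def vimage_def)
    finally show ?case
      unfolding set using levy_process_usual_indep[OF X 9(1-3) D'] by simp
  qed
qed

text \<open>Written as the image of one standard normal variable, so that expectations over one step
  are integrals against the same measure for every \<open>h\<close>.\<close>

definition bs_law :: "real \<Rightarrow> real \<Rightarrow> real \<Rightarrow> real measure" where
  "bs_law c \<sigma> h = distr std_normal_distribution borel (\<lambda>y. c * h + \<sigma> * sqrt h * y)"

lemma prob_space_bs_law: "prob_space (bs_law c \<sigma> h)"
  unfolding bs_law_def
  by (intro prob_space.prob_space_distr prob_space_normal_density) auto

lemma sets_bs_law: "sets (bs_law c \<sigma> h) = sets borel"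
  by (simp add: bs_law_def)

lemma normal_density_eq_distr_std:
  assumes "0 < s"
  shows "density lborel (normal_density 0 s) = distr std_normal_distribution borel (\<lambda>y. s * y)"
proof -
  interpret prob_space std_normal_distribution by (rule prob_space_normal_density) simp
  have "distributed std_normal_distribution lborel (\<lambda>y. y) std_normal_density"
    unfolding distributed_def by (auto intro!: distr_id2)
  from normal_density_affine[OF this _, of s 0] assms
  have "distributed std_normal_distribution lborel (\<lambda>y. s * y) (normal_density 0 s)" by simp
  then have "distr std_normal_distribution lborel (\<lambda>y. s * y) = density lborel (normal_density 0 s)"
    by (simp add: distributed_def)
  then show ?thesis by (metis distr_cong sets_lborel)
qed

lemma brownian_motion_stopping:
  assumes X: "levy_process M X" and B: "brownian_motion M (usual_filtration M X) B"
  shows "levy_stopping (completion M) (usual_filtration M X) (\<lambda>s \<omega>. c * s + \<sigma> * B s \<omega>) (bs_law c \<sigma>)"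
proof -
  interpret prob_space M using X by (simp add: levy_process_def)
  have X_meas[measurable]: "X v \<in> borel_measurable M" for v using X by (simp add: levy_process_def)
  interpret c: prob_space "completion M" by (rule prob_space_completion)
  have B_adapted: "B s \<in> borel_measurable (usual_filtration M X s)" for s
    using B by (simp add: brownian_motion_def)
  have B_meas[measurable]: "B s \<in> borel_measurable (completion M)" for s
    using B_adapted[of s] usual_filtration_subset[of X, OF X_meas, of s] space_usual_filtration[of X, OF X_meas, of s]
    by (auto simp: measurable_def)
  show ?thesis
  proof (rule levy_stopping.intro[OF c.prob_space_axioms levy_stopping_axioms.intro], goal_cases)
    case (1 s)
    then show ?case using space_usual_filtration[of X, OF X_meas] by simp
  next
    case (2 s)
    then show ?case by (rule usual_filtration_subset[of X, OF X_meas])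
  next
    case (3 s u)
    then show ?case by (rule usual_filtration_mono[of X, OF X_meas])
  next
    case (4 s)
    then show ?case using B_adapted[of s] by measurable
  next
    case (5 \<omega>)
    then show ?case using B by (simp add: brownian_motion_def)
  next
    case (6 \<omega> s)
    then have "continuous_on {0..} (\<lambda>u. B u \<omega>)" using B by (simp add: brownian_motion_def)
    then have "continuous (at s within {0..}) (\<lambda>u. B u \<omega>)" using 6 by (auto simp: continuous_on_eq_continuous_within)
    then have "continuous (at_right s) (\<lambda>u. B u \<omega>)" using 6 by (rule_tac continuous_within_subset) auto
    then show ?case by (intro continuous_intros)
  next
    case (7 h)
    then show ?case by (rule_tac prob_space_bs_law)
  next
    case (8 h)
    then show ?case by (rule sets_bs_law)
  next
    case (9 s h A D)
    define D' where "D' = (\<lambda>y. c * h + \<sigma> * y) -` D"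
    have D': "D' \<in> sets borel" using 9 measurable_sets[of "\<lambda>y. c * h + \<sigma> * y" borel borel D] by (simp add: D'_def)
    have set: "{\<omega> \<in> space (completion M). c * (s + h) + \<sigma> * B (s + h) \<omega> - (c * s + \<sigma> * B s \<omega>) \<in> D}
      = {\<omega> \<in> space M. B (s + h) \<omega> - B s \<omega> \<in> D'}"
      by (auto simp: D'_def algebra_simps)
    have "measure (completion M) {\<omega> \<in> space M. B (s + h) \<omega> - B s \<omega> \<in> D'}
      = measure (distr (completion M) borel (\<lambda>\<omega>. B (s + h) \<omega> - B s \<omega>)) D'"
      using D' by (subst measure_distr) (auto intro!: arg_cong[where f="measure (completion M)"])
    also have "distr (completion M) borel (\<lambda>\<omega>. B (s + h) \<omega> - B s \<omega>)
       = density lborel (normal_density 0 (sqrt (s + h - s)))"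
      using B 9 unfolding brownian_motion_def by auto
    also have "\<dots> = distr std_normal_distribution borel (\<lambda>y. sqrt h * y)"
      using 9 by (subst normal_density_eq_distr_std) auto
    also have "measure \<dots> D' = measure (bs_law c \<sigma> h) D"
      using 9 D' by (simp add: bs_law_def measure_distr D'_def vimage_def mult.assoc)
    finally show ?case
      unfolding set using B D' 9 unfolding brownian_motion_def by auto
  qed
qed

section \<open>Approximation of the jump part\<close>

text \<open>Needed for complex \<open>z\<close>, since it is applied to characteristic functions of
  \<open>n\<close>-fold convolutions; its real version gives the limit of their exponential
  means.\<close>

lemma tendsto_one_plus_div_power_exp:
  fixes z :: "nat \<Rightarrow> complex"
  assumes z: "z \<longlonglongrightarrow> l"
  shows "(\<lambda>n. (1 + z n / of_nat n) ^ n) \<longlonglongrightarrow> exp l"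
proof -
  have "(Ln has_field_derivative 1) (at 1)"
    using has_field_derivative_Ln[of 1] by simp
  \<comment> \<open>The Caratheodory form of the derivative of \<open>Ln\<close> at \<open>1\<close>
    replaces the difference quotient, which spares a case distinction for \<open>z n = 0\<close>:
    \<open>n\<close> times the logarithm of \<open>1 + z n / n\<close> is \<open>z n\<close> times a
    factor tending to \<open>1\<close>.\<close>
  then obtain g where g: "\<And>w. Ln w - Ln 1 = g w * (w - 1)" "isCont g 1" "g 1 = 1"
    unfolding CARAT_DERIV by auto
  have "(\<lambda>n. z n / of_nat n) \<longlonglongrightarrow> 0"
    using tendsto_mult[OF z lim_1_over_n[where 'a=complex]] by simp
  then have lim1: "(\<lambda>n. 1 + z n / of_nat n) \<longlonglongrightarrow> 1"
    using tendsto_add[OF tendsto_const, of "\<lambda>n. z n / of_nat n" 0 sequentially 1] by simp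
  then have "(\<lambda>n. g (1 + z n / of_nat n)) \<longlonglongrightarrow> 1"
    using isCont_tendsto_compose[OF g(2)] g(3) by auto
  then have "(\<lambda>n. exp (z n * g (1 + z n / of_nat n))) \<longlonglongrightarrow> exp (l * 1)"
    by (intro tendsto_intros z)
  moreover have "eventually (\<lambda>n. exp (z n * g (1 + z n / of_nat n)) = (1 + z n / of_nat n) ^ n) sequentially"
    using tendsto_imp_eventually_ne[OF lim1 one_neq_zero] eventually_gt_at_top[of 0]
  proof eventually_elim
    case (elim n)
    have "z n * g (1 + z n / of_nat n) = of_nat n * Ln (1 + z n / of_nat n)"
      using g(1)[of "1 + z n / of_nat n"] elim by (simp add: field_simps)
    then have "exp (z n * g (1 + z n / of_nat n)) = exp (Ln (1 + z n / of_nat n)) ^ n"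
      by (simp add: exp_of_nat_mult)
    then show ?case using elim by simp
  qed
  ultimately show ?thesis by (simp cong: filterlim_cong)
qed

lemma tendsto_one_plus_div_power_exp_real:
  fixes z :: "nat \<Rightarrow> real"
  assumes z: "z \<longlonglongrightarrow> l"
  shows "(\<lambda>n. (1 + z n / of_nat n) ^ n) \<longlonglongrightarrow> exp l"
proof -
  have "(\<lambda>n. complex_of_real ((1 + z n / of_nat n) ^ n)) \<longlonglongrightarrow> complex_of_real (exp l)"
    using tendsto_one_plus_div_power_exp[of "\<lambda>n. complex_of_real (z n)" "complex_of_real l"] z
    by (simp add: tendsto_of_real_iff exp_of_real)
  then show ?thesis by (simp only: tendsto_of_real_iff)
qed

text \<open>The case distinction avoids the junk normalisation by \<open>\<nu>(E) = 0\<close>.\<close>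

definition lazy_jump_law :: "real measure \<Rightarrow> real set \<Rightarrow> real \<Rightarrow> real measure" where
  "lazy_jump_law \<nu> E c = (if measure \<nu> E = 0 then return borel 0 else
     distr (measure_pmf (bernoulli_pmf (c * measure \<nu> E))
       \<Otimes>\<^sub>M density \<nu> (\<lambda>x. ennreal (indicator E x / measure \<nu> E))) borel (\<lambda>(t, y). if t then y else 0))"

lemma sets_lazy_jump_law: "sets (lazy_jump_law \<nu> E c) = sets borel"
  by (simp add: lazy_jump_law_def)

context
  fixes \<nu> :: "real measure" and E :: "real set" and c :: real
  assumes sets[measurable_cong]: "sets \<nu> = sets borel" and E[measurable]: "E \<in> sets borel"
    and fin: "emeasure \<nu> E < \<infinity>" and c: "0 \<le> c" "c * measure \<nu> E \<le> 1"
begin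

lemma prob_space_normalized_restriction:
  assumes "measure \<nu> E \<noteq> 0"
  shows "prob_space (density \<nu> (\<lambda>x. ennreal (indicator E x / measure \<nu> E)))"
proof
  define m where "m = measure \<nu> E"
  have m: "0 < m" using assms measure_nonneg[of \<nu> E] by (simp add: m_def less_le)
  have em: "emeasure \<nu> E = ennreal m" using fin by (simp add: m_def emeasure_eq_ennreal_measure)
  have "emeasure (density \<nu> (\<lambda>x. ennreal (indicator E x / m))) (space (density \<nu> (\<lambda>x. ennreal (indicator E x / m))))
      = (\<integral>\<^sup>+x. ennreal (1 / m) * indicator E x \<partial>\<nu>)"
    by (subst emeasure_density) (auto intro!: nn_integral_cong simp: indicator_def)
  also have "\<dots> = ennreal (1 / m) * ennreal m"
    using em by (subst nn_integral_cmult_indicator) (auto simp: sets)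
  also have "\<dots> = 1" using m by (simp add: ennreal_mult'[symmetric] flip: ennreal_1)
  finally show "emeasure (density \<nu> (\<lambda>x. ennreal (indicator E x / measure \<nu> E)))
      (space (density \<nu> (\<lambda>x. ennreal (indicator E x / measure \<nu> E)))) = 1" by (simp add: m_def)
qed

lemma prob_space_lazy_jump_law: "prob_space (lazy_jump_law \<nu> E c)"
proof (cases "measure \<nu> E = 0")
  case True
  then show ?thesis by (auto simp: lazy_jump_law_def intro: prob_space_return)
next
  case False
  define U where "U = density \<nu> (\<lambda>x. ennreal (indicator E x / measure \<nu> E))"
  define b where "b = measure_pmf (bernoulli_pmf (c * measure \<nu> E))"
  interpret U: prob_space U unfolding U_def by (rule prob_space_normalized_restriction[OF False])
  interpret b: prob_space b unfolding b_def by (rule prob_space_measure_pmf)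
  interpret P: pair_prob_space b U by unfold_locales
  have [measurable_cong]: "sets U = sets borel" "sets b = sets (count_space UNIV)"
    by (simp_all add: U_def b_def sets)
  have "lazy_jump_law \<nu> E c = distr (b \<Otimes>\<^sub>M U) borel (\<lambda>(t, y). if t then y else 0)"
    using False by (simp add: lazy_jump_law_def U_def b_def)
  also have "prob_space \<dots>" by (rule P.prob_space_distr) measurable
  finally show ?thesis .
qed

text \<open>A jump occurs with probability \<open>c * measure \<nu> E\<close> and then has the law
  \<open>\<nu>\<close> conditioned on \<open>E\<close>, so the normalising factor
  \<open>measure \<nu> E\<close> cancels. The values are vectors in order to cover real means and
  characteristic functions alike.\<close>

lemma lazy_jump_law_integral:
  fixes f :: "real \<Rightarrow> 'b::{banach, second_countable_topology}"
  assumes f[measurable]: "f \<in> borel_measurable borel" and int: "integrable \<nu> (\<lambda>y. indicator E y *\<^sub>R f y)"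
  shows "integrable (lazy_jump_law \<nu> E c) f \<and> integral\<^sup>L (lazy_jump_law \<nu> E c) f
    = (1 - c * measure \<nu> E) *\<^sub>R f 0 + c *\<^sub>R (\<integral>y. indicator E y *\<^sub>R f y \<partial>\<nu>)"
proof (cases "measure \<nu> E = 0")
  case True
  interpret r: prob_space "return borel (0::real)" by (rule prob_space_return) simp
  have "emeasure \<nu> E = 0" using True fin by (simp add: emeasure_eq_ennreal_measure)
  then have AE: "AE y in \<nu>. indicator E y = (0::real)"
    by (intro AE_I[where N=E]) (auto simp: indicator_def sets)
  have "(\<integral>y. indicator E y *\<^sub>R f y \<partial>\<nu>) = 0"
    using AE by (intro integral_eq_zero_AE) auto
  moreover have "integrable (return borel 0) f"
    by (intro r.integrable_const_bound[where B="norm (f 0)"]) (auto simp: AE_return)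
  moreover have "integral\<^sup>L (return borel 0) f = f 0"
    by (intro integral_return) auto
  ultimately show ?thesis by (simp add: True lazy_jump_law_def)
next
  case False
  define m where "m = measure \<nu> E"
  have m: "0 < m" using False measure_nonneg[of \<nu> E] by (simp add: m_def less_le)
  define p where "p = c * m"
  have p: "0 \<le> p" "p \<le> 1" using c m by (auto simp: p_def m_def)
  define U where "U = density \<nu> (\<lambda>x. ennreal (indicator E x / m))"
  define b where "b = measure_pmf (bernoulli_pmf p)"
  interpret U: prob_space U unfolding U_def m_def by (rule prob_space_normalized_restriction[OF False])
  interpret b: prob_space b unfolding b_def by (rule prob_space_measure_pmf)
  interpret P: pair_prob_space b U by unfold_locales
  have [measurable_cong]: "sets U = sets borel" "sets b = sets (count_space UNIV)"
    by (simp_all add: U_def b_def sets)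
  let ?g = "\<lambda>(t, y). if t then y else (0::real)"
  have g[measurable]: "?g \<in> borel_measurable (b \<Otimes>\<^sub>M U)" by measurable
  have \<pi>: "lazy_jump_law \<nu> E c = distr (b \<Otimes>\<^sub>M U) borel ?g"
    using False by (simp add: lazy_jump_law_def U_def b_def p_def m_def)
  have dens: "(\<lambda>y. (indicator E y / m) *\<^sub>R f y) = (\<lambda>y. (1 / m) *\<^sub>R (indicator E y *\<^sub>R f y))" by (auto simp: fun_eq_iff)
  have fm: "f \<in> borel_measurable \<nu>" and im: "(\<lambda>y. indicator E y / m) \<in> borel_measurable \<nu>"
    and nn: "AE y in \<nu>. 0 \<le> indicator E y / m"
    using m by (measurable, measurable, auto)
  have Uint: "integrable U f"
    unfolding U_def integrable_density[OF fm im nn] dens using int by (intro integrable_scaleR_right) auto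
  have Uval: "integral\<^sup>L U f = (1 / m) *\<^sub>R (\<integral>y. indicator E y *\<^sub>R f y \<partial>\<nu>)"
    unfolding U_def integral_density[OF fm im nn] dens by (rule integral_scaleR_right)
  have int': "integrable (b \<Otimes>\<^sub>M U) (\<lambda>z. f (?g z))"
  proof (rule P.Fubini_integrable)
    show "integrable b (\<lambda>x. \<integral>y. norm (f (?g (x, y))) \<partial>U)"
      unfolding b_def by (rule integrable_measure_pmf_finite) simp
    show "AE x in b. integrable U (\<lambda>y. f (?g (x, y)))"
    proof (rule AE_I2)
      fix x show "integrable U (\<lambda>y. f (?g (x, y)))" using Uint by (cases x) auto
    qed
  qed measurable
  then have "integrable (lazy_jump_law \<nu> E c) f" unfolding \<pi> by (subst integrable_distr_eq) auto
  moreover have "integral\<^sup>L (lazy_jump_law \<nu> E c) f = (\<integral>x. (\<integral>y. f (?g (x, y)) \<partial>U) \<partial>b)"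
    unfolding \<pi> using P.integral_fst'[OF int'] by (subst integral_distr) auto
  moreover have "\<dots> = p *\<^sub>R integral\<^sup>L U f + (1 - p) *\<^sub>R f 0"
    unfolding b_def using p by (subst integral_measure_pmf[of UNIV]) (auto simp: UNIV_bool U.prob_space)
  ultimately show ?thesis using m by (simp add: Uval p_def m_def[symmetric])
qed

end

section \<open>Convolution powers and their exponential moments\<close>

fun conv_power :: "real measure \<Rightarrow> nat \<Rightarrow> real measure" where
  "conv_power \<pi> 0 = return borel 0"
| "conv_power \<pi> (Suc n) = (\<pi> \<star> conv_power \<pi> n)"

lemma prob_space_convolution:
  assumes "prob_space M" "prob_space N" and [measurable_cong]: "sets M = sets borel" "sets N = sets borel"
  shows "prob_space (M \<star> N :: real measure)"
proof -
  interpret M: prob_space M by fact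
  interpret N: prob_space N by fact
  interpret P: pair_prob_space M N by unfold_locales
  show ?thesis unfolding convolution_def by (rule P.prob_space_distr) measurable
qed

lemma integral_convolution:
  fixes f :: "real \<Rightarrow> 'b::{banach, second_countable_topology}"
  assumes "prob_space M" "prob_space N" and [measurable_cong]: "sets M = sets borel" "sets N = sets borel"
    and [measurable]: "f \<in> borel_measurable borel" and bd: "\<And>x. norm (f x) \<le> B"
  shows "integral\<^sup>L (M \<star> N) f = (\<integral>x. \<integral>y. f (x + y) \<partial>N \<partial>M)"
proof -
  interpret M: prob_space M by fact
  interpret N: prob_space N by fact
  interpret P: pair_prob_space M N by unfold_locales
  have "integrable (M \<Otimes>\<^sub>M N) (\<lambda>z. f (case z of (x, y) \<Rightarrow> x + y))"
    by (rule P.integrable_const_bound[where B=B]) (auto simp: bd)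
  from P.integral_fst'[OF this] show ?thesis
    unfolding convolution_def by (subst integral_distr) auto
qed

lemma char_convolution:
  assumes "prob_space M" "prob_space N" "sets M = sets borel" "sets N = sets borel"
  shows "char (M \<star> N) t = char M t * char N t"
proof -
  have "char (M \<star> N) t = (CLINT x|M. CLINT y|N. iexp (t * (x + y)))"
    unfolding char_def using assms by (intro integral_convolution[where B=1]) auto
  also have "\<dots> = char M t * char N t"
    unfolding char_def by (simp add: distrib_left exp_add of_real_add)
  finally show ?thesis .
qed

context
  fixes \<pi> :: "real measure"
  assumes prob: "prob_space \<pi>" and sets[measurable_cong]: "sets \<pi> = sets borel"
begin

lemma sets_conv_power: "sets (conv_power \<pi> n) = sets borel"
  by (cases n) auto

lemma prob_space_conv_power: "prob_space (conv_power \<pi> n)"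
proof (induction n)
  case 0
  show ?case by (auto intro: prob_space_return)
qed (auto intro!: prob_space_convolution prob sets sets_conv_power)

lemma char_conv_power: "char (conv_power \<pi> n) t = char \<pi> t ^ n"
proof (induction n)
  case 0
  show ?case by (simp add: char_def integral_return)
qed (simp add: char_convolution prob prob_space_conv_power sets sets_conv_power)

lemma nn_integral_exp_conv_power:
  "(\<integral>\<^sup>+y. ennreal (exp y) \<partial>conv_power \<pi> n) = (\<integral>\<^sup>+y. ennreal (exp y) \<partial>\<pi>) ^ n"
proof (induction n)
  case 0
  show ?case by (simp add: nn_integral_return)
next
  case (Suc n)
  interpret \<pi>: prob_space \<pi> by (rule prob)
  interpret c: prob_space "conv_power \<pi> n" by (rule prob_space_conv_power)
  note [measurable_cong] = sets_conv_power
  have "(\<integral>\<^sup>+y. ennreal (exp y) \<partial>conv_power \<pi> (Suc n)) = (\<integral>\<^sup>+x. \<integral>\<^sup>+y. ennreal (exp x) * ennreal (exp y) \<partial>conv_power \<pi> n \<partial>\<pi>)"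
    by (simp add: nn_integral_convolution \<pi>.finite_measure_axioms c.finite_measure_axioms sets sets_conv_power exp_add ennreal_mult)
  also have "\<dots> = (\<integral>\<^sup>+y. ennreal (exp y) \<partial>\<pi>) * (\<integral>\<^sup>+y. ennreal (exp y) \<partial>conv_power \<pi> n)"
    by (simp add: nn_integral_cmult nn_integral_multc)
  finally show ?case by (simp add: Suc.IH)
qed

text \<open>The function \<open>max 1 (exp y)\<close> is submultiplicative under addition of its
  arguments. It measures only the upward jumps, which is why the bound on overshoots involves
  \<open>(e^y - 1)\<^sub>+\<close> and not \<open>\<bar>e^y - 1\<bar>\<close>. With nonnegative
  integrals the induction is free of integrability conditions.\<close>

lemma nn_integral_max_exp_conv_power:
  "(\<integral>\<^sup>+y. ennreal (max 1 (exp y)) \<partial>conv_power \<pi> n) \<le> (\<integral>\<^sup>+y. ennreal (max 1 (exp y)) \<partial>\<pi>) ^ n"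
proof (induction n)
  case 0
  show ?case by (simp add: nn_integral_return)
next
  case (Suc n)
  interpret \<pi>: prob_space \<pi> by (rule prob)
  interpret c: prob_space "conv_power \<pi> n" by (rule prob_space_conv_power)
  note [measurable_cong] = sets_conv_power
  have le: "max 1 (exp (x + y)) \<le> max 1 (exp x) * max 1 (exp y)" for x y :: real
  proof (rule max.boundedI)
    show "1 \<le> max 1 (exp x) * max 1 (exp y)" using mult_mono[of 1 "max 1 (exp x)" 1 "max 1 (exp y)"] by simp
    show "exp (x + y) \<le> max 1 (exp x) * max 1 (exp y)" unfolding exp_add by (intro mult_mono) auto
  qed
  have "(\<integral>\<^sup>+y. ennreal (max 1 (exp y)) \<partial>conv_power \<pi> (Suc n)) = (\<integral>\<^sup>+x. \<integral>\<^sup>+y. ennreal (max 1 (exp (x + y))) \<partial>conv_power \<pi> n \<partial>\<pi>)"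
    by (simp add: nn_integral_convolution \<pi>.finite_measure_axioms c.finite_measure_axioms sets sets_conv_power)
  also have "\<dots> \<le> (\<integral>\<^sup>+x. \<integral>\<^sup>+y. ennreal (max 1 (exp x)) * ennreal (max 1 (exp y)) \<partial>conv_power \<pi> n \<partial>\<pi>)"
    using le by (intro nn_integral_mono) (auto simp: ennreal_mult[symmetric] intro!: ennreal_leI)
  also have "\<dots> = (\<integral>\<^sup>+y. ennreal (max 1 (exp y)) \<partial>\<pi>) * (\<integral>\<^sup>+y. ennreal (max 1 (exp y)) \<partial>conv_power \<pi> n)"
    by (simp add: nn_integral_cmult nn_integral_multc)
  also have "\<dots> \<le> (\<integral>\<^sup>+y. ennreal (max 1 (exp y)) \<partial>\<pi>) * (\<integral>\<^sup>+y. ennreal (max 1 (exp y)) \<partial>\<pi>) ^ n"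
    by (rule mult_left_mono[OF Suc.IH]) simp
  finally show ?case by simp
qed

end

section \<open>Levy measures with jumps of finite variation\<close>

locale finite_variation_levy_measure =
  fixes \<nu> :: "real measure"
  assumes \<nu>: "levy_measure \<nu>"
    and exp_mom: "integrable \<nu> (\<lambda>y. indicator {y. \<bar>y\<bar> \<ge> 1} y * exp y)"
    and fin_var: "integrable \<nu> (\<lambda>y. indicator {y. \<bar>y\<bar> \<le> 1} y * \<bar>y\<bar>)"
begin

lemma sets_\<nu>[measurable_cong]: "sets \<nu> = sets borel"
  using \<nu> by (simp add: levy_measure_def)

lemma integrable_min_abs: "integrable \<nu> (\<lambda>y. min 1 \<bar>y\<bar>)"
proof (rule Bochner_Integration.integrable_bound)
  show "integrable \<nu> (\<lambda>y. indicator {y. \<bar>y\<bar> \<le> 1} y * \<bar>y\<bar> + min 1 (y\<^sup>2))"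
    using fin_var \<nu> by (intro Bochner_Integration.integrable_add) (auto simp: levy_measure_def)
  have "min 1 \<bar>y\<bar> \<le> indicator {y. \<bar>y\<bar> \<le> 1} y * \<bar>y\<bar> + min 1 (y\<^sup>2)" for y :: real
  proof (cases "\<bar>y\<bar> \<le> 1")
    case False
    then have "1 \<le> y\<^sup>2" using power_mono[of 1 "\<bar>y\<bar>" 2] by simp
    then show ?thesis by (simp add: False)
  qed simp
  then show "AE y in \<nu>. norm (min 1 \<bar>y\<bar>) \<le> norm (indicator {y. \<bar>y\<bar> \<le> 1} y * \<bar>y\<bar> + min 1 (y\<^sup>2))"
    by (intro AE_I2) (auto simp: abs_of_nonneg)
qed measurable

lemma integrable_exp_minus_one: "integrable \<nu> (\<lambda>y. exp y - 1)"
proof (rule Bochner_Integration.integrable_bound)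
  show "integrable \<nu> (\<lambda>y. 3 * min 1 \<bar>y\<bar> + indicator {y. \<bar>y\<bar> \<ge> 1} y * exp y)"
    using exp_mom integrable_min_abs by (intro Bochner_Integration.integrable_add) auto
  have "\<bar>exp y - 1\<bar> \<le> 3 * min 1 \<bar>y\<bar> + indicator {y. \<bar>y\<bar> \<ge> 1} y * exp y" for y :: real
  proof (cases "\<bar>y\<bar> < 1")
    case True
    have "\<bar>exp y - 1\<bar> \<le> 3 * \<bar>y\<bar>"
    proof (cases "0 \<le> y")
      case True
      have "exp y \<le> 1 + y + y\<^sup>2" using \<open>\<bar>y\<bar> < 1\<close> True by (intro exp_bound) auto
      moreover have "y\<^sup>2 \<le> y" using \<open>\<bar>y\<bar> < 1\<close> True by (simp add: power2_eq_square mult_left_le)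
      ultimately show ?thesis using True by auto
    next
      case False
      have "1 + y \<le> exp y" "exp y < 1" using False by auto
      then show ?thesis using False by linarith
    qed
    then show ?thesis using True by (simp add: indicator_def)
  next
    case False
    have "\<bar>exp y - 1\<bar> \<le> exp y + 1" by (simp add: abs_if add_nonneg_nonneg)
    then show ?thesis using False by (simp add: indicator_def)
  qed
  then show "AE y in \<nu>. norm (exp y - 1) \<le> norm (3 * min 1 \<bar>y\<bar> + indicator {y. \<bar>y\<bar> \<ge> 1} y * exp y)"
    by (intro AE_I2) (auto simp: abs_of_nonneg)
qed measurable

lemma integrable_max_exp: "integrable \<nu> (\<lambda>y. max 1 (exp y) - 1)"
  by (rule Bochner_Integration.integrable_bound[OF integrable_exp_minus_one]) auto

lemma max_exp_minus_one: "max 1 (exp y) - 1 = max 0 (exp y - 1 :: real)"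
  by auto

lemma norm_iexp_minus_one_le: "norm (iexp (u * y) - 1) \<le> (2 + \<bar>u\<bar>) * min 1 \<bar>y\<bar>"
proof (cases "1 \<le> \<bar>y\<bar>")
  case True
  have "norm (iexp (u * y) - 1) \<le> norm (iexp (u * y)) + norm (1::complex)" by (rule norm_triangle_ineq4)
  then show ?thesis using True by simp
next
  case False
  have "norm (iexp (u * y) - 1) \<le> \<bar>u * y\<bar>" using iexp_approx1[of "u * y" 0] by simp
  also have "\<dots> \<le> (2 + \<bar>u\<bar>) * \<bar>y\<bar>" by (simp add: abs_mult mult_right_mono)
  finally show ?thesis using False by simp
qed

lemma integrable_iexp_minus_one: "integrable \<nu> (\<lambda>y. iexp (u * y) - 1)"
proof (rule Bochner_Integration.integrable_bound)
  show "integrable \<nu> (\<lambda>y. (2 + \<bar>u\<bar>) * min 1 \<bar>y\<bar>)" using integrable_min_abs by simp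
  show "AE y in \<nu>. norm (iexp (u * y) - 1) \<le> norm ((2 + \<bar>u\<bar>) * min 1 \<bar>y\<bar>)"
    using norm_iexp_minus_one_le[of u] by (intro AE_I2) (auto intro: order_trans[OF _ abs_ge_self])
qed measurable

text \<open>The rate at which uncompensated jumps make the mean price grow; \<open>up_rate\<close>
  is the contribution of upward jumps alone, that is, the integral subtracted in
  \<open>d_+\<close>.\<close>

definition jump_drift :: real where "jump_drift = (\<integral>y. exp y - 1 \<partial>\<nu>)"
definition up_rate :: real where "up_rate = (\<integral>y. max 0 (exp y - 1) \<partial>\<nu>)"

lemma up_rate_nonneg: "0 \<le> up_rate"
  unfolding up_rate_def by simp

lemma integrable_small_jumps: "integrable \<nu> (\<lambda>y. y * indicator {y. \<bar>y\<bar> \<le> 1} y)"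
  by (rule Bochner_Integration.integrable_bound[OF fin_var]) (auto simp: indicator_def)

text \<open>Finite variation allows the truncated term to be integrated separately, and the
  martingale condition then eliminates \<open>\<gamma>\<close>. What remains is the exponent of the
  sum of a Gaussian variable with drift \<open>- \<sigma>\<^sup>2 / 2\<close>, the jumps, and their
  compensator \<open>- jump_drift\<close>.\<close>

lemma levy_exponent_eq:
  assumes "\<sigma>\<^sup>2 / 2 + \<gamma> + (\<integral>y. exp y - 1 - y * indicator {y. \<bar>y\<bar> \<le> 1} y \<partial>\<nu>) = 0"
  shows "levy_exponent \<sigma> \<gamma> \<nu> u = \<i> * complex_of_real (u * (- \<sigma>\<^sup>2 / 2 - jump_drift))
    - complex_of_real (\<sigma>\<^sup>2 * u\<^sup>2 / 2) + (CLINT y|\<nu>. iexp (u * y) - 1)"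
proof -
  define s where "s = (\<integral>y. y * indicator {y. \<bar>y\<bar> \<le> 1} y \<partial>\<nu>)"
  have \<gamma>: "\<gamma> = s - \<sigma>\<^sup>2 / 2 - jump_drift"
    using assms Bochner_Integration.integral_diff[OF integrable_exp_minus_one integrable_small_jumps]
    by (simp add: s_def jump_drift_def)
  have int: "integrable \<nu> (\<lambda>y. \<i> * complex_of_real (u * y * indicator {y. \<bar>y\<bar> \<le> 1} y))"
    using integrable_small_jumps by (intro integrable_mult_right integrable_of_real) (simp add: mult.assoc)
  have "(CLINT y|\<nu>. \<i> * complex_of_real (u * y * indicator {y. \<bar>y\<bar> \<le> 1} y)) = \<i> * complex_of_real (u * s)"
    unfolding s_def by (simp add: mult.assoc del: of_real_mult)
  then have "(CLINT y|\<nu>. iexp (u * y) - 1 - \<i> * complex_of_real (u * y * indicator {y. \<bar>y\<bar> \<le> 1} y))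
     = (CLINT y|\<nu>. iexp (u * y) - 1) - \<i> * complex_of_real (u * s)"
    using Bochner_Integration.integral_diff[OF integrable_iexp_minus_one int, of u] by simp
  then show ?thesis unfolding levy_exponent_def \<gamma> by (simp add: algebra_simps)
qed

text \<open>The threshold \<open>h J / n\<close> is chosen so that Markov's inequality makes the \<open>n\<close>-th lazy jump law
  a probability measure.\<close>

definition big_jumps :: "real \<Rightarrow> nat \<Rightarrow> real set" where
  "big_jumps h n = {y. h * ((\<integral>y. min 1 \<bar>y\<bar> \<partial>\<nu>) + 1) / real n \<le> min 1 \<bar>y\<bar>}"

lemma big_jumps_borel[measurable]: "big_jumps h n \<in> sets borel"
  unfolding big_jumps_def by measurable

lemma big_jumps_measure:
  assumes h: "0 < h" and n: "0 < n"
  shows "emeasure \<nu> (big_jumps h n) < \<infinity>" "h / real n * measure \<nu> (big_jumps h n) \<le> 1"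
proof -
  let ?J = "\<integral>y. min 1 \<bar>y\<bar> \<partial>\<nu>"
  let ?\<epsilon> = "h * (?J + 1) / real n"
  have J: "0 \<le> ?J" by simp
  have J1: "0 < ?J + 1" using J by linarith
  have \<epsilon>: "0 < ?\<epsilon>" using h n J1 by (intro divide_pos_pos mult_pos_pos) auto
  have set: "big_jumps h n = {y\<in>space \<nu>. ?\<epsilon> \<le> min 1 \<bar>y\<bar>}"
    using sets_eq_imp_space_eq[OF sets_\<nu>] by (auto simp: big_jumps_def)
  have "emeasure \<nu> (big_jumps h n) \<le> ennreal ((1 / ?\<epsilon>) * ?J)"
    unfolding set by (rule integral_Markov_inequality[OF integrable_min_abs _ \<epsilon>]) auto
  also have "\<dots> < \<infinity>" by simp
  finally show fin: "emeasure \<nu> (big_jumps h n) < \<infinity>" .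
  have "measure \<nu> (big_jumps h n) \<le> ?J / ?\<epsilon>"
    unfolding set by (rule integral_Markov_inequality_measure[OF integrable_min_abs sets.empty_sets _ \<epsilon>]) auto
  then have "h / real n * measure \<nu> (big_jumps h n) \<le> h / real n * (?J / ?\<epsilon>)"
    using h n by (intro mult_left_mono) auto
  also have "\<dots> = ?J / (?J + 1)"
  proof -
    have "h / real n * (J / (h * (J + 1) / real n)) = J / (J + 1)" for J using h n by (simp add: divide_simps)
    then show ?thesis .
  qed
  also have "\<dots> \<le> 1" using J1 by (subst pos_divide_le_eq) auto
  finally show "h / real n * measure \<nu> (big_jumps h n) \<le> 1" .
qed

lemma integrable_big_jumps:
  fixes f :: "real \<Rightarrow> 'b::{banach, second_countable_topology}"
  assumes "integrable \<nu> f"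
  shows "integrable \<nu> (\<lambda>y. indicator (big_jumps h n) y *\<^sub>R f y)"
  by (rule integrable_mult_indicator[OF _ assms]) (simp add: sets_\<nu>)

text \<open>Every \<open>y \<noteq> 0\<close> is eventually a big jump, and at \<open>0\<close>,
  which is left out for all \<open>n > 0\<close>, the integrand vanishes.\<close>

lemma tendsto_integral_big_jumps:
  fixes f :: "real \<Rightarrow> 'b::{banach, second_countable_topology}"
  assumes h: "0 < h" and f: "integrable \<nu> f" "f 0 = 0"
  shows "(\<lambda>n. \<integral>y. indicator (big_jumps h n) y *\<^sub>R f y \<partial>\<nu>) \<longlonglongrightarrow> integral\<^sup>L \<nu> f"
proof (rule integral_dominated_convergence[where w="\<lambda>y. norm (f y)"])
  let ?J = "\<integral>y. min 1 \<bar>y\<bar> \<partial>\<nu>"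
  have "(\<lambda>n. indicator (big_jumps h n) y *\<^sub>R f y) \<longlonglongrightarrow> f y" for y
  proof (cases "y = 0")
    case False
    have "(\<lambda>n. h * (?J + 1) / real n) \<longlonglongrightarrow> 0" by (rule lim_const_over_n)
    then have "eventually (\<lambda>n. h * (?J + 1) / real n < min 1 \<bar>y\<bar>) sequentially"
      using False by (intro order_tendstoD(2)) auto
    then have "eventually (\<lambda>n. indicator (big_jumps h n) y *\<^sub>R f y = f y) sequentially"
      by eventually_elim (auto simp: big_jumps_def)
    then show ?thesis by (rule tendsto_eventually)
  qed (simp add: f)
  then show "AE y in \<nu>. (\<lambda>n. indicator (big_jumps h n) y *\<^sub>R f y) \<longlonglongrightarrow> f y" by simp
qed (use f in \<open>auto simp: indicator_def intro: borel_measurable_integrable integrable_big_jumps[unfolded indicator_def]\<close>)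

definition jump_law :: "real \<Rightarrow> nat \<Rightarrow> real measure" where
  "jump_law h n = lazy_jump_law \<nu> (big_jumps h n) (h / real n)"

lemma sets_jump_law: "sets (jump_law h n) = sets borel"
  by (simp add: jump_law_def sets_lazy_jump_law)

context
  fixes h :: real and n :: nat
  assumes h: "0 < h" and n: "0 < n"
begin

lemma jump_law_weight_nonneg: "0 \<le> h / real n"
  using h by simp

lemmas jump_law_integral = lazy_jump_law_integral[OF sets_\<nu> big_jumps_borel big_jumps_measure(1)[OF h n]
  jump_law_weight_nonneg big_jumps_measure(2)[OF h n], folded jump_law_def]

lemma prob_space_jump_law: "prob_space (jump_law h n)"
  unfolding jump_law_def
  using prob_space_lazy_jump_law[OF sets_\<nu> big_jumps_borel big_jumps_measure(1)[OF h n]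
    jump_law_weight_nonneg big_jumps_measure(2)[OF h n]] .

lemma indicator_big_jumps:
  "integrable \<nu> (\<lambda>y. indicator (big_jumps h n) y :: real)"
  "(\<integral>y. indicator (big_jumps h n) y \<partial>\<nu>) = measure \<nu> (big_jumps h n)"
  using big_jumps_measure(1)[OF h n] by (auto simp: sets_\<nu>)

lemma char_jump_law:
  "char (jump_law h n) u = 1 + (h * (CLINT y|\<nu>. indicator (big_jumps h n) y *\<^sub>R (iexp (u * y) - 1))) / real n"
proof -
  let ?E = "big_jumps h n"
  have i1: "integrable \<nu> (\<lambda>y. indicator ?E y *\<^sub>R (iexp (u * y) - 1))"
    by (rule integrable_big_jumps[OF integrable_iexp_minus_one])
  have i2: "integrable \<nu> (\<lambda>y. indicator ?E y *\<^sub>R (1::complex))"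
    using indicator_big_jumps(1) by (intro integrable_scaleR_left) auto
  have eq: "(\<lambda>y. indicator ?E y *\<^sub>R iexp (u * y)) = (\<lambda>y. indicator ?E y *\<^sub>R (iexp (u * y) - 1) + indicator ?E y *\<^sub>R (1::complex))"
    by (auto simp: fun_eq_iff scaleR_diff_right)
  have "(CLINT y|\<nu>. indicator ?E y *\<^sub>R iexp (u * y)) = (CLINT y|\<nu>. indicator ?E y *\<^sub>R (iexp (u * y) - 1)) + of_real (measure \<nu> ?E)"
    unfolding eq using indicator_big_jumps
    by (subst Bochner_Integration.integral_add[OF i1 i2]) (simp add: integral_scaleR_left scaleR_conv_of_real)
  moreover have "integrable \<nu> (\<lambda>y. indicator ?E y *\<^sub>R iexp (u * y))"
    unfolding eq by (intro Bochner_Integration.integrable_add i1 i2)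
  ultimately show ?thesis
    using jump_law_integral[of "\<lambda>y. iexp (u * y)"] by (simp add: char_def scaleR_conv_of_real algebra_simps)
qed

text \<open>The condition \<open>f 0 = 1\<close> merges the mass at \<open>0\<close> with the jump
  part into the form \<open>1 + z / n\<close>, as in \<open>char_jump_law\<close>, whose
  \<open>n\<close>-th powers have an exponential limit. It is used for \<open>exp\<close> and for
  \<open>max 1 (exp y)\<close>.\<close>

lemma jump_law_integral_real:
  fixes f :: "real \<Rightarrow> real"
  assumes f: "f \<in> borel_measurable borel" "f 0 = 1" "integrable \<nu> (\<lambda>y. f y - 1)"
  shows "integrable (jump_law h n) f" (is ?i)
    and "integral\<^sup>L (jump_law h n) f = 1 + h * (\<integral>y. indicator (big_jumps h n) y *\<^sub>R (f y - 1) \<partial>\<nu>) / real n" (is ?v)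
proof -
  let ?E = "big_jumps h n"
  note one = indicator_big_jumps
  have i1: "integrable \<nu> (\<lambda>y. indicator ?E y *\<^sub>R (f y - 1))" by (rule integrable_big_jumps[OF f(3)])
  have eq: "(\<lambda>y. indicator ?E y *\<^sub>R f y) = (\<lambda>y. indicator ?E y *\<^sub>R (f y - 1) + indicator ?E y)"
    by (auto simp: fun_eq_iff algebra_simps)
  have v: "(\<integral>y. indicator ?E y *\<^sub>R f y \<partial>\<nu>) = (\<integral>y. indicator ?E y *\<^sub>R (f y - 1) \<partial>\<nu>) + measure \<nu> ?E"
    unfolding eq Bochner_Integration.integral_add[OF i1 one(1)] one(2) by simp
  have i: "integrable \<nu> (\<lambda>y. indicator ?E y *\<^sub>R f y)"
    unfolding eq by (intro Bochner_Integration.integrable_add i1 one)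
  show ?i using jump_law_integral[OF f(1) i] by simp
  show ?v using jump_law_integral[OF f(1) i] f(2) unfolding v by (simp add: algebra_simps)
qed

end

end

lemma char_distr_std_normal_affine:
  "char (distr std_normal_distribution borel (\<lambda>g. a * g + b)) u
    = iexp (u * b) * complex_of_real (exp (- ((u * a)\<^sup>2) / 2))"
proof -
  have "char (distr std_normal_distribution borel (\<lambda>g. a * g + b)) u
      = (CLINT g|std_normal_distribution. iexp (u * b) * iexp (u * a * g))"
    unfolding char_def by (subst integral_distr) (auto simp: exp_add[symmetric] algebra_simps)
  also have "\<dots> = iexp (u * b) * char std_normal_distribution (u * a)"
    unfolding char_def by (rule integral_mult_right_zero)
  finally show ?thesis by (simp add: char_std_normal_distribution)
qed

lemma real_distributionI:
  "prob_space N \<Longrightarrow> sets N = sets borel \<Longrightarrow> real_distribution N"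
  using sets_eq_imp_space_eq[of N borel] by (simp add: real_distribution_def real_distribution_axioms_def)

section \<open>Weak approximation of the Levy increment\<close>

context finite_variation_levy_measure
begin

text \<open>\<open>\<rho> n\<close> approximates the law of the sum of all jumps up to time \<open>h\<close> (finite variation), so that
  \<open>e\<^sup>y / c n\<close> is the mean-one factor by which jumps multiply the Black-Scholes price.\<close>

definition compensated_jump_approx :: "real \<Rightarrow> (nat \<Rightarrow> real measure) \<Rightarrow> (nat \<Rightarrow> real) \<Rightarrow> bool" where
  "compensated_jump_approx h \<rho> c \<longleftrightarrow>
    (\<forall>n. prob_space (\<rho> n) \<and> sets (\<rho> n) = sets borel \<and> integrable (\<rho> n) exp \<and> integral\<^sup>L (\<rho> n) exp = c n \<and> 0 < c n \<and>
         integrable (\<rho> n) (\<lambda>y. max 1 (exp y)) \<and> (\<integral>y. max 1 (exp y) \<partial>\<rho> n) \<le> exp (h * up_rate)) \<and>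
    c \<longlonglongrightarrow> exp (h * jump_drift)"

text \<open>Summing the independent lazy jumps of \<open>n\<close> pieces of time is a binomial
  approximation of the jump part. The characteristic function and the mean of \<open>exp\<close> are
  \<open>n\<close>-th powers of \<open>1 + z / n\<close>, with \<open>z\<close> converging as the
  threshold for big jumps tends to \<open>0\<close>.\<close>

lemma ex_compensated_jump_approx:
  assumes h: "0 < h"
  shows "\<exists>\<rho> c. compensated_jump_approx h \<rho> c \<and>
    (\<forall>u. (\<lambda>n. char (\<rho> n) u) \<longlonglongrightarrow> exp (complex_of_real h * (CLINT y|\<nu>. iexp (u * y) - 1)))"
proof -
  let ?E = "\<lambda>n. big_jumps h n"
  \<comment> \<open>Shifted by one, because the properties are demanded for all \<open>n\<close>,
    including \<open>0\<close>.\<close>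
  define \<pi> where "\<pi> n = jump_law h (Suc n)" for n
  have \<pi>: "prob_space (\<pi> n)" "sets (\<pi> n) = sets borel" for n
    unfolding \<pi>_def using prob_space_jump_law[OF h zero_less_Suc] sets_jump_law by auto
  note ch = char_jump_law[OF h zero_less_Suc, folded \<pi>_def]
  note re = jump_law_integral_real[OF h zero_less_Suc, folded \<pi>_def]
  define \<rho> where "\<rho> n = conv_power (\<pi> n) (Suc n)" for n
  define e where "e n = integral\<^sup>L (\<pi> n) exp" for n
  define c where "c n = e n ^ Suc n" for n
  have \<rho>: "prob_space (\<rho> n)" "sets (\<rho> n) = sets borel" for n
    unfolding \<rho>_def using prob_space_conv_power[OF \<pi>] sets_conv_power[OF \<pi>] by blast+
  have e: "integrable (\<pi> n) exp" "e n = 1 + h * (\<integral>y. indicator (?E (Suc n)) y *\<^sub>R (exp y - 1) \<partial>\<nu>) / real (Suc n)" for n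
    using re[of exp n] integrable_exp_minus_one by (auto simp: e_def simp del: of_nat_Suc)
  have e_pos: "0 < e n" for n
  proof -
    interpret prob_space "\<pi> n" by (rule \<pi>)
    have "e n \<noteq> 0"
      unfolding e_def using integral_nonneg_eq_0_iff_AE[OF e(1)] AE_False by simp
    moreover have "0 \<le> e n" unfolding e_def by simp
    ultimately show ?thesis by simp
  qed
  have int_exp: "integrable (\<rho> n) exp \<and> integral\<^sup>L (\<rho> n) exp = c n" for n
  proof -
    have "(\<integral>\<^sup>+y. ennreal (exp y) \<partial>\<pi> n) = ennreal (e n)"
      unfolding e_def using e(1) by (intro nn_integral_eq_integral) auto
    then have *: "(\<integral>\<^sup>+y. ennreal (exp y) \<partial>\<rho> n) = ennreal (c n)"
      unfolding \<rho>_def c_def nn_integral_exp_conv_power[OF \<pi>] using e_pos[of n] by (simp add: ennreal_power del: power_Suc)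
    have m: "exp \<in> borel_measurable (\<rho> n)" using \<rho>(2) by (simp cong: measurable_cong_sets)
    have i: "integrable (\<rho> n) exp"
      using m * by (intro integrableI_nn_integral_finite[where x="c n"]) (auto simp: c_def less_imp_le[OF e_pos])
    moreover have "integral\<^sup>L (\<rho> n) exp = c n"
      using m * by (subst integral_eq_nn_integral) (auto simp: c_def less_imp_le[OF e_pos])
    ultimately show ?thesis by simp
  qed
  have int_max: "integrable (\<rho> n) (\<lambda>y. max 1 (exp y)) \<and> (\<integral>y. max 1 (exp y) \<partial>\<rho> n) \<le> exp (h * up_rate)" for n
  proof -
    define a where "a = (\<integral>y. max 1 (exp y) \<partial>\<pi> n)"
    have a: "integrable (\<pi> n) (\<lambda>y. max 1 (exp y))"
      and a_eq: "a = 1 + h * (\<integral>y. indicator (?E (Suc n)) y *\<^sub>R (max 1 (exp y) - 1) \<partial>\<nu>) / real (Suc n)"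
      using re[of "\<lambda>y. max 1 (exp y)" n] integrable_max_exp by (auto simp: a_def simp del: of_nat_Suc)
    have "(\<integral>y. indicator (?E (Suc n)) y *\<^sub>R (max 1 (exp y) - 1) \<partial>\<nu>) \<le> (\<integral>y. max 1 (exp y) - 1 \<partial>\<nu>)"
      by (intro integral_mono integrable_big_jumps integrable_max_exp) (auto simp: indicator_def)
    also have "\<dots> = up_rate" unfolding up_rate_def max_exp_minus_one ..
    finally have "a \<le> 1 + h * up_rate / real (Suc n)"
      unfolding a_eq using h by (intro add_left_mono divide_right_mono mult_left_mono) auto
    \<comment> \<open>This makes the bound on the \<open>n\<close>-th power independent of
      \<open>n\<close>.\<close>
    also have "\<dots> \<le> exp (h * up_rate / real (Suc n))" by (rule exp_ge_add_one_self)
    finally have a_le: "a \<le> exp (h * up_rate / real (Suc n))" .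
    have a0: "0 \<le> a" unfolding a_def by simp
    have "a ^ Suc n \<le> exp (h * up_rate / real (Suc n)) ^ Suc n"
      using a_le a0 by (rule power_mono)
    also have "\<dots> = exp (h * up_rate)" by (subst exp_of_nat_mult[symmetric]) (simp del: of_nat_Suc)
    finally have an: "a ^ Suc n \<le> exp (h * up_rate)" .
    have "(\<integral>\<^sup>+y. ennreal (max 1 (exp y)) \<partial>\<pi> n) = ennreal a"
      unfolding a_def using a by (intro nn_integral_eq_integral) auto
    then have "(\<integral>\<^sup>+y. ennreal (max 1 (exp y)) \<partial>\<rho> n) \<le> ennreal (a ^ Suc n)"
      unfolding \<rho>_def using nn_integral_max_exp_conv_power[OF \<pi>, of n "Suc n"] a0 by (simp add: ennreal_power del: power_Suc conv_power.simps)
    also have "\<dots> \<le> ennreal (exp (h * up_rate))" using an by (rule ennreal_leI)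
    finally have *: "(\<integral>\<^sup>+y. ennreal (max 1 (exp y)) \<partial>\<rho> n) \<le> ennreal (exp (h * up_rate))" .
    have m: "(\<lambda>y. max 1 (exp y)) \<in> borel_measurable (\<rho> n)" using \<rho>(2) by (simp cong: measurable_cong_sets)
    have "integrable (\<rho> n) (\<lambda>y. max 1 (exp y))"
    proof (rule integrableI_bounded[OF m])
      have "(\<integral>\<^sup>+y. ennreal (norm (max 1 (exp y))) \<partial>\<rho> n) = (\<integral>\<^sup>+y. ennreal (max 1 (exp y)) \<partial>\<rho> n)"
        by (intro nn_integral_cong) (auto simp: abs_of_nonneg)
      also have "\<dots> < \<infinity>" using * by (simp add: le_less_trans)
      finally show "(\<integral>\<^sup>+y. ennreal (norm (max 1 (exp y))) \<partial>\<rho> n) < \<infinity>" .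
    qed
    moreover have "(\<integral>y. max 1 (exp y) \<partial>\<rho> n) \<le> exp (h * up_rate)"
      using m * by (subst integral_eq_nn_integral) (auto intro: enn2real_leI)
    ultimately show ?thesis by simp
  qed
  have "(\<lambda>n. h * (\<integral>y. indicator (?E n) y *\<^sub>R (exp y - 1) \<partial>\<nu>)) \<longlonglongrightarrow> h * jump_drift"
    unfolding jump_drift_def
    by (intro tendsto_mult tendsto_const tendsto_integral_big_jumps[OF h integrable_exp_minus_one]) simp
  from LIMSEQ_Suc[OF tendsto_one_plus_div_power_exp_real[OF this]]
  have c_lim: "c \<longlonglongrightarrow> exp (h * jump_drift)"
    by (simp add: c_def[abs_def] e(2))
  have "(\<lambda>n. char (\<rho> n) u) \<longlonglongrightarrow> exp (complex_of_real h * (CLINT y|\<nu>. iexp (u * y) - 1))" for u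
  proof -
    have "(\<lambda>n. complex_of_real h * (CLINT y|\<nu>. indicator (?E n) y *\<^sub>R (iexp (u * y) - 1)))
        \<longlonglongrightarrow> complex_of_real h * (CLINT y|\<nu>. iexp (u * y) - 1)"
      by (intro tendsto_mult tendsto_const tendsto_integral_big_jumps[OF h integrable_iexp_minus_one]) simp
    from LIMSEQ_Suc[OF tendsto_one_plus_div_power_exp[OF this]]
    show ?thesis unfolding \<rho>_def char_conv_power[OF \<pi>] ch by simp
  qed
  moreover have "compensated_jump_approx h \<rho> c"
    unfolding compensated_jump_approx_def
    using \<rho> int_exp int_max c_lim e_pos by (auto simp: c_def)
  ultimately show ?thesis by blast
qed

text \<open>Levy's continuity theorem: the Gaussian characteristic function times that of
  \<open>\<rho> n\<close>, with the shift \<open>- ln (c n)\<close> that compensates the jumps,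
  tends to that of \<open>X h\<close>. The sequences are chosen before the test function, since
  estimates that compare two starting prices need them in common.\<close>

lemma levy_weak_approximation:
  assumes triplet: "levy_triplet M X \<sigma> \<gamma> \<nu>"
    and mart: "\<sigma>\<^sup>2 / 2 + \<gamma> + (\<integral>y. exp y - 1 - y * indicator {y. \<bar>y\<bar> \<le> 1} y \<partial>\<nu>) = 0"
    and h: "0 < h"
  shows "\<exists>\<rho> c. compensated_jump_approx h \<rho> c \<and>
    (\<forall>(\<phi> :: real \<Rightarrow> real) B. (\<forall>y. isCont \<phi> y) \<longrightarrow> (\<forall>y. \<bar>\<phi> y\<bar> \<le> B) \<longrightarrow>
      (\<lambda>n. \<integral>g. \<integral>y. \<phi> (\<sigma> * sqrt h * g - \<sigma>\<^sup>2 / 2 * h - ln (c n) + y) \<partial>\<rho> n \<partial>std_normal_distribution)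
        \<longlonglongrightarrow> (\<integral>y. \<phi> y \<partial>distr M borel (X h)))"
proof -
  obtain \<rho> c where approx: "compensated_jump_approx h \<rho> c"
    and ch: "\<And>u. (\<lambda>n. char (\<rho> n) u) \<longlonglongrightarrow> exp (complex_of_real h * (CLINT y|\<nu>. iexp (u * y) - 1))"
    using ex_compensated_jump_approx[OF h] by blast
  have \<rho>: "prob_space (\<rho> n)" "sets (\<rho> n) = sets borel" and c_pos: "0 < c n" for n
    using approx by (auto simp: compensated_jump_approx_def)
  have c_lim: "c \<longlonglongrightarrow> exp (h * jump_drift)" using approx by (simp add: compensated_jump_approx_def)
  define G where "G n = distr std_normal_distribution borel (\<lambda>g. \<sigma> * sqrt h * g + (- \<sigma>\<^sup>2 / 2 * h - ln (c n)))" for n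
  have std: "prob_space std_normal_distribution" by (rule prob_space_normal_density) simp
  have G: "prob_space (G n)" "sets (G n) = sets borel" for n
    unfolding G_def by (auto intro!: prob_space.prob_space_distr[OF std])
  have \<Lambda>: "real_distribution (G n \<star> \<rho> n)" for n
    using G \<rho> by (intro real_distributionI prob_space_convolution) auto
  have X: "levy_process M X" and chX: "\<And>u. char (distr M borel (X h)) u = exp (complex_of_real h * levy_exponent \<sigma> \<gamma> \<nu> u)"
    using triplet h by (auto simp: levy_triplet_def)
  interpret M: prob_space M using X by (simp add: levy_process_def)
  have Xd: "real_distribution (distr M borel (X h))"
    using X by (intro M.real_distribution_distr) (simp add: levy_process_def)
  have "weak_conv_m (\<lambda>n. G n \<star> \<rho> n) (distr M borel (X h))"
  proof (rule levy_continuity[OF \<Lambda> Xd])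
    fix u
    have "(\<lambda>n. ln (c n)) \<longlonglongrightarrow> ln (exp (h * jump_drift))"
      by (intro tendsto_ln c_lim) simp
    then have ln_lim: "(\<lambda>n. ln (c n)) \<longlonglongrightarrow> h * jump_drift" by simp
    have "(\<lambda>n. iexp (u * (- \<sigma>\<^sup>2 / 2 * h - ln (c n))) * complex_of_real (exp (- ((u * (\<sigma> * sqrt h))\<^sup>2) / 2)) * char (\<rho> n) u)
      \<longlonglongrightarrow> iexp (u * (- \<sigma>\<^sup>2 / 2 * h - h * jump_drift)) * complex_of_real (exp (- ((u * (\<sigma> * sqrt h))\<^sup>2) / 2))
          * exp (complex_of_real h * (CLINT y|\<nu>. iexp (u * y) - 1))"
      by (intro tendsto_intros ln_lim ch)
    also have "iexp (u * (- \<sigma>\<^sup>2 / 2 * h - h * jump_drift)) * complex_of_real (exp (- ((u * (\<sigma> * sqrt h))\<^sup>2) / 2))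
          * exp (complex_of_real h * (CLINT y|\<nu>. iexp (u * y) - 1))
        = exp (complex_of_real h * levy_exponent \<sigma> \<gamma> \<nu> u)"
    proof -
      have sq: "(u * (\<sigma> * sqrt h))\<^sup>2 = h * (\<sigma>\<^sup>2 * u\<^sup>2)"
        using h by (simp add: power_mult_distrib algebra_simps)
      have "\<i> * complex_of_real (u * (- \<sigma>\<^sup>2 / 2 * h - h * jump_drift)) + complex_of_real (- (h * (\<sigma>\<^sup>2 * u\<^sup>2)) / 2)
          + complex_of_real h * (CLINT y|\<nu>. iexp (u * y) - 1) = complex_of_real h * levy_exponent \<sigma> \<gamma> \<nu> u"
        unfolding levy_exponent_eq[OF mart] by (simp add: algebra_simps)
      then show ?thesis unfolding sq exp_of_real[symmetric] exp_add[symmetric] by simp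
    qed
    also have "(\<lambda>n. iexp (u * (- \<sigma>\<^sup>2 / 2 * h - ln (c n))) * complex_of_real (exp (- ((u * (\<sigma> * sqrt h))\<^sup>2) / 2)) * char (\<rho> n) u)
        = (\<lambda>n. char (G n \<star> \<rho> n) u)"
      by (simp only: char_convolution[OF G(1) \<rho>(1) G(2) \<rho>(2)], simp only: G_def char_distr_std_normal_affine)
    finally show "(\<lambda>n. char (G n \<star> \<rho> n) u) \<longlonglongrightarrow> char (distr M borel (X h)) u"
      unfolding chX .
  qed
  note conv = weak_conv_imp_integral_bdd_continuous_conv[OF \<Lambda> Xd this]
  have "(\<lambda>n. \<integral>g. \<integral>y. \<phi> (\<sigma> * sqrt h * g - \<sigma>\<^sup>2 / 2 * h - ln (c n) + y) \<partial>\<rho> n \<partial>std_normal_distribution)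
        \<longlonglongrightarrow> (\<integral>y. \<phi> y \<partial>distr M borel (X h))"
    if cont: "\<And>y. isCont \<phi> y" and bd: "\<And>y. \<bar>\<phi> y\<bar> \<le> B" for \<phi> :: "real \<Rightarrow> real" and B
  proof -
    have m[measurable]: "\<phi> \<in> borel_measurable borel"
      using cont by (intro borel_measurable_continuous_onI continuous_at_imp_continuous_on) auto
    have "integral\<^sup>L (G n \<star> \<rho> n) \<phi>
      = (\<integral>g. \<integral>y. \<phi> (\<sigma> * sqrt h * g - \<sigma>\<^sup>2 / 2 * h - ln (c n) + y) \<partial>\<rho> n \<partial>std_normal_distribution)" for n
    proof -
      interpret \<rho>: prob_space "\<rho> n" by (rule \<rho>)
      note [measurable_cong] = \<rho>(2)
      have "integral\<^sup>L (G n \<star> \<rho> n) \<phi> = (\<integral>x. \<integral>y. \<phi> (x + y) \<partial>\<rho> n \<partial>G n)"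
        using bd by (intro integral_convolution[OF G(1) \<rho>(1) G(2) \<rho>(2) m, where B=B]) auto
      also have "\<dots> = (\<integral>g. \<integral>y. \<phi> (\<sigma> * sqrt h * g + (- \<sigma>\<^sup>2 / 2 * h - ln (c n)) + y) \<partial>\<rho> n \<partial>std_normal_distribution)"
        unfolding G_def by (subst integral_distr) auto
      finally show ?thesis by (simp add: algebra_simps)
    qed
    then show ?thesis using conv[of \<phi> B] cont bd by simp
  qed
  then show ?thesis using approx by blast
qed

end

section \<open>One-step comparison with the Black-Scholes model\<close>

lemma std_normal_exp:
  "integrable std_normal_distribution (\<lambda>g. exp (a * g))" (is ?i)
  "(\<integral>g. exp (a * g) \<partial>std_normal_distribution) = exp (a\<^sup>2 / 2)" (is ?v)
proof -
  have eq: "std_normal_density g * exp (a * g) = exp (a\<^sup>2 / 2) * normal_density a 1 g" for g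
  proof -
    have "- (g\<^sup>2) / 2 + a * g = a\<^sup>2 / 2 - (g - a)\<^sup>2 / 2"
      by (simp add: power2_eq_square algebra_simps add_divide_distrib diff_divide_distrib)
    then show ?thesis
      by (simp add: normal_density_def mult_exp_exp)
  qed
  have i: "integrable lborel (\<lambda>g. std_normal_density g * exp (a * g))"
    unfolding eq by (intro integrable_mult_right integrable_normal_density) simp
  have v: "(\<integral>g. std_normal_density g * exp (a * g) \<partial>lborel) = exp (a\<^sup>2 / 2)"
    unfolding eq by (simp add: integral_normal_density)
  show ?i using i by (subst integrable_density) auto
  show ?v using v by (subst integral_density) auto
qed

lemma pair_integral_mult:
  fixes u :: "'a \<Rightarrow> real" and v :: "'b \<Rightarrow> real"
  assumes "prob_space M" "prob_space N" and u: "integrable M u" and v: "integrable N v"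
  shows "integrable (M \<Otimes>\<^sub>M N) (\<lambda>(x, y). u x * v y)"
    and "(\<integral>(x, y). u x * v y \<partial>(M \<Otimes>\<^sub>M N)) = integral\<^sup>L M u * integral\<^sup>L N v"
proof -
  interpret M: prob_space M by fact
  interpret N: prob_space N by fact
  interpret P: pair_prob_space M N by unfold_locales
  have [measurable]: "u \<in> borel_measurable M" "v \<in> borel_measurable N" using u v by auto
  show i: "integrable (M \<Otimes>\<^sub>M N) (\<lambda>(x, y). u x * v y)"
  proof (rule P.Fubini_integrable)
    show "integrable M (\<lambda>x. \<integral>y. norm (case (x, y) of (x, y) \<Rightarrow> u x * v y) \<partial>N)"
      using u v by (simp add: abs_mult)
    show "AE x in M. integrable N (\<lambda>y. case (x, y) of (x, y) \<Rightarrow> u x * v y)" using v by simp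
  qed measurable
  show "(\<integral>(x, y). u x * v y \<partial>(M \<Otimes>\<^sub>M N)) = integral\<^sup>L M u * integral\<^sup>L N v"
    using P.integral_fst'[OF i] by simp
qed

section \<open>The laws of one step in the two models\<close>

locale put_setting = finite_variation_levy_measure +
  fixes M :: "'a measure" and X :: "real \<Rightarrow> 'a \<Rightarrow> real" and \<sigma> \<gamma> r \<delta> K :: real
  assumes triplet: "levy_triplet M X \<sigma> \<gamma> \<nu>"
    and mart: "\<sigma>\<^sup>2 / 2 + \<gamma> + (\<integral>y. exp y - 1 - y * indicator {y. \<bar>y\<bar> \<le> 1} y \<partial>\<nu>) = 0"
    and \<sigma>: "0 < \<sigma>" and K: "0 < K" and r: "0 < r" and \<delta>: "0 \<le> \<delta>"
begin

definition levy_law :: "real \<Rightarrow> real measure" where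
  "levy_law h = distr M borel (\<lambda>\<omega>. (r - \<delta>) * h + X h \<omega>)"

abbreviation bs :: "real \<Rightarrow> real measure" where
  "bs h \<equiv> bs_law (r - \<delta> - \<sigma>\<^sup>2 / 2) \<sigma> h"

definition bs_growth :: "real \<Rightarrow> real \<Rightarrow> real" where
  "bs_growth h g = exp ((r - \<delta> - \<sigma>\<^sup>2 / 2) * h + \<sigma> * sqrt h * g)"

lemma levy_X: "levy_process M X"
  using triplet by (simp add: levy_triplet_def)

lemma prob_space_M: "prob_space M"
  using levy_X by (simp add: levy_process_def)

lemma X_measurable[measurable]: "X s \<in> borel_measurable M"
  using levy_X by (simp add: levy_process_def)

lemma prob_space_levy_law: "prob_space (levy_law h)"
  unfolding levy_law_def by (intro prob_space.prob_space_distr prob_space_M) simp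

lemma sets_levy_law: "sets (levy_law h) = sets borel"
  by (simp add: levy_law_def)

lemma prob_space_std: "prob_space std_normal_distribution"
  by (rule prob_space_normal_density) simp

lemma bs_growth_pos: "0 < bs_growth h g"
  by (simp add: bs_growth_def)

lemma bs_growth_measurable[measurable]: "bs_growth h \<in> borel_measurable borel"
  unfolding bs_growth_def by measurable

text \<open>Moments of a lognormal variable. The order one gives the mean of the growth; the barrier
  calls for orders up to four.\<close>

lemma bs_growth_power:
  assumes h: "0 \<le> h"
  shows "integrable std_normal_distribution (\<lambda>g. bs_growth h g ^ j)"
    and "(\<integral>g. bs_growth h g ^ j \<partial>std_normal_distribution)
      = exp (h * (real j * (r - \<delta> - \<sigma>\<^sup>2 / 2) + (real j)\<^sup>2 * \<sigma>\<^sup>2 / 2))"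
proof -
  have eq: "bs_growth h g ^ j = exp (real j * ((r - \<delta> - \<sigma>\<^sup>2 / 2) * h)) * exp (real j * \<sigma> * sqrt h * g)" for g
    unfolding bs_growth_def exp_of_nat_mult[symmetric] by (simp add: exp_add[symmetric] algebra_simps)
  show "integrable std_normal_distribution (\<lambda>g. bs_growth h g ^ j)"
    unfolding eq by (intro integrable_mult_right std_normal_exp(1))
  have "(real j * \<sigma> * sqrt h)\<^sup>2 = h * ((real j)\<^sup>2 * \<sigma>\<^sup>2)" using h by (simp add: power_mult_distrib)
  then have "(\<integral>g. bs_growth h g ^ j \<partial>std_normal_distribution)
      = exp (real j * ((r - \<delta> - \<sigma>\<^sup>2 / 2) * h)) * exp (h * ((real j)\<^sup>2 * \<sigma>\<^sup>2) / 2)"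
    unfolding eq integral_mult_right_zero std_normal_exp(2) by simp
  then show "(\<integral>g. bs_growth h g ^ j \<partial>std_normal_distribution)
      = exp (h * (real j * (r - \<delta> - \<sigma>\<^sup>2 / 2) + (real j)\<^sup>2 * \<sigma>\<^sup>2 / 2))"
    by (simp add: exp_add[symmetric] algebra_simps)
qed

lemma bs_growth_mean:
  assumes "0 \<le> h"
  shows "integrable std_normal_distribution (bs_growth h)"
    and "integral\<^sup>L std_normal_distribution (bs_growth h) = exp ((r - \<delta>) * h)"
  using bs_growth_power[OF assms, of 1] by (auto simp: algebra_simps)

lemma bs_integral:
  fixes f :: "real \<Rightarrow> real"
  assumes f: "f \<in> borel_measurable borel"
  shows "(\<integral>y. f (x * exp y) \<partial>bs h) = (\<integral>g. f (x * bs_growth h g) \<partial>std_normal_distribution)"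
  unfolding bs_law_def using f by (subst integral_distr) (auto simp: bs_growth_def)

lemma isCont_payoff_exp:
  fixes f :: "real \<Rightarrow> real"
  assumes f: "continuous_on {0..} f" and x: "0 \<le> x"
  shows "isCont (\<lambda>y. f (x * exp y)) y"
proof -
  have "continuous_on UNIV (\<lambda>y. f (x * exp y))"
    using x by (intro continuous_on_compose2[OF f] continuous_intros) auto
  then show ?thesis by (simp add: continuous_on_eq_continuous_at)
qed

lemma payoff_exp_measurable:
  fixes f :: "real \<Rightarrow> real"
  assumes "continuous_on {0..} f" and "0 \<le> x"
  shows "(\<lambda>y. f (x * exp y)) \<in> borel_measurable borel"
  using isCont_payoff_exp[OF assms]
  by (intro borel_measurable_continuous_onI continuous_at_imp_continuous_on) auto

text \<open>The weak approximation in terms of prices: in the limit one Levy step is a Black-Scholes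
  step times an independent factor \<open>exp y / c n\<close> of mean one. Test functions need be
  continuous and bounded on nonnegative prices only, where option values are controlled.\<close>

lemma levy_law_approx:
  assumes h: "0 < h"
  shows "\<exists>\<rho> c. compensated_jump_approx h \<rho> c \<and>
    (\<forall>(f :: real \<Rightarrow> real) B x. continuous_on {0..} f \<longrightarrow> (\<forall>y\<ge>0. \<bar>f y\<bar> \<le> B) \<longrightarrow> 0 \<le> x \<longrightarrow>
      (\<lambda>n. \<integral>(g, y). f (x * (bs_growth h g / c n) * exp y) \<partial>(std_normal_distribution \<Otimes>\<^sub>M \<rho> n))
        \<longlonglongrightarrow> (\<integral>y. f (x * exp y) \<partial>levy_law h))"
proof -
  obtain \<rho> c where approx: "compensated_jump_approx h \<rho> c"
    and conv: "\<And>(\<phi> :: real \<Rightarrow> real) B. (\<And>y. isCont \<phi> y) \<Longrightarrow> (\<And>y. \<bar>\<phi> y\<bar> \<le> B) \<Longrightarrow>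
      (\<lambda>n. \<integral>g. \<integral>y. \<phi> (\<sigma> * sqrt h * g - \<sigma>\<^sup>2 / 2 * h - ln (c n) + y) \<partial>\<rho> n \<partial>std_normal_distribution)
        \<longlonglongrightarrow> (\<integral>y. \<phi> y \<partial>distr M borel (X h))"
    using levy_weak_approximation[OF triplet mart h] by blast
  have \<rho>: "prob_space (\<rho> n)" "sets (\<rho> n) = sets borel" and c_pos: "0 < c n" for n
    using approx by (auto simp: compensated_jump_approx_def)
  have main: "(\<lambda>n. \<integral>(g, y). f (x * (bs_growth h g / c n) * exp y) \<partial>(std_normal_distribution \<Otimes>\<^sub>M \<rho> n))
        \<longlonglongrightarrow> (\<integral>y. f (x * exp y) \<partial>levy_law h)"
    if f: "continuous_on {0..} f" and bd: "\<And>y. 0 \<le> y \<Longrightarrow> \<bar>f y\<bar> \<le> B" and x: "0 \<le> x"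
    for f :: "real \<Rightarrow> real" and B x
  proof -
    define \<phi> where "\<phi> y = f (x * exp ((r - \<delta>) * h) * exp y)" for y
    have x': "0 \<le> x * exp ((r - \<delta>) * h)" using x by simp
    have cont: "isCont \<phi> y" for y
      unfolding \<phi>_def by (rule isCont_payoff_exp[OF f x'])
    have \<phi>_bd: "\<bar>\<phi> y\<bar> \<le> B" for y unfolding \<phi>_def using x by (intro bd) auto
    have m[measurable]: "\<phi> \<in> borel_measurable borel"
      unfolding \<phi>_def by (rule payoff_exp_measurable[OF f x'])
    have eq: "f (x * (bs_growth h g / c n) * exp y) = \<phi> (\<sigma> * sqrt h * g - \<sigma>\<^sup>2 / 2 * h - ln (c n) + y)" for g n y
    proof -
      have "exp ((r - \<delta>) * h) * exp (\<sigma> * sqrt h * g - \<sigma>\<^sup>2 / 2 * h - ln (c n) + y) = bs_growth h g / c n * exp y"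
      proof -
        have "bs_growth h g / c n * exp y = exp ((r - \<delta> - \<sigma>\<^sup>2 / 2) * h + \<sigma> * sqrt h * g) * exp (- ln (c n)) * exp y"
          using c_pos[of n] by (simp add: bs_growth_def exp_minus field_simps)
        also have "\<dots> = exp ((r - \<delta>) * h + (\<sigma> * sqrt h * g - \<sigma>\<^sup>2 / 2 * h - ln (c n) + y))"
          unfolding exp_add[symmetric] by (simp add: algebra_simps)
        finally show ?thesis by (simp add: exp_add)
      qed
      then show ?thesis by (simp add: \<phi>_def mult.assoc)
    qed
    have "(\<integral>(g, y). f (x * (bs_growth h g / c n) * exp y) \<partial>(std_normal_distribution \<Otimes>\<^sub>M \<rho> n))
      = (\<integral>g. \<integral>y. \<phi> (\<sigma> * sqrt h * g - \<sigma>\<^sup>2 / 2 * h - ln (c n) + y) \<partial>\<rho> n \<partial>std_normal_distribution)" for n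
    proof -
      interpret s: prob_space std_normal_distribution by (rule prob_space_std)
      interpret \<rho>: prob_space "\<rho> n" by (rule \<rho>)
      interpret P: pair_prob_space std_normal_distribution "\<rho> n" by unfold_locales
      note [measurable_cong] = \<rho>(2)
      have "integrable (std_normal_distribution \<Otimes>\<^sub>M \<rho> n) (\<lambda>(g, y). \<phi> (\<sigma> * sqrt h * g - \<sigma>\<^sup>2 / 2 * h - ln (c n) + y))"
        using \<phi>_bd by (intro P.integrable_const_bound[where B=B]) auto
      from P.integral_fst'[OF this] show ?thesis by (simp only: eq prod.case)
    qed
    moreover have "(\<integral>y. \<phi> y \<partial>distr M borel (X h)) = (\<integral>y. f (x * exp y) \<partial>levy_law h)"
    proof -
      have "(\<integral>y. f (x * exp y) \<partial>levy_law h) = (\<integral>\<omega>. f (x * exp ((r - \<delta>) * h + X h \<omega>)) \<partial>M)"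
        unfolding levy_law_def using payoff_exp_measurable[OF f x] by (subst integral_distr) auto
      also have "\<dots> = (\<integral>\<omega>. \<phi> (X h \<omega>) \<partial>M)" by (simp add: \<phi>_def exp_add mult.assoc)
      also have "\<dots> = (\<integral>y. \<phi> y \<partial>distr M borel (X h))" by (subst integral_distr) auto
      finally show ?thesis by simp
    qed
    ultimately show ?thesis using conv[OF cont \<phi>_bd] by simp
  qed
  show ?thesis
  proof (intro exI[of _ \<rho>] exI[of _ c] conjI approx allI impI)
    fix f :: "real \<Rightarrow> real" and B x :: real
    assume "continuous_on {0..} f" "\<forall>y\<ge>0. \<bar>f y\<bar> \<le> B" "0 \<le> x"
    then show "(\<lambda>n. \<integral>(g, y). f (x * (bs_growth h g / c n) * exp y) \<partial>(std_normal_distribution \<Otimes>\<^sub>M \<rho> n))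
        \<longlonglongrightarrow> (\<integral>y. f (x * exp y) \<partial>levy_law h)"
      by (intro main[where B=B]) auto
  qed
qed

end

text \<open>One member of the approximating sequence. The compensating \<open>1 / c\<close> is
  attached to the Gaussian factor \<open>u\<close>, so that the other factor is plainly
  \<open>exp y\<close>. The bounds proved here involve \<open>\<rho>\<close> only through
  \<open>c\<close>, which makes them stable under the weak limit.\<close>

locale jump_factor = put_setting +
  fixes h :: real and \<rho> :: "real measure" and c :: real
  assumes h: "0 < h" and prob_\<rho>: "prob_space \<rho>" and sets_\<rho>: "sets \<rho> = sets borel"
    and int_exp: "integrable \<rho> exp" and exp_mean: "integral\<^sup>L \<rho> exp = c" and c_pos: "0 < c"
    and int_max: "integrable \<rho> (\<lambda>y. max 1 (exp y))" and max_mean: "(\<integral>y. max 1 (exp y) \<partial>\<rho>) \<le> exp (h * up_rate)"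
begin

abbreviation "P \<equiv> std_normal_distribution \<Otimes>\<^sub>M \<rho>"
abbreviation "u g \<equiv> bs_growth h g / c"

sublocale \<rho>: prob_space \<rho> by (rule prob_\<rho>)
sublocale std: prob_space std_normal_distribution by (rule prob_space_std)
sublocale P: pair_prob_space std_normal_distribution \<rho> by unfold_locales

declare sets_\<rho>[measurable_cong]

lemma u_pos: "0 < u g"
  using bs_growth_pos c_pos by simp

lemma xub_nonneg: "0 \<le> x \<Longrightarrow> 0 \<le> x * u g * exp y"
  using u_pos[of g] by (intro mult_nonneg_nonneg) auto

lemma u_power:
  "integrable std_normal_distribution (\<lambda>g. u g ^ j)"
  "(\<integral>g. u g ^ j \<partial>std_normal_distribution) = exp (h * (real j * (r - \<delta> - \<sigma>\<^sup>2 / 2) + (real j)\<^sup>2 * \<sigma>\<^sup>2 / 2)) / c ^ j"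
  using bs_growth_power[of h j] h by (auto simp: power_divide)

lemma u_mean:
  "integrable std_normal_distribution u"
  "(\<integral>g. u g \<partial>std_normal_distribution) = exp ((r - \<delta>) * h) / c"
  using bs_growth_mean[of h] h by auto

lemma ub_mean:
  "integrable P (\<lambda>(g, y). u g * exp y)"
  "(\<integral>(g, y). u g * exp y \<partial>P) = exp ((r - \<delta>) * h)"
  using pair_integral_mult[OF prob_space_std prob_\<rho> u_mean(1) int_exp] exp_mean u_mean(2) c_pos by auto

text \<open>From \<open>\<bar>a - 1\<bar> = 2 * max 1 a - 1 - a\<close> for
  \<open>a = exp y\<close>: the mean and the upward part determine the mean absolute
  deviation.\<close>

lemma abs_jump:
  "integrable \<rho> (\<lambda>y. \<bar>exp y - 1\<bar>)"
  "(\<integral>y. \<bar>exp y - 1\<bar> \<partial>\<rho>) \<le> 2 * exp (h * up_rate) - 1 - c"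
proof -
  have eq: "(\<lambda>y. \<bar>exp y - 1\<bar>) = (\<lambda>y. 2 * max 1 (exp y) - 1 - exp y :: real)"
    by (auto simp: fun_eq_iff max_def abs_if)
  show "integrable \<rho> (\<lambda>y. \<bar>exp y - 1\<bar>)"
    unfolding eq using int_max int_exp by auto
  have "(\<integral>y. \<bar>exp y - 1\<bar> \<partial>\<rho>) = 2 * (\<integral>y. max 1 (exp y) \<partial>\<rho>) - 1 - c"
    unfolding eq using int_max int_exp by (simp add: exp_mean \<rho>.prob_space)
  then show "(\<integral>y. \<bar>exp y - 1\<bar> \<partial>\<rho>) \<le> 2 * exp (h * up_rate) - 1 - c"
    using max_mean by simp
qed

context
  fixes f :: "real \<Rightarrow> real" and B :: real
  assumes cont: "continuous_on {0..} f" and bd: "\<And>y. 0 \<le> y \<Longrightarrow> \<bar>f y\<bar> \<le> B"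
begin

lemma f_bs_measurable: "0 \<le> x \<Longrightarrow> (\<lambda>g. f (x * bs_growth h g)) \<in> borel_measurable borel"
proof -
  assume "0 \<le> x"
  from payoff_exp_measurable[OF cont this]
  have "(\<lambda>g. f (x * exp ((r - \<delta> - \<sigma>\<^sup>2 / 2) * h + \<sigma> * sqrt h * g))) \<in> borel_measurable borel"
    by (rule measurable_compose[rotated]) measurable
  then show ?thesis by (simp add: bs_growth_def)
qed

lemma f_integrable:
  assumes x: "0 \<le> x"
  shows "integrable P (\<lambda>(g, y). f (x * u g * exp y))"
proof (rule P.integrable_const_bound[where B=B])
  show "AE z in P. norm (case z of (g, y) \<Rightarrow> f (x * u g * exp y)) \<le> B"
    using x c_pos by (intro AE_I2) (auto intro!: bd mult_nonneg_nonneg simp: less_imp_le[OF bs_growth_pos])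
  have "(\<lambda>z. (\<lambda>y. f (x * exp y)) (case z of (g, y) \<Rightarrow> (r - \<delta> - \<sigma>\<^sup>2 / 2) * h + \<sigma> * sqrt h * g - ln c + y)) \<in> borel_measurable P"
    by (rule measurable_compose[OF _ payoff_exp_measurable[OF cont x]]) measurable
  also have "(\<lambda>z. (\<lambda>y. f (x * exp y)) (case z of (g, y) \<Rightarrow> (r - \<delta> - \<sigma>\<^sup>2 / 2) * h + \<sigma> * sqrt h * g - ln c + y))
     = (\<lambda>(g, y). f (x * u g * exp y))"
    using c_pos by (auto simp: fun_eq_iff bs_growth_def exp_add exp_diff mult.assoc)
  finally show "(\<lambda>(g, y). f (x * u g * exp y)) \<in> borel_measurable P" .
qed

lemma f_bs_integrable:
  assumes x: "0 \<le> x"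
  shows "integrable std_normal_distribution (\<lambda>g. f (x * bs_growth h g))"
  using f_bs_measurable[OF x] x
  by (intro std.integrable_const_bound[where B=B] AE_I2) (auto intro!: bd mult_nonneg_nonneg simp: less_imp_le[OF bs_growth_pos])

lemma f_bs_integrable_P:
  assumes x: "0 \<le> x"
  shows "integrable P (\<lambda>(g, y). f (x * bs_growth h g))"
    and "(\<integral>(g, y). f (x * bs_growth h g) \<partial>P) = (\<integral>g. f (x * bs_growth h g) \<partial>std_normal_distribution)"
  using pair_integral_mult[OF prob_space_std prob_\<rho> f_bs_integrable[OF x], of "\<lambda>_. 1"] by (simp_all add: \<rho>.prob_space)

lemma approx_lipschitz:
  assumes lip: "\<And>a b. 0 \<le> a \<Longrightarrow> 0 \<le> b \<Longrightarrow> \<bar>f a - f b\<bar> \<le> \<bar>a - b\<bar>" and x: "0 \<le> x" "0 \<le> x'"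
  shows "\<bar>(\<integral>(g, y). f (x * u g * exp y) \<partial>P) - (\<integral>(g, y). f (x' * u g * exp y) \<partial>P)\<bar> \<le> \<bar>x - x'\<bar> * exp ((r - \<delta>) * h)"
proof -
  have eq: "(\<integral>(g, y). f (x * u g * exp y) \<partial>P) - (\<integral>(g, y). f (x' * u g * exp y) \<partial>P)
      = (\<integral>(g, y). f (x * u g * exp y) - f (x' * u g * exp y) \<partial>P)"
    using Bochner_Integration.integral_diff[OF f_integrable[OF x(1)] f_integrable[OF x(2)]]
    by (simp add: case_prod_unfold)
  have "\<bar>\<integral>(g, y). f (x * u g * exp y) - f (x' * u g * exp y) \<partial>P\<bar>
      \<le> (\<integral>z. \<bar>case z of (g, y) \<Rightarrow> f (x * u g * exp y) - f (x' * u g * exp y)\<bar> \<partial>P)"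
    by (rule integral_abs_bound)
  also have "\<dots> \<le> (\<integral>z. \<bar>x - x'\<bar> * (case z of (g, y) \<Rightarrow> u g * exp y) \<partial>P)"
  proof (rule integral_mono)
    show "integrable P (\<lambda>z. \<bar>case z of (g, y) \<Rightarrow> f (x * u g * exp y) - f (x' * u g * exp y)\<bar>)"
      using Bochner_Integration.integrable_diff[OF f_integrable[OF x(1)] f_integrable[OF x(2)]]
      by (intro integrable_abs) (simp add: case_prod_unfold)
    show "integrable P (\<lambda>z. \<bar>x - x'\<bar> * (case z of (g, y) \<Rightarrow> u g * exp y))"
      by (intro integrable_mult_right ub_mean)
    fix z :: "real \<times> real"
    obtain g y where z: "z = (g, y)" by (cases z)
    have "\<bar>f (x * u g * exp y) - f (x' * u g * exp y)\<bar> \<le> \<bar>x * u g * exp y - x' * u g * exp y\<bar>"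
      by (intro lip xub_nonneg x)
    also have "x * u g * exp y - x' * u g * exp y = (x - x') * (u g * exp y)" by (simp only: left_diff_distrib mult.assoc)
    also have "\<bar>(x - x') * (u g * exp y)\<bar> = \<bar>x - x'\<bar> * (u g * exp y)"
      by (simp only: abs_mult abs_of_pos[OF u_pos] abs_exp_cancel)
    finally show "\<bar>case z of (g, y) \<Rightarrow> f (x * u g * exp y) - f (x' * u g * exp y)\<bar> \<le> \<bar>x - x'\<bar> * (case z of (g, y) \<Rightarrow> u g * exp y)"
      by (simp add: z)
  qed
  also have "\<dots> = \<bar>x - x'\<bar> * exp ((r - \<delta>) * h)" by (simp only: integral_mult_right_zero ub_mean(2))
  finally show ?thesis unfolding eq .
qed

text \<open>Jensen's inequality in the jump variable for fixed Gaussian factor, as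
  \<open>exp y / c\<close> has mean one.\<close>

lemma bs_le_approx:
  assumes conv: "convex_on {0..} f" and x: "0 \<le> x"
  shows "(\<integral>g. f (x * bs_growth h g) \<partial>std_normal_distribution) \<le> (\<integral>(g, y). f (x * u g * exp y) \<partial>P)"
proof -
  have le: "f (x * bs_growth h g) \<le> (\<integral>y. f (x * u g * exp y) \<partial>\<rho>)" for g
  \<comment> \<open>Jensen's inequality is applied on the open half-line, which the constant
    argument \<open>0\<close> misses.\<close>
  proof (cases "x = 0")
    case False
    then have a: "0 < x * u g" using x bs_growth_pos[of h g] c_pos by simp
    have "f (\<integral>y. x * u g * exp y \<partial>\<rho>) \<le> (\<integral>y. f (x * u g * exp y) \<partial>\<rho>)"
    proof (rule \<rho>.jensens_inequality)
      show "integrable \<rho> (\<lambda>y. x * u g * exp y)" using int_exp by simp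
      show "AE y in \<rho>. x * u g * exp y \<in> {0<..}" using mult_pos_pos[OF a exp_gt_zero] by (intro AE_I2) simp
      show "convex_on {0<..} f" by (rule convex_on_subset[OF conv]) auto
      show "{0<..} = {0<..<0} \<or> {0<..} = {0::real<..} \<or> {0<..} = {..<0} \<or> {0<..} = (UNIV :: real set)" by simp
      show "integrable \<rho> (\<lambda>y. f (x * u g * exp y))"
        using payoff_exp_measurable[OF cont less_imp_le[OF a]] bd[OF xub_nonneg[OF x, of g]]
        by (intro \<rho>.integrable_const_bound[where B=B] AE_I2) auto
    qed
    also have "(\<integral>y. x * u g * exp y \<partial>\<rho>) = x * bs_growth h g" using c_pos by (simp add: exp_mean)
    finally show ?thesis .
  qed (simp add: \<rho>.prob_space)
  have "(\<integral>g. f (x * bs_growth h g) \<partial>std_normal_distribution) \<le> (\<integral>g. (\<integral>y. f (x * u g * exp y) \<partial>\<rho>) \<partial>std_normal_distribution)"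
    using P.integrable_fst'[OF f_integrable[OF x]] le by (intro integral_mono f_bs_integrable[OF x]) auto
  also have "\<dots> = (\<integral>(g, y). f (x * u g * exp y) \<partial>P)"
    using P.integral_fst'[OF f_integrable[OF x]] by simp
  finally show ?thesis .
qed

text \<open>For a Lipschitz function, dropping the factor \<open>exp y / c\<close> costs at most the
  mean of the price change it causes, and independence separates this mean into growth times
  \<open>E \<bar>exp y / c - 1\<bar>\<close>.\<close>

lemma approx_le_bs:
  assumes lip: "\<And>a b. 0 \<le> a \<Longrightarrow> 0 \<le> b \<Longrightarrow> \<bar>f a - f b\<bar> \<le> \<bar>a - b\<bar>" and x: "0 \<le> x"
  shows "(\<integral>(g, y). f (x * u g * exp y) \<partial>P) \<le> (\<integral>g. f (x * bs_growth h g) \<partial>std_normal_distribution)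
    + x * exp ((r - \<delta>) * h) * ((2 * exp (h * up_rate) - 1 - c) / c + \<bar>1 / c - 1\<bar>)"
proof -
  \<comment> \<open>An upper bound of \<open>\<bar>exp y / c - 1\<bar>\<close>, split so that
    \<open>abs_jump\<close> applies.\<close>
  define v where "v y = \<bar>exp y - 1\<bar> / c + \<bar>1 / c - 1\<bar>" for y
  have v: "integrable \<rho> v" "integral\<^sup>L \<rho> v \<le> (2 * exp (h * up_rate) - 1 - c) / c + \<bar>1 / c - 1\<bar>"
    unfolding v_def using abs_jump c_pos by (auto simp: \<rho>.prob_space divide_right_mono)
  note S = bs_growth_mean[OF less_imp_le[OF h]]
  note Sv = pair_integral_mult[OF prob_space_std prob_\<rho> S(1) v(1)]
  have "(\<integral>(g, y). f (x * u g * exp y) \<partial>P) \<le> (\<integral>z. (case z of (g, y) \<Rightarrow> f (x * bs_growth h g)) + x * (case z of (g, y) \<Rightarrow> bs_growth h g * v y) \<partial>P)"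
  proof (rule integral_mono)
    show "integrable P (\<lambda>z. (case z of (g, y) \<Rightarrow> f (x * bs_growth h g)) + x * (case z of (g, y) \<Rightarrow> bs_growth h g * v y))"
      by (intro Bochner_Integration.integrable_add integrable_mult_right f_bs_integrable_P x Sv)
    fix z :: "real \<times> real"
    obtain g y where z: "z = (g, y)" by (cases z)
    have "f (x * u g * exp y) \<le> f (x * bs_growth h g) + \<bar>x * u g * exp y - x * bs_growth h g\<bar>"
      using lip[OF xub_nonneg[OF x, of g y] mult_nonneg_nonneg[OF x less_imp_le[OF bs_growth_pos[of h g]]]]
      by linarith
    also have "x * u g * exp y - x * bs_growth h g = x * bs_growth h g * ((exp y - 1) / c + (1 / c - 1))"
      using c_pos by (simp add: field_simps)
    also have "\<bar>\<dots>\<bar> \<le> x * bs_growth h g * v y"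
      unfolding abs_mult v_def using x bs_growth_pos[of h g] c_pos abs_triangle_ineq[of "(exp y - 1) / c" "1 / c - 1"]
      by (simp add: mult_left_mono abs_mult)
    finally show "(case z of (g, y) \<Rightarrow> f (x * u g * exp y)) \<le> (case z of (g, y) \<Rightarrow> f (x * bs_growth h g)) + x * (case z of (g, y) \<Rightarrow> bs_growth h g * v y)"
      by (simp add: z mult.assoc)
  qed (rule f_integrable[OF x])
  also have "\<dots> = (\<integral>g. f (x * bs_growth h g) \<partial>std_normal_distribution) + x * (exp ((r - \<delta>) * h) * integral\<^sup>L \<rho> v)"
    using f_bs_integrable_P[OF x] Sv by (simp add: S(2))
  also have "x * (exp ((r - \<delta>) * h) * integral\<^sup>L \<rho> v) \<le> x * (exp ((r - \<delta>) * h) * ((2 * exp (h * up_rate) - 1 - c) / c + \<bar>1 / c - 1\<bar>))"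
    using v(2) x by (intro mult_left_mono) auto
  finally show ?thesis by (simp add: mult.assoc)
qed

end

end

section \<open>Passage to the limit in the bounds for one step\<close>

context put_setting
begin

lemma jump_factorI:
  assumes "0 < h" "compensated_jump_approx h \<rho> c"
  shows "jump_factor \<nu> M X \<sigma> \<gamma> r \<delta> K h (\<rho> n) (c n)"
  using assms put_setting_axioms
  by (auto simp: jump_factor_def jump_factor_axioms_def compensated_jump_approx_def)

text \<open>The last factor of the bound \<open>approx_le_bs\<close> at the limit
  \<open>exp (h * jump_drift)\<close> of the constants \<open>c n\<close>.\<close>

definition jump_error :: "real \<Rightarrow> real" where
  "jump_error h = (2 * exp (h * up_rate) - 1 - exp (h * jump_drift)) / exp (h * jump_drift) + \<bar>1 / exp (h * jump_drift) - 1\<bar>"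

context
  fixes f :: "real \<Rightarrow> real" and B h :: real
  assumes h: "0 < h" and cont: "continuous_on {0..} f" and bd: "\<And>y. 0 \<le> y \<Longrightarrow> \<bar>f y\<bar> \<le> B"
begin

lemma levy_law_lipschitz:
  assumes lip: "\<And>a b. 0 \<le> a \<Longrightarrow> 0 \<le> b \<Longrightarrow> \<bar>f a - f b\<bar> \<le> \<bar>a - b\<bar>" and x: "0 \<le> x" "0 \<le> x'"
  shows "\<bar>(\<integral>y. f (x * exp y) \<partial>levy_law h) - (\<integral>y. f (x' * exp y) \<partial>levy_law h)\<bar> \<le> \<bar>x - x'\<bar> * exp ((r - \<delta>) * h)"
proof -
  obtain \<rho> c where approx: "compensated_jump_approx h \<rho> c"
    and lim: "\<And>x. 0 \<le> x \<Longrightarrow> (\<lambda>n. \<integral>(g, y). f (x * (bs_growth h g / c n) * exp y) \<partial>(std_normal_distribution \<Otimes>\<^sub>M \<rho> n))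
        \<longlonglongrightarrow> (\<integral>y. f (x * exp y) \<partial>levy_law h)"
    using levy_law_approx[OF h] cont bd by meson
  show ?thesis
    by (rule LIMSEQ_le_const2[OF tendsto_rabs[OF tendsto_diff[OF lim[OF x(1)] lim[OF x(2)]]]])
       (use jump_factor.approx_lipschitz[OF jump_factorI[OF h approx] cont bd lip x] in auto)
qed

lemma bs_le_levy_law:
  assumes conv: "convex_on {0..} f" and x: "0 \<le> x"
  shows "(\<integral>g. f (x * bs_growth h g) \<partial>std_normal_distribution) \<le> (\<integral>y. f (x * exp y) \<partial>levy_law h)"
proof -
  obtain \<rho> c where approx: "compensated_jump_approx h \<rho> c"
    and lim: "\<And>x. 0 \<le> x \<Longrightarrow> (\<lambda>n. \<integral>(g, y). f (x * (bs_growth h g / c n) * exp y) \<partial>(std_normal_distribution \<Otimes>\<^sub>M \<rho> n))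
        \<longlonglongrightarrow> (\<integral>y. f (x * exp y) \<partial>levy_law h)"
    using levy_law_approx[OF h] cont bd by meson
  show ?thesis
    by (rule LIMSEQ_le_const[OF lim[OF x]])
       (use jump_factor.bs_le_approx[OF jump_factorI[OF h approx] cont bd conv x] in auto)
qed

lemma levy_law_le_bs:
  assumes lip: "\<And>a b. 0 \<le> a \<Longrightarrow> 0 \<le> b \<Longrightarrow> \<bar>f a - f b\<bar> \<le> \<bar>a - b\<bar>" and x: "0 \<le> x"
  shows "(\<integral>y. f (x * exp y) \<partial>levy_law h) \<le> (\<integral>g. f (x * bs_growth h g) \<partial>std_normal_distribution)
    + x * exp ((r - \<delta>) * h) * jump_error h"
proof -
  obtain \<rho> c where approx: "compensated_jump_approx h \<rho> c"
    and lim: "\<And>x. 0 \<le> x \<Longrightarrow> (\<lambda>n. \<integral>(g, y). f (x * (bs_growth h g / c n) * exp y) \<partial>(std_normal_distribution \<Otimes>\<^sub>M \<rho> n))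
        \<longlonglongrightarrow> (\<integral>y. f (x * exp y) \<partial>levy_law h)"
    using levy_law_approx[OF h] cont bd by meson
  have c: "c \<longlonglongrightarrow> exp (h * jump_drift)" using approx by (simp add: compensated_jump_approx_def)
  have "(\<lambda>n. (\<integral>g. f (x * bs_growth h g) \<partial>std_normal_distribution)
    + x * exp ((r - \<delta>) * h) * ((2 * exp (h * up_rate) - 1 - c n) / c n + \<bar>1 / c n - 1\<bar>))
     \<longlonglongrightarrow> (\<integral>g. f (x * bs_growth h g) \<partial>std_normal_distribution) + x * exp ((r - \<delta>) * h) * jump_error h"
    unfolding jump_error_def by (intro tendsto_intros c) auto
  from LIMSEQ_le[OF lim[OF x] this] show ?thesis
    using jump_factor.approx_le_bs[OF jump_factorI[OF h approx] cont bd lip x] by auto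
qed

end

end

lemma continuous_on_lipschitz_real:
  fixes f :: "real \<Rightarrow> real"
  assumes "\<And>a b. a \<in> A \<Longrightarrow> b \<in> A \<Longrightarrow> \<bar>f a - f b\<bar> \<le> \<bar>a - b\<bar>"
  shows "continuous_on A f"
  by (rule lipschitz_on_continuous_on[of 1]) (use assms in \<open>auto intro!: lipschitz_onI simp: dist_real_def\<close>)

lemma abs_max_diff_le:
  fixes a b c d e :: real
  assumes "\<bar>a - b\<bar> \<le> e" "\<bar>c - d\<bar> \<le> e"
  shows "\<bar>max a c - max b d\<bar> \<le> e"
  using assms by (auto simp: max_def abs_le_iff)

text \<open>The form in which expansions to first order in \<open>h\<close> are used: a strictly
  negative slope absorbs all terms of higher order.\<close>

lemma neg_deriv_imp_eventually_neg:
  fixes f :: "real \<Rightarrow> real"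
  assumes "(f has_real_derivative l) (at 0)" "l < 0" "f 0 = 0"
  shows "eventually (\<lambda>h. f h < 0) (at_right 0)"
proof -
  obtain d where "0 < d" "\<forall>h>0. h < d \<longrightarrow> f (0 + h) < f 0"
    using DERIV_neg_dec_right[OF assms(1,2)] by auto
  then show ?thesis using assms(3) by (auto simp: eventually_at_right[of 0 1] intro!: exI[of _ d])
qed

section \<open>Iteration over the exercise dates\<close>

context put_setting
begin

definition VL :: "real \<Rightarrow> nat \<Rightarrow> real \<Rightarrow> real" where
  "VL h = bermudan_put (levy_law h) (exp (- r * h)) K"

definition VB :: "real \<Rightarrow> nat \<Rightarrow> real \<Rightarrow> real" where
  "VB h = bermudan_put (bs h) (exp (- r * h)) K"

lemma VL_0: "VL h 0 x = max 0 (K - x)" and VB_0: "VB h 0 x = max 0 (K - x)"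
  by (simp_all add: VL_def VB_def)

lemma VL_Suc: "VL h (Suc n) x = max (max 0 (K - x)) (exp (- r * h) * (\<integral>y. VL h n (x * exp y) \<partial>levy_law h))"
  by (simp add: VL_def)

lemma VL_measurable: "VL h n \<in> borel_measurable borel"
  unfolding VL_def by (intro borel_measurable_bermudan_put prob_space_levy_law sets_levy_law)

lemma VB_measurable: "VB h n \<in> borel_measurable borel"
  unfolding VB_def by (intro borel_measurable_bermudan_put prob_space_bs_law sets_bs_law)

lemma VL_bound: "0 \<le> h \<Longrightarrow> 0 \<le> y \<Longrightarrow> \<bar>VL h n y\<bar> \<le> K"
  using bermudan_put_le[OF prob_space_levy_law sets_levy_law, of "exp (- r * h)" K y h n] r K
  by (simp add: VL_def bermudan_put_nonneg)

lemma VB_bound: "0 \<le> h \<Longrightarrow> 0 \<le> y \<Longrightarrow> \<bar>VB h n y\<bar> \<le> K"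
  using bermudan_put_le[OF prob_space_bs_law sets_bs_law, of "exp (- r * h)" K y _ _ h n] r K
  by (simp add: VB_def bermudan_put_nonneg)

lemma discount_growth: "exp (- r * h) * exp ((r - \<delta>) * h) = exp (- \<delta> * h)"
  by (simp add: exp_add[symmetric] algebra_simps)

lemma discount_growth_le_1: "0 \<le> h \<Longrightarrow> exp (- r * h) * exp ((r - \<delta>) * h) \<le> 1"
  unfolding discount_growth using \<delta> by simp

lemma VB_Suc: "VB h (Suc n) x = max (max 0 (K - x)) (exp (- r * h) * (\<integral>g. VB h n (x * bs_growth h g) \<partial>std_normal_distribution))"
  using bs_integral[OF VB_measurable[of h n], where x=x and h=h] by (simp add: VB_def)

lemma VB_integrable:
  assumes "0 \<le> h" "0 \<le> x"
  shows "integrable std_normal_distribution (\<lambda>g. VB h n (x * bs_growth h g))"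
proof -
  interpret prob_space std_normal_distribution by (rule prob_space_std)
  note [measurable] = VB_measurable
  show ?thesis
    using VB_bound[OF assms(1) mult_nonneg_nonneg[OF assms(2) less_imp_le[OF bs_growth_pos]]]
    by (intro integrable_const_bound[where B=K]) auto
qed

lemma VL_integrable_std:
  assumes "0 \<le> h" "0 \<le> x"
  shows "integrable std_normal_distribution (\<lambda>g. VL h n (x * bs_growth h g))"
proof -
  interpret prob_space std_normal_distribution by (rule prob_space_std)
  note [measurable] = VL_measurable
  show ?thesis
    using VL_bound[OF assms(1) mult_nonneg_nonneg[OF assms(2) less_imp_le[OF bs_growth_pos]]]
    by (intro integrable_const_bound[where B=K]) auto
qed

lemma VL_integrable:
  assumes "0 \<le> h" "0 \<le> x"
  shows "integrable (levy_law h) (\<lambda>y. VL h n (x * exp y))"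
proof -
  interpret prob_space "levy_law h" by (rule prob_space_levy_law)
  note [measurable] = VL_measurable
  note [measurable_cong] = sets_levy_law
  show ?thesis
    using VL_bound[OF assms(1) mult_nonneg_nonneg[OF assms(2) exp_ge_zero]]
    by (intro integrable_const_bound[where B=K]) auto
qed

text \<open>The discounted price has mean growth \<open>exp (- \<delta> * h) \<le> 1\<close>, so a
  step preserves the Lipschitz constant \<open>1\<close> of the payoff. The continuity contained in
  the induction hypothesis is what admits the value as a test function for the weak limit.\<close>

lemma VL_lipschitz:
  assumes h: "0 < h" and "0 \<le> a" "0 \<le> b"
  shows "\<bar>VL h n a - VL h n b\<bar> \<le> \<bar>a - b\<bar>"
  using assms(2,3)
proof (induction n arbitrary: a b)
  case 0
  then show ?case by (auto simp: VL_0 VB_0 max_def)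
next
  case (Suc n)
  have cont: "continuous_on {0..} (VL h n)"
    by (rule continuous_on_lipschitz_real) (use Suc.IH in auto)
  have "\<bar>exp (- r * h) * (\<integral>y. VL h n (a * exp y) \<partial>levy_law h) - exp (- r * h) * (\<integral>y. VL h n (b * exp y) \<partial>levy_law h)\<bar>
      = exp (- r * h) * \<bar>(\<integral>y. VL h n (a * exp y) \<partial>levy_law h) - (\<integral>y. VL h n (b * exp y) \<partial>levy_law h)\<bar>"
    by (simp add: right_diff_distrib[symmetric] abs_mult)
  also have "\<dots> \<le> exp (- r * h) * (\<bar>a - b\<bar> * exp ((r - \<delta>) * h))"
    using h Suc.prems
    by (intro mult_left_mono levy_law_lipschitz[OF h cont VL_bound Suc.IH]) auto
  also have "\<dots> \<le> \<bar>a - b\<bar>"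
    using mult_left_mono[OF discount_growth_le_1[of h], of "\<bar>a - b\<bar>"] h by (simp add: ac_simps)
  finally show ?case unfolding VL_Suc by (intro abs_max_diff_le) (auto simp: max_def)
qed

lemma VL_continuous: "0 < h \<Longrightarrow> continuous_on {0..} (VL h n)"
  by (rule continuous_on_lipschitz_real) (use VL_lipschitz in auto)

lemma VB_lipschitz:
  assumes h: "0 < h" and "0 \<le> a" "0 \<le> b"
  shows "\<bar>VB h n a - VB h n b\<bar> \<le> \<bar>a - b\<bar>"
  using assms(2,3)
proof (induction n arbitrary: a b)
  case 0
  then show ?case by (auto simp: VL_0 VB_0 max_def)
next
  case (Suc n)
  let ?I = "\<lambda>a. \<integral>g. VB h n (a * bs_growth h g) \<partial>std_normal_distribution"
  have h0: "0 \<le> h" using h by simp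
  note i = VB_integrable[OF h0 Suc.prems(1), of n] VB_integrable[OF h0 Suc.prems(2), of n]
  have "\<bar>?I a - ?I b\<bar> = \<bar>\<integral>g. VB h n (a * bs_growth h g) - VB h n (b * bs_growth h g) \<partial>std_normal_distribution\<bar>"
    using i by simp
  also have "\<dots> \<le> (\<integral>g. \<bar>VB h n (a * bs_growth h g) - VB h n (b * bs_growth h g)\<bar> \<partial>std_normal_distribution)"
    by (rule integral_abs_bound)
  also have "\<dots> \<le> (\<integral>g. \<bar>a - b\<bar> * bs_growth h g \<partial>std_normal_distribution)"
  proof (rule integral_mono)
    show "integrable std_normal_distribution (\<lambda>g. \<bar>a - b\<bar> * bs_growth h g)"
      using bs_growth_mean[OF h0] by simp
    fix g
    have "\<bar>VB h n (a * bs_growth h g) - VB h n (b * bs_growth h g)\<bar> \<le> \<bar>a * bs_growth h g - b * bs_growth h g\<bar>"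
      using Suc.prems bs_growth_pos[of h g] by (intro Suc.IH) auto
    also have "\<dots> = \<bar>a - b\<bar> * bs_growth h g"
      using bs_growth_pos[of h g] by (simp add: left_diff_distrib[symmetric] abs_mult)
    finally show "\<bar>VB h n (a * bs_growth h g) - VB h n (b * bs_growth h g)\<bar> \<le> \<bar>a - b\<bar> * bs_growth h g" .
  qed (use i in auto)
  also have "\<dots> = \<bar>a - b\<bar> * exp ((r - \<delta>) * h)" using bs_growth_mean[OF h0] by simp
  finally have le: "\<bar>?I a - ?I b\<bar> \<le> \<bar>a - b\<bar> * exp ((r - \<delta>) * h)" .
  have "\<bar>exp (- r * h) * ?I a - exp (- r * h) * ?I b\<bar> = exp (- r * h) * \<bar>?I a - ?I b\<bar>"
    by (simp add: right_diff_distrib[symmetric] abs_mult)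
  also have "\<dots> \<le> exp (- r * h) * (\<bar>a - b\<bar> * exp ((r - \<delta>) * h))"
    using le by (rule mult_left_mono) simp
  also have "\<dots> \<le> \<bar>a - b\<bar>"
    using mult_left_mono[OF discount_growth_le_1[of h], of "\<bar>a - b\<bar>"] h by (simp add: ac_simps)
  finally show ?case unfolding VB_Suc by (intro abs_max_diff_le) (auto simp: max_def)
qed

lemma VB_continuous: "0 < h \<Longrightarrow> continuous_on {0..} (VB h n)"
  by (rule continuous_on_lipschitz_real) (use VB_lipschitz in auto)

text \<open>The price after a step is linear in the starting price, hence expectations and maxima
  keep convexity. This is the input of Jensen's inequality in \<open>VB_le_VL\<close>.\<close>

lemma VB_convex:
  assumes h: "0 < h"
  shows "convex_on {0..} (VB h n)"
proof (induction n)
  case 0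
  show ?case
  proof (rule convex_onI)
    fix t x y :: real assume t: "0 < t" "t < 1"
    have "(1 - t) * (K - x) + t * (K - y) \<le> (1 - t) * max 0 (K - x) + t * max 0 (K - y)"
      "0 \<le> (1 - t) * max 0 (K - x) + t * max 0 (K - y)"
      using t by (auto intro!: add_mono mult_left_mono add_nonneg_nonneg)
    moreover have "(1 - t) * (K - x) + t * (K - y) = K - ((1 - t) * x + t * y)" by (simp add: algebra_simps)
    ultimately show "VB h 0 ((1 - t) *\<^sub>R x + t *\<^sub>R y) \<le> (1 - t) * VB h 0 x + t * VB h 0 y" by (auto simp: VB_0)
  qed simp
next
  case (Suc n)
  let ?I = "\<lambda>a. \<integral>g. VB h n (a * bs_growth h g) \<partial>std_normal_distribution"
  have h0: "0 \<le> h" using h by simp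
  show ?case
  proof (rule convex_onI)
    fix t x y :: real assume t: "0 < t" "t < 1" and xy: "x \<in> {0..}" "y \<in> {0..}"
    define z where "z = (1 - t) * x + t * y"
    have z: "0 \<le> z" using t xy by (auto simp: z_def)
    have i: "integrable std_normal_distribution (\<lambda>g. VB h n (x * bs_growth h g))"
      "integrable std_normal_distribution (\<lambda>g. VB h n (y * bs_growth h g))"
      using VB_integrable[OF h0] xy by auto
    have "?I z \<le> (\<integral>g. (1 - t) * VB h n (x * bs_growth h g) + t * VB h n (y * bs_growth h g) \<partial>std_normal_distribution)"
    proof (rule integral_mono[OF VB_integrable[OF h0 z]])
      fix g
      have "VB h n ((1 - t) *\<^sub>R (x * bs_growth h g) + t *\<^sub>R (y * bs_growth h g))
          \<le> (1 - t) * VB h n (x * bs_growth h g) + t * VB h n (y * bs_growth h g)"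
        using Suc.IH t xy bs_growth_pos[of h g] by (intro convex_onD) auto
      also have "(1 - t) *\<^sub>R (x * bs_growth h g) + t *\<^sub>R (y * bs_growth h g) = z * bs_growth h g"
        by (simp add: z_def algebra_simps)
      finally show "VB h n (z * bs_growth h g) \<le> (1 - t) * VB h n (x * bs_growth h g) + t * VB h n (y * bs_growth h g)" .
    qed (use i in auto)
    also have "\<dots> = (1 - t) * ?I x + t * ?I y" using i by simp
    finally have "exp (- r * h) * ?I z \<le> exp (- r * h) * ((1 - t) * ?I x + t * ?I y)" by (rule mult_left_mono) simp
    also have "\<dots> = (1 - t) * (exp (- r * h) * ?I x) + t * (exp (- r * h) * ?I y)" by (simp add: algebra_simps)
    also have "\<dots> \<le> (1 - t) * VB h (Suc n) x + t * VB h (Suc n) y"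
      unfolding VB_Suc using t by (intro add_mono mult_left_mono) auto
    finally have 1: "exp (- r * h) * ?I z \<le> (1 - t) * VB h (Suc n) x + t * VB h (Suc n) y" .
    have "(1 - t) * (K - x) + t * (K - y) \<le> (1 - t) * VB h (Suc n) x + t * VB h (Suc n) y"
      using t by (intro add_mono mult_left_mono) (auto simp: VB_Suc)
    moreover have "(1 - t) * (K - x) + t * (K - y) = K - z" by (simp add: z_def algebra_simps)
    moreover have "0 \<le> (1 - t) * VB h (Suc n) x + t * VB h (Suc n) y"
      using t by (intro add_nonneg_nonneg mult_nonneg_nonneg) (auto simp: VB_Suc)
    ultimately have "VB h (Suc n) z \<le> (1 - t) * VB h (Suc n) x + t * VB h (Suc n) y"
      using 1 VB_Suc[of h n z] by simp
    then show "VB h (Suc n) ((1 - t) *\<^sub>R x + t *\<^sub>R y) \<le> (1 - t) * VB h (Suc n) x + t * VB h (Suc n) y"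
      by (simp add: z_def)
  qed simp
qed

text \<open>The laws are exchanged under the Black-Scholes value, whose convexity favours the Levy
  step; the values are exchanged afterwards, by induction.\<close>

lemma VB_le_VL:
  assumes h: "0 < h" and "0 \<le> x"
  shows "VB h n x \<le> VL h n x"
  using assms(2)
proof (induction n arbitrary: x)
  case 0
  then show ?case by (simp add: VL_0 VB_0)
next
  case (Suc n)
  have h0: "0 \<le> h" using h by simp
  interpret L: prob_space "levy_law h" by (rule prob_space_levy_law)
  note [measurable] = VB_measurable
  note [measurable_cong] = sets_levy_law
  have "(\<integral>g. VB h n (x * bs_growth h g) \<partial>std_normal_distribution) \<le> (\<integral>y. VB h n (x * exp y) \<partial>levy_law h)"
    by (rule bs_le_levy_law[OF h VB_continuous[OF h] VB_bound[OF h0] VB_convex[OF h] Suc.prems])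
  also have "\<dots> \<le> (\<integral>y. VL h n (x * exp y) \<partial>levy_law h)"
  proof (rule integral_mono[OF _ VL_integrable[OF h0 Suc.prems]])
    show "integrable (levy_law h) (\<lambda>y. VB h n (x * exp y))"
      using VB_bound[OF h0 mult_nonneg_nonneg[OF Suc.prems exp_ge_zero]]
      by (intro L.integrable_const_bound[where B=K]) auto
  qed (use Suc in auto)
  finally have "exp (- r * h) * (\<integral>g. VB h n (x * bs_growth h g) \<partial>std_normal_distribution)
     \<le> exp (- r * h) * (\<integral>y. VL h n (x * exp y) \<partial>levy_law h)" by (rule mult_left_mono) simp
  then show ?case unfolding VB_Suc VL_Suc by (intro max.mono order_refl)
qed

text \<open>The error of one step is proportional to the price, and the discounted price does not
  grow in mean, so the errors of \<open>n\<close> steps merely add. With \<open>E\<close> of order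
  \<open>h\<close> the total is of order \<open>n h x\<close>.\<close>

lemma VL_le_VB:
  assumes h: "0 < h" and E: "0 \<le> E" "jump_error h \<le> E" and "0 \<le> x"
  shows "VL h n x \<le> VB h n x + real n * E * x"
  using assms(4)
proof (induction n arbitrary: x)
  case 0
  then show ?case by (simp add: VL_0 VB_0)
next
  case (Suc n)
  have h0: "0 \<le> h" using h by simp
  let ?d = "exp (- r * h)" and ?e = "exp ((r - \<delta>) * h)"
  let ?IB = "\<integral>g. VB h n (x * bs_growth h g) \<partial>std_normal_distribution"
  have "(\<integral>y. VL h n (x * exp y) \<partial>levy_law h) \<le> (\<integral>g. VL h n (x * bs_growth h g) \<partial>std_normal_distribution) + x * ?e * jump_error h"
    by (rule levy_law_le_bs[OF h VL_continuous[OF h] VL_bound[OF h0] VL_lipschitz[OF h] Suc.prems])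
  also have "(\<integral>g. VL h n (x * bs_growth h g) \<partial>std_normal_distribution)
     \<le> (\<integral>g. VB h n (x * bs_growth h g) + real n * E * x * bs_growth h g \<partial>std_normal_distribution)"
  proof (rule integral_mono[OF VL_integrable_std[OF h0 Suc.prems]])
    show "integrable std_normal_distribution (\<lambda>g. VB h n (x * bs_growth h g) + real n * E * x * bs_growth h g)"
      using VB_integrable[OF h0 Suc.prems] bs_growth_mean[OF h0] by simp
    fix g
    show "VL h n (x * bs_growth h g) \<le> VB h n (x * bs_growth h g) + real n * E * x * bs_growth h g"
      using Suc.IH[of "x * bs_growth h g"] Suc.prems bs_growth_pos[of h g] by (simp add: mult.assoc)
  qed
  also have "\<dots> = ?IB + real n * E * x * ?e"
    using VB_integrable[OF h0 Suc.prems, of n] bs_growth_mean[OF h0] by simp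
  also have "x * ?e * jump_error h \<le> x * ?e * E" using E Suc.prems by (intro mult_left_mono) auto
  finally have "(\<integral>y. VL h n (x * exp y) \<partial>levy_law h) \<le> ?IB + real (Suc n) * E * x * ?e"
    by (simp add: algebra_simps)
  then have "?d * (\<integral>y. VL h n (x * exp y) \<partial>levy_law h) \<le> ?d * (?IB + real (Suc n) * E * x * ?e)"
    by (rule mult_left_mono) simp
  also have "\<dots> = ?d * ?IB + real (Suc n) * E * x * (?d * ?e)" by (simp only: distrib_left mult.assoc mult.left_commute)
  also have "\<dots> \<le> ?d * ?IB + real (Suc n) * E * x * 1"
    using E Suc.prems discount_growth_le_1[OF h0] by (intro add_left_mono mult_left_mono) auto
  finally have 1: "?d * (\<integral>y. VL h n (x * exp y) \<partial>levy_law h) \<le> ?d * ?IB + real (Suc n) * E * x" by simp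
  have "0 \<le> real (Suc n) * E * x" using E Suc.prems by simp
  then show ?case using 1 unfolding VB_Suc VL_Suc by (simp add: max_def)
qed

lemma VL_antimono:
  assumes h: "0 < h" and "0 \<le> a" "a \<le> b"
  shows "VL h n b \<le> VL h n a"
  using assms(2,3)
proof (induction n arbitrary: a b)
  case 0
  then show ?case by (auto simp: VL_0 VB_0 max_def)
next
  case (Suc n)
  have h0: "0 \<le> h" using h by simp
  have "(\<integral>y. VL h n (b * exp y) \<partial>levy_law h) \<le> (\<integral>y. VL h n (a * exp y) \<partial>levy_law h)"
    using Suc.prems by (intro integral_mono VL_integrable[OF h0] Suc.IH) auto
  then have "exp (- r * h) * (\<integral>y. VL h n (b * exp y) \<partial>levy_law h) \<le> exp (- r * h) * (\<integral>y. VL h n (a * exp y) \<partial>levy_law h)"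
    by (rule mult_left_mono) simp
  then show ?case using Suc.prems unfolding VL_Suc by (intro max.mono) auto
qed

text \<open>A majorant of \<open>jump_error\<close> has slope \<open>C - 1\<close> at
  \<open>0\<close>; the extra \<open>1\<close> in \<open>C\<close> gives the strict
  inequality.\<close>

lemma jump_error_le:
  defines "C \<equiv> 2 * up_rate - jump_drift + \<bar>jump_drift\<bar> + 1"
  shows "0 < C" "eventually (\<lambda>h. jump_error h \<le> C * h) (at_right 0)"
proof -
  show "0 < C" unfolding C_def using up_rate_nonneg abs_ge_self[of jump_drift] by linarith
  \<comment> \<open>The term \<open>exp (h * \<bar>jump_drift\<bar>) - 1\<close> majorises, for
    \<open>h > 0\<close>, the absolute value in \<open>jump_error\<close>, which has a corner at
    \<open>h = 0\<close> when \<open>jump_drift \<noteq> 0\<close>.\<close>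
  define f where "f h = (2 * exp (h * up_rate) - 1) * exp (- h * jump_drift) - 1 + (exp (h * \<bar>jump_drift\<bar>) - 1) - C * h" for h
  have "eventually (\<lambda>h. f h < 0) (at_right 0)"
  proof (rule neg_deriv_imp_eventually_neg)
    show "(f has_real_derivative (2 * up_rate - jump_drift + \<bar>jump_drift\<bar> - C)) (at 0)"
      unfolding f_def by (auto intro!: derivative_eq_intros)
  qed (auto simp: C_def f_def)
  then show "eventually (\<lambda>h. jump_error h \<le> C * h) (at_right 0)"
    using eventually_at_right_less[of 0]
  proof eventually_elim
    case (elim h)
    let ?k = "h * jump_drift"
    have k: "\<bar>?k\<bar> = h * \<bar>jump_drift\<bar>" using elim by (simp add: abs_mult)
    have "\<bar>1 / exp ?k - 1\<bar> \<le> exp \<bar>?k\<bar> - 1"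
    proof -
      have "1 / exp ?k = exp (- ?k)" by (simp add: exp_minus inverse_eq_divide)
      moreover have "exp (- ?k) \<le> exp \<bar>?k\<bar>" by simp
      moreover have "2 \<le> exp (- ?k) + exp \<bar>?k\<bar>"
        using exp_ge_add_one_self[of "- ?k"] exp_ge_add_one_self[of "\<bar>?k\<bar>"] by linarith
      ultimately show ?thesis by linarith
    qed
    moreover have "(2 * exp (h * up_rate) - 1 - exp ?k) / exp ?k = (2 * exp (h * up_rate) - 1) * exp (- h * jump_drift) - 1"
    proof -
      have "exp (- h * jump_drift) = 1 / exp ?k" by (simp add: exp_minus inverse_eq_divide)
      then show ?thesis by (simp add: diff_divide_distrib)
    qed
    ultimately show ?case using elim(1) unfolding jump_error_def f_def k[symmetric] by linarith
  qed
qed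

end

section \<open>The barrier\<close>

definition barrier :: "real \<Rightarrow> real \<Rightarrow> real \<Rightarrow> real \<Rightarrow> real \<Rightarrow> real" where
  "barrier K \<beta> z x v = K - min v x + \<beta> * (max 0 (min v x - z))\<^sup>2"

text \<open>The fourth power makes the contribution of the continuous part to the overshoot over \<open>x\<close>,
  when starting below \<open>x0 < x\<close>, of order \<open>h\<^sup>2\<close>.\<close>

lemma barrier_split_le:
  fixes K \<beta> z x x0 w u b :: real
  assumes \<beta>: "0 \<le> \<beta>" and z: "0 \<le> z" and x0: "0 < x0" "x0 < x" "x \<le> K"
    and w: "0 \<le> w" "w \<le> x0" and u: "0 \<le> u" and b: "0 \<le> b"
  shows "barrier K \<beta> z x (w * u * b) \<le> K - w * (u * b) + \<beta> * (max 0 (w - z))\<^sup>2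
    + 2 * \<beta> * max 0 (w - z) * w * (u - 1) + \<beta> * w\<^sup>2 * (u - 1)\<^sup>2
    + 2 * \<beta> * K * w * (u * \<bar>b - 1\<bar>) + x0 / (x / x0 - 1) ^ 3 * ((u - 1) ^ 4 * b) + K * (max 1 b - 1)"
proof -
  define a where "a = w * u"
  define q where "q v = (max 0 (min v x - z))\<^sup>2" for v
  have a0: "0 \<le> a" using w u by (simp add: a_def)
  have K: "0 < K" using x0 by linarith
  \<comment> \<open>Freezing the linear part at \<open>x\<close> is paid for by the overshoot
    \<open>max 0 (v - x)\<close>.\<close>
  have barrier: "barrier K \<beta> z x v = K - v + \<beta> * q v + max 0 (v - x)" for v
    by (auto simp: barrier_def q_def min_def max_def)
  have q1: "q (a * b) \<le> q a + 2 * K * (a * \<bar>b - 1\<bar>)"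
  proof -
    define p p' where "p = max 0 (min (a * b) x - z)" and "p' = max 0 (min a x - z)"
    have p: "0 \<le> p" "p \<le> K" "0 \<le> p'" "p' \<le> K" using z x0 by (auto simp: p_def p'_def)
    have "\<bar>p - p'\<bar> \<le> \<bar>a * b - a\<bar>" by (auto simp: p_def p'_def max_def min_def)
    also have "a * b - a = a * (b - 1)" by (simp add: right_diff_distrib)
    also have "\<bar>a * (b - 1)\<bar> = a * \<bar>b - 1\<bar>" by (simp only: abs_mult abs_of_nonneg[OF a0])
    finally have d: "\<bar>p - p'\<bar> \<le> a * \<bar>b - 1\<bar>" .
    have "p\<^sup>2 - p'\<^sup>2 = (p + p') * (p - p')" by (simp add: power2_eq_square algebra_simps)
    also have "\<dots> \<le> (p + p') * \<bar>p - p'\<bar>" using p by (intro mult_left_mono) auto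
    also have "\<dots> \<le> (2 * K) * (a * \<bar>b - 1\<bar>)" using p d by (intro mult_mono) auto
    finally show ?thesis by (simp add: q_def p_def p'_def)
  qed
  have q2: "q a \<le> (max 0 (w - z))\<^sup>2 + 2 * max 0 (w - z) * w * (u - 1) + w\<^sup>2 * (u - 1)\<^sup>2"
  proof -
    have "q a \<le> (max 0 (a - z))\<^sup>2" unfolding q_def by (intro power_mono) auto
    also have "\<dots> \<le> (max 0 (w - z))\<^sup>2 + 2 * max 0 (w - z) * (a - w) + (a - w)\<^sup>2"
    proof (cases "z \<le> w")
      case True
      then have "(max 0 (w - z))\<^sup>2 + 2 * max 0 (w - z) * (a - w) + (a - w)\<^sup>2 = (a - z)\<^sup>2"
        by (simp add: max_def power2_eq_square algebra_simps)
      then show ?thesis by (auto simp: max_def)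
    next
      case False
      have "(max 0 (a - z))\<^sup>2 \<le> (a - w)\<^sup>2"
        using False by (auto simp: max_def intro!: power_mono)
      then show ?thesis using False by simp
    qed
    also have "a - w = w * (u - 1)" by (simp add: a_def algebra_simps)
    finally show ?thesis by (simp add: power_mult_distrib mult.assoc)
  qed
  define d where "d = x / x0 - 1"
  have d: "0 < d" using x0 by (simp add: d_def)
  \<comment> \<open>The overshoot splits into that of the continuous factor and the gain from a jump
    starting at \<open>x\<close> at most. The mean of the second part is what produces
    \<open>up_rate\<close>.\<close>
  have e1: "max 0 (a * b - x) \<le> b * max 0 (a - x) + K * (max 1 b - 1)"
  proof -
    have "a * b - x = b * (a - x) + x * (b - 1)" by (simp add: algebra_simps)
    also have "\<dots> \<le> b * max 0 (a - x) + K * (max 1 b - 1)"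
    proof (rule add_mono)
      show "b * (a - x) \<le> b * max 0 (a - x)" using b by (intro mult_left_mono) auto
      have "x * (b - 1) \<le> x * (max 1 b - 1)" using x0 by (intro mult_left_mono) auto
      also have "\<dots> \<le> K * (max 1 b - 1)" using x0 by (intro mult_right_mono) auto
      finally show "x * (b - 1) \<le> K * (max 1 b - 1)" .
    qed
    finally show ?thesis using b K by (auto intro!: add_nonneg_nonneg mult_nonneg_nonneg)
  qed
  \<comment> \<open>Starting below \<open>x0\<close>, the level \<open>x\<close> is exceeded only if
    \<open>u - 1 \<ge> d\<close>, and then \<open>(u - 1) ^ 3 / d ^ 3\<close> is at least
    \<open>1\<close> and can be inserted.\<close>
  have e2: "max 0 (a - x) \<le> x0 / d ^ 3 * (u - 1) ^ 4"
  proof (cases "a \<le> x")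
    case True
    then show ?thesis using x0 d by simp
  next
    case False
    have "a \<le> x0 * u" unfolding a_def using w u by (intro mult_right_mono) auto
    then have "x < x0 * u" using False by simp
    then have ud: "d \<le> u - 1" using x0 by (simp add: d_def field_simps)
    have "a - x \<le> x0 * (u - 1)" using \<open>a \<le> x0 * u\<close> x0 by (simp add: algebra_simps)
    also have "\<dots> \<le> x0 * ((u - 1) * ((u - 1) ^ 3 / d ^ 3))"
    proof (intro mult_left_mono)
      have "1 \<le> (u - 1) ^ 3 / d ^ 3" using power_mono[OF ud, of 3] d by (simp add: le_divide_eq)
      then show "u - 1 \<le> (u - 1) * ((u - 1) ^ 3 / d ^ 3)"
        using ud d mult_left_mono[of 1 "(u - 1) ^ 3 / d ^ 3" "u - 1"] by simp
    qed (use x0 in simp)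
    also have "\<dots> = x0 / d ^ 3 * (u - 1) ^ 4" by (simp add: eval_nat_numeral field_simps)
    finally show ?thesis using x0 d by simp
  qed
  have "barrier K \<beta> z x (w * u * b) = K - a * b + \<beta> * q (a * b) + max 0 (a * b - x)"
    by (simp add: barrier a_def)
  also have "\<dots> \<le> K - a * b + \<beta> * (((max 0 (w - z))\<^sup>2 + 2 * max 0 (w - z) * w * (u - 1) + w\<^sup>2 * (u - 1)\<^sup>2) + 2 * K * (a * \<bar>b - 1\<bar>))
     + (b * (x0 / d ^ 3 * (u - 1) ^ 4) + K * (max 1 b - 1))"
    using q1 q2 e1 mult_left_mono[OF e2 b] \<beta> by (intro add_mono mult_left_mono order_refl) auto
  also have "\<dots> = K - w * (u * b) + \<beta> * (max 0 (w - z))\<^sup>2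
    + 2 * \<beta> * max 0 (w - z) * w * (u - 1) + \<beta> * w\<^sup>2 * (u - 1)\<^sup>2
    + 2 * \<beta> * K * w * (u * \<bar>b - 1\<bar>) + x0 / d ^ 3 * ((u - 1) ^ 4 * b) + K * (max 1 b - 1)"
    by (simp add: a_def algebra_simps)
  finally show ?thesis by (simp add: d_def)
qed

lemma barrier_continuous: "continuous_on A (barrier K \<beta> z x)"
  unfolding barrier_def by (intro continuous_intros)

lemma barrier_bound:
  assumes "0 \<le> \<beta>" "0 \<le> z" "0 \<le> x" "x \<le> K" "0 \<le> v"
  shows "\<bar>barrier K \<beta> z x v\<bar> \<le> K + \<beta> * K\<^sup>2"
proof -
  have "(max 0 (min v x - z))\<^sup>2 \<le> K\<^sup>2" using assms by (intro power_mono) auto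
  then have "\<beta> * (max 0 (min v x - z))\<^sup>2 \<le> \<beta> * K\<^sup>2" using assms by (intro mult_left_mono) auto
  moreover have "0 \<le> \<beta> * (max 0 (min v x - z))\<^sup>2" using assms by simp
  ultimately show ?thesis using assms by (auto simp: barrier_def)
qed

lemma bochner_pair_mult:
  fixes u :: "'a \<Rightarrow> real" and v :: "'b \<Rightarrow> real"
  assumes "prob_space M" "prob_space N" "has_bochner_integral M u a" "has_bochner_integral N v b"
  shows "has_bochner_integral (M \<Otimes>\<^sub>M N) (\<lambda>z. u (fst z) * v (snd z)) (a * b)"
  using pair_integral_mult[OF assms(1,2), of u v] assms(3,4)
  by (simp add: has_bochner_integral_iff case_prod_unfold)

section \<open>The expectation of the barrier over one step\<close>

context put_setting
begin

text \<open>The \<open>j\<close>-th moment of the lognormal variable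
  \<open>bs_growth h\<close>.\<close>

definition growth_moment :: "real \<Rightarrow> nat \<Rightarrow> real" where
  "growth_moment h j = exp (h * (real j * (r - \<delta> - \<sigma>\<^sup>2 / 2) + (real j)\<^sup>2 * \<sigma>\<^sup>2 / 2))"

text \<open>The expectation of the bound in \<open>barrier_split_le\<close> when \<open>b\<close> has mean \<open>c\<close> and \<open>u\<close> is the
  one-step Black-Scholes growth divided by \<open>c\<close>.\<close>

definition barrier_bound_expr :: "real \<Rightarrow> real \<Rightarrow> real \<Rightarrow> real \<Rightarrow> real \<Rightarrow> real \<Rightarrow> real" where
  "barrier_bound_expr \<beta> m D w h c = K - w * exp ((r - \<delta>) * h) + \<beta> * m\<^sup>2
    + 2 * \<beta> * m * w * (growth_moment h 1 / c - 1) + \<beta> * w\<^sup>2 * (growth_moment h 2 / c ^ 2 - 2 * (growth_moment h 1 / c) + 1)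
    + 2 * \<beta> * K * w * (growth_moment h 1 / c * (2 * exp (h * up_rate) - 1 - c))
    + D * ((growth_moment h 4 / c ^ 4 - 4 * (growth_moment h 3 / c ^ 3) + 6 * (growth_moment h 2 / c ^ 2) - 4 * (growth_moment h 1 / c) + 1) * c)
    + K * (exp (h * up_rate) - 1)"

end

context jump_factor
begin

lemma u_moment: "has_bochner_integral std_normal_distribution (\<lambda>g. u g ^ j) (growth_moment h j / c ^ j)"
  using u_power[of j] by (simp add: has_bochner_integral_iff growth_moment_def)

lemma u_const: "has_bochner_integral std_normal_distribution (\<lambda>g. k) (k :: real)"
  using std.prob_space by (simp add: has_bochner_integral_iff)

text \<open>Each term of the pointwise bound is a function of \<open>g\<close> times a function of
  \<open>y\<close>, so by independence its expectation is a product of explicit moments and of the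
  two jump quantities already estimated.\<close>

lemma approx_barrier_le:
  assumes \<beta>: "0 \<le> \<beta>" and z: "0 \<le> z" and x0: "0 < x0" "x0 < x" "x \<le> K" and w: "0 \<le> w" "w \<le> x0"
  shows "(\<integral>(g, y). barrier K \<beta> z x (w * u g * exp y) \<partial>P)
    \<le> barrier_bound_expr \<beta> (max 0 (w - z)) (x0 / (x / x0 - 1) ^ 3) w h c"
proof -
  define m where "m = max 0 (w - z)"
  define D where "D = x0 / (x / x0 - 1) ^ 3"
  define e where "e j = growth_moment h j / c ^ j" for j
  define A where "A = (\<integral>y. \<bar>exp y - 1\<bar> \<partial>\<rho>)"
  define B where "B = (\<integral>y. max 1 (exp y) \<partial>\<rho>)"
  have U: "has_bochner_integral std_normal_distribution (\<lambda>g. u g ^ j) (e j)" for j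
    unfolding e_def by (rule u_moment)
  have U1: "has_bochner_integral std_normal_distribution (\<lambda>g. u g) (e 1)" using U[of 1] by simp
  have one\<rho>: "has_bochner_integral \<rho> (\<lambda>y. k) (k :: real)" for k by (simp add: has_bochner_integral_iff \<rho>.prob_space)
  have E\<rho>: "has_bochner_integral \<rho> exp c" using int_exp exp_mean by (simp add: has_bochner_integral_iff)
  have A\<rho>: "has_bochner_integral \<rho> (\<lambda>y. \<bar>exp y - 1\<bar>) A" using abs_jump by (simp add: has_bochner_integral_iff A_def)
  have B\<rho>: "has_bochner_integral \<rho> (\<lambda>y. max 1 (exp y) - 1) (B - 1)"
    using int_max by (intro has_bochner_integral_diff one\<rho>) (simp add: has_bochner_integral_iff B_def)
  note pm = bochner_pair_mult[OF prob_space_std prob_\<rho>]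
  have c1: "has_bochner_integral P (\<lambda>z. k) (k :: real)" for k
    by (simp add: has_bochner_integral_iff P.prob_space)
  have t1: "has_bochner_integral P (\<lambda>z. u (fst z) * exp (snd z)) (e 1 * c)"
    by (rule pm[OF U1 E\<rho>])
  have s1: "has_bochner_integral std_normal_distribution (\<lambda>g. u g - 1) (e 1 - 1)"
    by (intro has_bochner_integral_diff U1 u_const)
  have s2: "has_bochner_integral std_normal_distribution (\<lambda>g. (u g - 1)\<^sup>2) (e 2 - 2 * e 1 + 1)"
  proof -
    have eq: "(a - 1) ^ 2 = a ^ 2 - 2 * a + 1" for a :: real by (simp add: power2_eq_square algebra_simps)
    show ?thesis unfolding eq by (intro has_bochner_integral_add has_bochner_integral_diff has_bochner_integral_mult_right U U1 u_const)
  qed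
  have s4: "has_bochner_integral std_normal_distribution (\<lambda>g. (u g - 1) ^ 4) (e 4 - 4 * e 3 + 6 * e 2 - 4 * e 1 + 1)"
  proof -
    have eq: "(a - 1) ^ 4 = a ^ 4 - 4 * a ^ 3 + 6 * a ^ 2 - 4 * a + 1" for a :: real
      by (simp add: eval_nat_numeral algebra_simps)
    show ?thesis unfolding eq by (intro has_bochner_integral_add has_bochner_integral_diff has_bochner_integral_mult_right U U1 u_const)
  qed
  have t2: "has_bochner_integral P (\<lambda>z. u (fst z) - 1) (e 1 - 1)" using pm[OF s1 one\<rho>[of 1]] by simp
  have t3: "has_bochner_integral P (\<lambda>z. (u (fst z) - 1)\<^sup>2) (e 2 - 2 * e 1 + 1)" using pm[OF s2 one\<rho>[of 1]] by simp
  have t4: "has_bochner_integral P (\<lambda>z. u (fst z) * \<bar>exp (snd z) - 1\<bar>) (e 1 * A)" by (rule pm[OF U1 A\<rho>])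
  have t5: "has_bochner_integral P (\<lambda>z. (u (fst z) - 1) ^ 4 * exp (snd z)) ((e 4 - 4 * e 3 + 6 * e 2 - 4 * e 1 + 1) * c)"
    by (rule pm[OF s4 E\<rho>])
  have t6: "has_bochner_integral P (\<lambda>z. max 1 (exp (snd z)) - 1) (B - 1)" using pm[OF u_const[of 1] B\<rho>] by simp
  let ?R = "\<lambda>z. K - w * (u (fst z) * exp (snd z)) + \<beta> * m\<^sup>2
    + 2 * \<beta> * m * w * (u (fst z) - 1) + \<beta> * w\<^sup>2 * (u (fst z) - 1)\<^sup>2
    + 2 * \<beta> * K * w * (u (fst z) * \<bar>exp (snd z) - 1\<bar>) + D * ((u (fst z) - 1) ^ 4 * exp (snd z)) + K * (max 1 (exp (snd z)) - 1)"
  have R: "has_bochner_integral P ?R (K - w * (e 1 * c) + \<beta> * m\<^sup>2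
    + 2 * \<beta> * m * w * (e 1 - 1) + \<beta> * w\<^sup>2 * (e 2 - 2 * e 1 + 1)
    + 2 * \<beta> * K * w * (e 1 * A) + D * ((e 4 - 4 * e 3 + 6 * e 2 - 4 * e 1 + 1) * c) + K * (B - 1))"
    by (intro has_bochner_integral_add has_bochner_integral_diff has_bochner_integral_mult_right c1 t1 t2 t3 t4 t5 t6)
  have fi: "integrable P (\<lambda>(g, y). barrier K \<beta> z x (w * u g * exp y))"
    using \<beta> z x0 w by (intro f_integrable[where B="K + \<beta> * K\<^sup>2"] barrier_continuous barrier_bound) auto
  have "(\<integral>(g, y). barrier K \<beta> z x (w * u g * exp y) \<partial>P) \<le> integral\<^sup>L P ?R"
  proof (rule integral_mono[OF fi])
    show "integrable P ?R" using R by (rule has_bochner_integral_iff[THEN iffD1, THEN conjunct1])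
    fix v :: "real \<times> real"
    show "(case v of (g, y) \<Rightarrow> barrier K \<beta> z x (w * u g * exp y)) \<le> ?R v"
      using barrier_split_le[OF \<beta> z x0 w less_imp_le[OF u_pos[of "fst v"]] exp_ge_zero[of "snd v"]]
      unfolding m_def D_def case_prod_unfold .
  qed
  also have "integral\<^sup>L P ?R = K - w * (e 1 * c) + \<beta> * m\<^sup>2
    + 2 * \<beta> * m * w * (e 1 - 1) + \<beta> * w\<^sup>2 * (e 2 - 2 * e 1 + 1)
    + 2 * \<beta> * K * w * (e 1 * A) + D * ((e 4 - 4 * e 3 + 6 * e 2 - 4 * e 1 + 1) * c) + K * (B - 1)"
    using R by (rule has_bochner_integral_integral_eq)
  also have "\<dots> \<le> K - w * (e 1 * c) + \<beta> * m\<^sup>2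
    + 2 * \<beta> * m * w * (e 1 - 1) + \<beta> * w\<^sup>2 * (e 2 - 2 * e 1 + 1)
    + 2 * \<beta> * K * w * (e 1 * (2 * exp (h * up_rate) - 1 - c)) + D * ((e 4 - 4 * e 3 + 6 * e 2 - 4 * e 1 + 1) * c) + K * (exp (h * up_rate) - 1)"
    using abs_jump(2) max_mean \<beta> K w c_pos unfolding A_def B_def e_def
    by (intro add_mono mult_left_mono order_refl) (auto simp: growth_moment_def)
  also have "e 1 * c = exp ((r - \<delta>) * h)"
    using c_pos by (simp add: e_def growth_moment_def algebra_simps)
  finally show ?thesis unfolding barrier_bound_expr_def m_def D_def e_def by simp
qed

end

section \<open>The barrier as a supersolution\<close>

context put_setting
begin

lemma levy_law_barrier_le:
  assumes h: "0 < h" and \<beta>: "0 \<le> \<beta>" and z: "0 \<le> z" and x0: "0 < x0" "x0 < x" "x \<le> K" and w: "0 \<le> w" "w \<le> x0"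
  shows "(\<integral>y. barrier K \<beta> z x (w * exp y) \<partial>levy_law h)
    \<le> barrier_bound_expr \<beta> (max 0 (w - z)) (x0 / (x / x0 - 1) ^ 3) w h (exp (h * jump_drift))"
proof -
  have bd: "\<forall>y\<ge>0. \<bar>barrier K \<beta> z x y\<bar> \<le> K + \<beta> * K\<^sup>2"
    using barrier_bound[OF \<beta> z _ x0(3)] x0 by auto
  obtain \<rho> c where approx: "compensated_jump_approx h \<rho> c"
    and lim: "(\<lambda>n. \<integral>(g, y). barrier K \<beta> z x (w * (bs_growth h g / c n) * exp y) \<partial>(std_normal_distribution \<Otimes>\<^sub>M \<rho> n))
        \<longlonglongrightarrow> (\<integral>y. barrier K \<beta> z x (w * exp y) \<partial>levy_law h)"
    using levy_law_approx[OF h] barrier_continuous[of "{0..}" K \<beta> z x] bd w(1) by blast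
  have c: "c \<longlonglongrightarrow> exp (h * jump_drift)" using approx by (simp add: compensated_jump_approx_def)
  have "(\<lambda>n. barrier_bound_expr \<beta> (max 0 (w - z)) (x0 / (x / x0 - 1) ^ 3) w h (c n))
     \<longlonglongrightarrow> barrier_bound_expr \<beta> (max 0 (w - z)) (x0 / (x / x0 - 1) ^ 3) w h (exp (h * jump_drift))"
    unfolding barrier_bound_expr_def by (intro tendsto_intros c) auto
  from LIMSEQ_le[OF lim this] show ?thesis
    using jump_factor.approx_barrier_le[OF jump_factorI[OF h approx] \<beta> z x0 w] by auto
qed

text \<open>The exponential rate in \<open>h\<close> of the \<open>j\<close>-th moment of the
  Gaussian factor after compensation. It is a polynomial of degree at most two in \<open>j\<close>
  that vanishes at \<open>0\<close>.\<close>

definition net_moment :: "nat \<Rightarrow> real" where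
  "net_moment j = real j * (r - \<delta> - \<sigma>\<^sup>2 / 2 - jump_drift) + (real j)\<^sup>2 * \<sigma>\<^sup>2 / 2"

lemma growth_moment_div: "growth_moment h j / exp (h * jump_drift) ^ j = exp (h * net_moment j)"
  unfolding growth_moment_def net_moment_def
  by (simp add: exp_of_nat_mult[symmetric] exp_diff[symmetric] algebra_simps)

lemma jump_drift_le_up_rate: "jump_drift \<le> up_rate"
  unfolding jump_drift_def up_rate_def
  using integrable_max_exp unfolding max_exp_minus_one
  by (intro integral_mono integrable_exp_minus_one) auto

text \<open>The coefficient of \<open>\<beta> * K\<^sup>2 * h\<close> in the expansion of the bound
  for the quadratic term. Its summands stem from the drift and the variance of the Gaussian factor
  and from the jumps.\<close>

definition barrier_slope :: real where
  "barrier_slope = 2 * \<bar>net_moment 1\<bar> + (net_moment 2 - 2 * net_moment 1) + 2 * (2 * up_rate - jump_drift)"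

text \<open>For all \<open>w \<le> x0\<close> at once, the discounted expectation exceeds the
  barrier by at most \<open>\<Psi> h\<close>. The slope of \<open>\<Psi>\<close> at \<open>0\<close>
  is \<open>K\<close> times \<open>\<beta> * K * barrier_slope + up_rate - (r - \<delta>)\<close>,
  which the condition on \<open>\<beta>\<close> makes negative.\<close>

lemma eventually_barrier_supersolution:
  assumes \<beta>: "0 \<le> \<beta>" "\<beta> * K * barrier_slope < r - \<delta> - up_rate"
    and z: "0 \<le> z" and x0: "0 < x0" "x0 < x" "x \<le> K"
  shows "eventually (\<lambda>h. \<forall>w. 0 \<le> w \<longrightarrow> w \<le> x0 \<longrightarrow>
    exp (- r * h) * (\<integral>y. barrier K \<beta> z x (w * exp y) \<partial>levy_law h) \<le> barrier K \<beta> z x w) (at_right 0)"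
proof -
  define D where "D = x0 / (x / x0 - 1) ^ 3"
  define a where "a = net_moment"
  \<comment> \<open>Bounds the terms of \<open>barrier_bound_expr\<close> other than
    \<open>K - w * exp ((r - \<delta>) * h) + \<beta> * m\<^sup>2\<close>, with \<open>w\<close> and
    \<open>m\<close> replaced by \<open>K\<close> so that it depends on \<open>h\<close>
    alone.\<close>
  define R where "R h = \<beta> * (2 * K\<^sup>2 * (exp (h * \<bar>a 1\<bar>) - 1) + K\<^sup>2 * (exp (h * a 2) - 2 * exp (h * a 1) + 1)
      + 2 * K\<^sup>2 * (exp (h * a 1) * (2 * exp (h * up_rate) - 1 - exp (h * jump_drift))))
    + D * ((exp (h * a 4) - 4 * exp (h * a 3) + 6 * exp (h * a 2) - 4 * exp (h * a 1) + 1) * exp (h * jump_drift))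
    + K * (exp (h * up_rate) - 1)" for h
  \<comment> \<open>Waiting at price \<open>w\<close> costs \<open>r * K - \<delta> * w\<close> per
    unit of time. The difference of \<open>K * exp (- r * h)\<close> and
    \<open>K * exp (- \<delta> * h)\<close> retains the part \<open>(r - \<delta>) * K\<close> of
    it, common to all \<open>w \<le> K\<close>.\<close>
  define \<Psi> where "\<Psi> h = exp (- r * h) * (K + R h) - K * exp (- \<delta> * h)" for h
  \<comment> \<open>A fourth difference of a polynomial of degree two. The diffusive overshoot over
    \<open>x\<close> thus has no term of first order in \<open>h\<close>, however large
    \<open>D\<close> is.\<close>
  have a4: "a 4 - 4 * a 3 + 6 * a 2 - 4 * a 1 = 0"
    by (simp add: a_def net_moment_def algebra_simps)
  have "eventually (\<lambda>h. \<Psi> h < 0) (at_right 0)"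
  proof (rule neg_deriv_imp_eventually_neg)
    have "(R has_real_derivative (\<beta> * (2 * K\<^sup>2 * \<bar>a 1\<bar> + K\<^sup>2 * (a 2 - 2 * a 1) + 2 * K\<^sup>2 * (2 * up_rate - jump_drift))
        + D * (a 4 - 4 * a 3 + 6 * a 2 - 4 * a 1) + K * up_rate)) (at 0)"
      unfolding R_def by (auto intro!: derivative_eq_intros) (simp add: algebra_simps)
    also have "\<beta> * (2 * K\<^sup>2 * \<bar>a 1\<bar> + K\<^sup>2 * (a 2 - 2 * a 1) + 2 * K\<^sup>2 * (2 * up_rate - jump_drift))
        + D * (a 4 - 4 * a 3 + 6 * a 2 - 4 * a 1) + K * up_rate = K * (\<beta> * K * barrier_slope + up_rate)"
      unfolding a4 by (simp add: barrier_slope_def a_def power2_eq_square algebra_simps)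
    finally have R': "(R has_real_derivative (K * (\<beta> * K * barrier_slope + up_rate))) (at 0)" .
    have R0: "R 0 = 0" by (simp add: R_def)
    show "(\<Psi> has_real_derivative (K * (\<beta> * K * barrier_slope + up_rate) - r * K + \<delta> * K)) (at 0)"
      unfolding \<Psi>_def by (auto intro!: derivative_eq_intros R' simp: R0)
    have "K * (\<beta> * K * barrier_slope + up_rate - r + \<delta>) < 0"
      using K \<beta> by (intro mult_pos_neg) auto
    then show "K * (\<beta> * K * barrier_slope + up_rate) - r * K + \<delta> * K < 0" by (simp add: algebra_simps)
    show "\<Psi> 0 = 0" by (simp add: \<Psi>_def R0)
  qed
  then show ?thesis
    using eventually_at_right_less[of 0]
  proof eventually_elim
    case (elim h)
    then have h: "0 < h" by simp
    show ?case
    proof (intro allI impI)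
      fix w assume w: "0 \<le> w" "w \<le> x0"
      define m where "m = max 0 (w - z)"
      have wK: "w \<le> K" and m: "0 \<le> m" "m \<le> K" using w x0 z by (auto simp: m_def)
      have mw: "m * w \<le> K\<^sup>2" unfolding power2_eq_square using m w wK K by (intro mult_mono) auto
      have mw0: "0 \<le> m * w" using m w by simp
      have ww: "w\<^sup>2 \<le> K\<^sup>2" using w wK by (intro power_mono) auto
      let ?E1 = "exp (h * a 1)"
      have E1: "?E1 - 1 \<le> exp (h * \<bar>a 1\<bar>) - 1" using h by simp
      have E1': "0 \<le> exp (h * \<bar>a 1\<bar>) - 1" using h by simp
      have E2: "0 \<le> exp (h * a 2) - 2 * ?E1 + 1"
      proof -
        have "h * a 2 = h * a 1 + h * a 1 + h * \<sigma>\<^sup>2" by (simp add: a_def net_moment_def algebra_simps)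
        then have "exp (h * a 2) = ?E1 * ?E1 * exp (h * \<sigma>\<^sup>2)" by (simp only: exp_add)
        also have "\<dots> = ?E1\<^sup>2 * exp (h * \<sigma>\<^sup>2)" by (simp only: power2_eq_square)
        also have "\<dots> \<ge> ?E1\<^sup>2 * 1" using h by (intro mult_left_mono) auto
        finally have "?E1\<^sup>2 \<le> exp (h * a 2)" by simp
        moreover have "0 \<le> (?E1 - 1)\<^sup>2" by simp
        ultimately show ?thesis by (simp add: power2_eq_square algebra_simps)
      qed
      have J: "0 \<le> ?E1 * (2 * exp (h * up_rate) - 1 - exp (h * jump_drift))"
      proof -
        have "exp (h * jump_drift) \<le> exp (h * up_rate)" "1 \<le> exp (h * up_rate)"
          using h jump_drift_le_up_rate up_rate_nonneg by auto
        then have "0 \<le> 2 * exp (h * up_rate) - 1 - exp (h * jump_drift)" by linarith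
        then show ?thesis by (rule mult_nonneg_nonneg[OF exp_ge_zero])
      qed
      have t1: "2 * \<beta> * m * w * (?E1 - 1) \<le> \<beta> * (2 * K\<^sup>2 * (exp (h * \<bar>a 1\<bar>) - 1))"
      proof -
        have "m * w * (?E1 - 1) \<le> m * w * (exp (h * \<bar>a 1\<bar>) - 1)" using E1 mw0 by (rule mult_left_mono)
        also have "\<dots> \<le> K\<^sup>2 * (exp (h * \<bar>a 1\<bar>) - 1)" using mw E1' by (rule mult_right_mono)
        finally have "(2 * \<beta>) * (m * w * (?E1 - 1)) \<le> (2 * \<beta>) * (K\<^sup>2 * (exp (h * \<bar>a 1\<bar>) - 1))"
          using \<beta> by (intro mult_left_mono) auto
        then show ?thesis by (simp only: mult.assoc mult.left_commute)
      qed
      have t2: "\<beta> * w\<^sup>2 * (exp (h * a 2) - 2 * ?E1 + 1) \<le> \<beta> * (K\<^sup>2 * (exp (h * a 2) - 2 * ?E1 + 1))"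
        unfolding mult.assoc using \<beta> mult_right_mono[OF ww E2] by (intro mult_left_mono) auto
      have t3: "2 * \<beta> * K * w * (?E1 * (2 * exp (h * up_rate) - 1 - exp (h * jump_drift)))
        \<le> \<beta> * (2 * K\<^sup>2 * (?E1 * (2 * exp (h * up_rate) - 1 - exp (h * jump_drift))))"
      proof -
        have "K * w \<le> K\<^sup>2" unfolding power2_eq_square using wK K by (intro mult_left_mono) auto
        from mult_right_mono[OF this J]
        have "(2 * \<beta>) * (K * w * (?E1 * (2 * exp (h * up_rate) - 1 - exp (h * jump_drift))))
          \<le> (2 * \<beta>) * (K\<^sup>2 * (?E1 * (2 * exp (h * up_rate) - 1 - exp (h * jump_drift))))"
          using \<beta> by (intro mult_left_mono) auto
        then show ?thesis by (simp only: mult.assoc mult.left_commute)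
      qed
      have g: "growth_moment h 1 / exp (h * jump_drift) = exp (h * a 1)"
        "growth_moment h 2 / exp (h * jump_drift) ^ 2 = exp (h * a 2)"
        "growth_moment h 3 / exp (h * jump_drift) ^ 3 = exp (h * a 3)"
        "growth_moment h 4 / exp (h * jump_drift) ^ 4 = exp (h * a 4)"
        using growth_moment_div[of h 1] growth_moment_div[of h 2] growth_moment_div[of h 3] growth_moment_div[of h 4]
        by (simp_all add: a_def)
      have "(\<integral>y. barrier K \<beta> z x (w * exp y) \<partial>levy_law h) \<le> barrier_bound_expr \<beta> m D w h (exp (h * jump_drift))"
        unfolding m_def D_def by (rule levy_law_barrier_le[OF h \<beta>(1) z x0 w])
      also have "\<dots> \<le> K - w * exp ((r - \<delta>) * h) + \<beta> * m\<^sup>2 + R h"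
        unfolding barrier_bound_expr_def g R_def distrib_left[of \<beta>] using t1 t2 t3 by linarith
      finally have "exp (- r * h) * (\<integral>y. barrier K \<beta> z x (w * exp y) \<partial>levy_law h)
          \<le> exp (- r * h) * (K - w * exp ((r - \<delta>) * h) + \<beta> * m\<^sup>2 + R h)"
        by (rule mult_left_mono) simp
      also have "\<dots> = exp (- r * h) * (K + R h) - w * (exp (- r * h) * exp ((r - \<delta>) * h)) + exp (- r * h) * (\<beta> * m\<^sup>2)"
        by (simp add: algebra_simps)
      also have "\<dots> = \<Psi> h + (K - w) * exp (- \<delta> * h) + exp (- r * h) * (\<beta> * m\<^sup>2)"
        unfolding discount_growth \<Psi>_def by (simp add: algebra_simps)
      also have "\<dots> \<le> 0 + (K - w) * 1 + 1 * (\<beta> * m\<^sup>2)"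
        using elim(1) wK h r \<delta> \<beta> by (intro add_mono mult_left_mono mult_right_mono) auto
      also have "\<dots> = barrier K \<beta> z x w" using w x0 by (simp add: barrier_def m_def)
      finally show "exp (- r * h) * (\<integral>y. barrier K \<beta> z x (w * exp y) \<partial>levy_law h) \<le> barrier K \<beta> z x w" .
    qed
  qed
qed

lemma VL_mono:
  assumes "0 \<le> h" "0 \<le> x" "k \<le> n"
  shows "VL h k x \<le> VL h n x"
proof (rule lift_Suc_mono_le[of "\<lambda>k. VL h k x", OF _ \<open>k \<le> n\<close>])
  show "VL h k x \<le> VL h (Suc k) x" for k
    unfolding VL_def
    by (rule bermudan_put_Suc_mono[OF prob_space_levy_law sets_levy_law]) (use assms K r in auto)
qed

text \<open>A comparison principle. Up to \<open>x0\<close> the supersolution property carries the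
  domination from \<open>k\<close> to \<open>k + 1\<close> steps, the price after the step being
  covered wherever it lands. Beyond \<open>x0\<close> the domination is given for \<open>n\<close>
  steps and holds for fewer by monotonicity.\<close>

lemma VL_le_barrier:
  assumes h: "0 < h" and \<beta>: "0 \<le> \<beta>" and z: "0 \<le> z" and x0: "0 < x0" "x0 < x" "x \<le> K"
    and super: "\<And>w. 0 \<le> w \<Longrightarrow> w \<le> x0 \<Longrightarrow>
      exp (- r * h) * (\<integral>y. barrier K \<beta> z x (w * exp y) \<partial>levy_law h) \<le> barrier K \<beta> z x w"
    and far: "\<And>w. x0 \<le> w \<Longrightarrow> VL h n w \<le> barrier K \<beta> z x w"
    and k: "k \<le> n" and w: "0 \<le> w"
  shows "VL h k w \<le> barrier K \<beta> z x w"
  using k w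
proof (induction k arbitrary: w)
  have pay: "max 0 (K - w) \<le> barrier K \<beta> z x w" if "0 \<le> w" for w
  proof -
    have "0 \<le> \<beta> * (max 0 (min w x - z))\<^sup>2" using \<beta> by simp
    then show ?thesis using x0 unfolding barrier_def by (auto simp: min_def)
  qed
  {
    case 0
    then show ?case using pay by (simp add: VL_0)
  next
    case (Suc k)
    have h0: "0 \<le> h" using h by simp
    show ?case
    proof (cases "w \<le> x0")
      case True
      interpret L: prob_space "levy_law h" by (rule prob_space_levy_law)
      note [measurable_cong] = sets_levy_law
      have bm: "(\<lambda>y. barrier K \<beta> z x (w * exp y)) \<in> borel_measurable borel"
        unfolding barrier_def by measurable
      have "(\<integral>y. VL h k (w * exp y) \<partial>levy_law h) \<le> (\<integral>y. barrier K \<beta> z x (w * exp y) \<partial>levy_law h)"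
      proof (rule integral_mono[OF VL_integrable[OF h0 Suc.prems(2)]])
        show "integrable (levy_law h) (\<lambda>y. barrier K \<beta> z x (w * exp y))"
        proof (rule L.integrable_const_bound[where B="K + \<beta> * K\<^sup>2"])
          show "AE y in levy_law h. norm (barrier K \<beta> z x (w * exp y)) \<le> K + \<beta> * K\<^sup>2"
            using barrier_bound[OF \<beta> z _ x0(3) mult_nonneg_nonneg[OF Suc.prems(2) exp_ge_zero]] x0 by (intro AE_I2) auto
        qed (use bm in measurable)
        show "VL h k (w * exp y) \<le> barrier K \<beta> z x (w * exp y)" for y
          using Suc by auto
      qed
      then have "exp (- r * h) * (\<integral>y. VL h k (w * exp y) \<partial>levy_law h) \<le> exp (- r * h) * (\<integral>y. barrier K \<beta> z x (w * exp y) \<partial>levy_law h)"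
        by (rule mult_left_mono) simp
      also note super[OF Suc.prems(2) True]
      finally show ?thesis
        unfolding VL_Suc by (rule max.boundedI[OF pay[OF Suc.prems(2)]])
    next
      case False
      have "VL h (Suc k) w \<le> VL h n w" using VL_mono[OF h0 Suc.prems(2,1)] .
      also have "\<dots> \<le> barrier K \<beta> z x w" using False by (intro far) auto
      finally show ?thesis .
    qed
  }
qed

end

section \<open>Critical prices\<close>

context put_setting
begin

text \<open>Otherwise the exponential moment \<open>exp (l\<^sup>2 / 2)\<close> would be at most
  \<open>exp (- l * c)\<close> for every \<open>l > 0\<close>, which fails for large
  \<open>l\<close>.\<close>

lemma std_normal_not_bounded_below: "\<not> (AE g in std_normal_distribution. c \<le> g)"
proof
  assume AE: "AE g in std_normal_distribution. c \<le> g"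
  interpret prob_space std_normal_distribution by (rule prob_space_std)
  define l where "l = 2 * (\<bar>c\<bar> + 1)"
  have l: "0 < l" by (simp add: l_def)
  have "exp ((- l)\<^sup>2 / 2) = (\<integral>g. exp (- l * g) \<partial>std_normal_distribution)"
    by (rule std_normal_exp(2)[symmetric])
  also have "\<dots> \<le> exp (- l * c)"
  proof (rule integral_le_const[OF std_normal_exp(1)])
    show "AE g in std_normal_distribution. exp (- l * g) \<le> exp (- l * c)"
      using AE by eventually_elim (use l in auto)
  qed
  finally have "l * (l / 2 + c) \<le> 0" by (simp add: power2_eq_square algebra_simps)
  moreover have "l / 2 = \<bar>c\<bar> + 1" by (simp add: l_def)
  then have "0 < l / 2 + c" using abs_ge_minus_self[of c] by linarith
  ultimately show False using mult_pos_pos[OF l, of "l / 2 + c"] by linarith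
qed

text \<open>The Gaussian factor falls below \<open>1\<close> with positive probability. Consequently
  the set whose infimum is the Black-Scholes critical price contains \<open>K\<close>; without a
  member its infimum would be unspecified.\<close>

lemma VB_at_strike_pos:
  assumes h: "0 < h"
  shows "0 < VB h 1 K"
proof -
  have h0: "0 \<le> h" using h by simp
  let ?I = "\<integral>g. VB h 0 (K * bs_growth h g) \<partial>std_normal_distribution"
  note i = VB_integrable[OF h0 less_imp_le[OF K], of 0]
  have nn: "0 \<le> VB h 0 v" for v by (simp add: VB_0)
  have "?I \<noteq> 0"
  proof
    assume "?I = 0"
    then have "AE g in std_normal_distribution. VB h 0 (K * bs_growth h g) = 0"
      using integral_nonneg_eq_0_iff_AE[OF i] nn by simp
    then have "AE g in std_normal_distribution. - (r - \<delta> - \<sigma>\<^sup>2 / 2) * h / (\<sigma> * sqrt h) \<le> g"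
    proof eventually_elim
      case (elim g)
      then have "K * 1 \<le> K * bs_growth h g" by (simp add: VB_0)
      then have "1 \<le> bs_growth h g" using K by (simp only: mult_le_cancel_left_pos)
      then have "0 \<le> (r - \<delta> - \<sigma>\<^sup>2 / 2) * h + \<sigma> * sqrt h * g" by (simp add: bs_growth_def)
      then have "- (r - \<delta> - \<sigma>\<^sup>2 / 2) * h \<le> g * (\<sigma> * sqrt h)" by (simp add: algebra_simps)
      then show ?case using \<sigma> h by (subst pos_divide_le_eq) auto
    qed
    then show False using std_normal_not_bounded_below by blast
  qed
  moreover have "0 \<le> ?I" using nn by (intro integral_nonneg_AE) auto
  ultimately have "0 < exp (- r * h) * ?I" by simp
  then show ?thesis using VB_Suc[of h 0 K] by simp
qed

text \<open>Prices translate into critical prices through the sets of which these are infima: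
  \<open>Q \<le> P\<close> makes the Black-Scholes set the smaller one, and \<open>P_stop\<close>
  keeps every point more than \<open>C * sqrt (T - t)\<close> below its infimum out of the Levy
  set.\<close>

lemma critical_price_gap:
  assumes BM: "brownian_motion M (usual_filtration M X) B"
    and dplus: "0 < r - \<delta> - up_rate"
  shows "\<exists>C>0. \<forall>t<T.
     let P = american_put M (usual_filtration M X) (\<lambda>x s \<omega>. x * exp ((r - \<delta>) * s + X s \<omega>)) r K T;
         PBS = american_put M (usual_filtration M X)
           (\<lambda>x s \<omega>. x * exp ((r - \<delta> - \<sigma>\<^sup>2 / 2) * s + \<sigma> * B s \<omega>)) r K T;
         d = critical_price PBS K t - critical_price P K t
     in 0 \<le> d \<and> d \<le> C * sqrt (T - t)"
proof -
  define P where "P = american_put M (usual_filtration M X) (\<lambda>x s \<omega>. x * exp ((r - \<delta>) * s + X s \<omega>)) r K T"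
  define Q where "Q = american_put M (usual_filtration M X)
           (\<lambda>x s \<omega>. x * exp ((r - \<delta> - \<sigma>\<^sup>2 / 2) * s + \<sigma> * B s \<omega>)) r K T"
  have r0: "0 \<le> r" and K0: "0 \<le> K" using r K by auto
  note LX = levy_process_stopping[OF levy_X, of "r - \<delta>", folded levy_law_def]
  note LB = brownian_motion_stopping[OF levy_X BM, of "r - \<delta> - \<sigma>\<^sup>2 / 2" \<sigma>]
  have P_le: "P t x \<le> b" if "t < T" "0 \<le> x" "eventually (\<lambda>n. VL ((T - t) / real n) n x \<le> b) sequentially" for t x b
    unfolding P_def by (rule american_put_le[OF LX that(1,2) K0 r0 that(3)[unfolded VL_def]])
  have P_ge: "VL ((T - t) / real n) n x \<le> P t x" if "t < T" "0 \<le> x" "0 < n" for t x n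
    unfolding P_def VL_def by (rule bermudan_le_american_put[OF LX that(1,2) K0 r0 that(3)])
  have Q_le: "Q t x \<le> b" if "t < T" "0 \<le> x" "eventually (\<lambda>n. VB ((T - t) / real n) n x \<le> b) sequentially" for t x b
    unfolding Q_def by (rule american_put_le[OF LB that(1,2) K0 r0 that(3)[unfolded VB_def]])
  have Q_ge: "VB ((T - t) / real n) n x \<le> Q t x" if "t < T" "0 \<le> x" "0 < n" for t x n
    unfolding Q_def VB_def by (rule bermudan_le_american_put[OF LB that(1,2) K0 r0 that(3)])
  have Q_le_P: "Q t x \<le> P t x" if t: "t < T" and x: "0 \<le> x" for t x
  proof (rule Q_le[OF t x])
    show "eventually (\<lambda>n. VB ((T - t) / real n) n x \<le> P t x) sequentially"
      using eventually_gt_at_top[of 0]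
    proof eventually_elim
      case (elim n)
      have "VB ((T - t) / real n) n x \<le> VL ((T - t) / real n) n x"
        using t x elim by (intro VB_le_VL) auto
      also have "\<dots> \<le> P t x" by (rule P_ge[OF t x elim])
      finally show ?case .
    qed
  qed

  define C1 where "C1 = 2 * up_rate - jump_drift + \<bar>jump_drift\<bar> + 1"
  have C1: "0 < C1" and err: "eventually (\<lambda>h. jump_error h \<le> C1 * h) (at_right 0)"
    unfolding C1_def by (rule jump_error_le)+
  \<comment> \<open>The quadratic term may then use up at most half of the slack \<open>d_+\<close>.
    Absolute value and \<open>+ 1\<close> keep the denominator positive whatever
    \<open>barrier_slope\<close> is.\<close>
  define \<beta> where "\<beta> = (r - \<delta> - up_rate) / (2 * K * (\<bar>barrier_slope\<bar> + 1))"
  have \<beta>: "0 < \<beta>" unfolding \<beta>_def using dplus K by (intro divide_pos_pos mult_pos_pos) auto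
  have slope: "\<beta> * K * barrier_slope < r - \<delta> - up_rate"
  proof -
    have "\<beta> * K * barrier_slope \<le> \<beta> * K * (\<bar>barrier_slope\<bar> + 1)"
      using \<beta> K by (intro mult_left_mono) auto
    also have "\<dots> = (r - \<delta> - up_rate) / 2"
    proof -
      have "(d / (2 * K * s)) * K * s = d / 2" if "0 < s" for d s :: real using K that by simp
      from this[of "\<bar>barrier_slope\<bar> + 1"] show ?thesis by (simp add: \<beta>_def)
    qed
    also have "\<dots> < r - \<delta> - up_rate" using dplus by simp
    finally show ?thesis .
  qed
  \<comment> \<open>Solves \<open>\<beta> * C\<^sup>2 = C1 * K\<close>: at distance
    \<open>C * sqrt (T - t)\<close> from \<open>z\<close> the quadratic term equals the largest
    possible excess \<open>C1 * K * (T - t)\<close> over the payoff.\<close>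
  define C where "C = sqrt (C1 * K / \<beta>)"
  have C: "0 < C" unfolding C_def using C1 K \<beta> by simp
  have C2: "\<beta> * C\<^sup>2 = C1 * K" unfolding C_def using C1 K \<beta> by simp

  have P_stop: "P t z \<le> K - z"
    if t: "t < T" and z: "0 \<le> z" "z + C * sqrt (T - t) < b" and b: "b \<le> K"
      and stop: "\<And>v. 0 \<le> v \<Longrightarrow> v < b \<Longrightarrow> Q t v \<le> K - v" for t z b
  proof (rule P_le[OF t z(1)])
    define \<theta> where "\<theta> = T - t"
    have \<theta>: "0 < \<theta>" using t by (simp add: \<theta>_def)
    define s where "s = C * sqrt \<theta>"
    have s: "0 < s" using C \<theta> by (simp add: s_def)
    have s2: "\<beta> * s\<^sup>2 = C1 * K * \<theta>"
      using C2 \<theta> by (simp add: s_def power_mult_distrib mult.assoc[symmetric])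
    \<comment> \<open>The points \<open>x0\<close> and \<open>x\<close> cut the interval from
      \<open>z + s\<close> to \<open>b\<close> into thirds. Thus \<open>x0\<close> is far enough
      from \<open>z\<close> for the quadratic term, \<open>x\<close> leaves room above
      \<open>x0\<close>, and stopping is still optimal at \<open>x\<close> in the Black-Scholes
      model.\<close>
    define x0 where "x0 = (2 * (z + s) + b) / 3"
    define x where "x = (z + s + 2 * b) / 3"
    have zs: "z + s < b" using z(2) by (simp add: s_def \<theta>_def)
    have x0: "0 < x0" "x0 < x" "x \<le> K" and x0z: "z + s \<le> x0" and xb: "x < b"
      using zs s z(1) b by (auto simp: x0_def x_def)
    have lim: "filterlim (\<lambda>n. \<theta> / real n) (at_right 0) sequentially"
    proof -
      have "eventually (\<lambda>n. \<theta> / real n \<in> {0<..} \<and> \<theta> / real n \<noteq> 0) sequentially"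
        using eventually_gt_at_top[of 0] by eventually_elim (use \<theta> in auto)
      then show ?thesis
        unfolding filterlim_at using lim_const_over_n[of \<theta>] by blast
    qed
    have ev1: "eventually (\<lambda>n. \<forall>w. 0 \<le> w \<longrightarrow> w \<le> x0 \<longrightarrow>
        exp (- r * (\<theta> / real n)) * (\<integral>y. barrier K \<beta> z x (w * exp y) \<partial>levy_law (\<theta> / real n)) \<le> barrier K \<beta> z x w) sequentially"
      by (rule eventually_compose_filterlim[OF eventually_barrier_supersolution[OF less_imp_le[OF \<beta>] slope z(1) x0] lim])
    have ev2: "eventually (\<lambda>n. jump_error (\<theta> / real n) \<le> C1 * (\<theta> / real n)) sequentially"
      by (rule eventually_compose_filterlim[OF err lim])
    show "eventually (\<lambda>n. VL ((T - t) / real n) n z \<le> K - z) sequentially"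
      using ev1 ev2 eventually_gt_at_top[of 0]
    proof eventually_elim
      case (elim n)
      define h where "h = \<theta> / real n"
      have h: "0 < h" using \<theta> elim(3) by (simp add: h_def)
      have near: "VL h n v \<le> K - v + C1 * K * \<theta>" if v: "0 \<le> v" "v < b" for v
      proof -
        have "VL h n v \<le> VB h n v + real n * (C1 * h) * v"
          using elim(2)[folded h_def] C1 h v by (intro VL_le_VB) auto
        also have "real n * (C1 * h) * v = C1 * \<theta> * v" using elim(3) by (simp add: h_def)
        also have "C1 * \<theta> * v \<le> C1 * \<theta> * K" using C1 \<theta> v b by (intro mult_left_mono) auto
        also have "VB h n v \<le> Q t v" unfolding h_def \<theta>_def by (rule Q_ge[OF t v(1) elim(3)])
        also have "Q t v \<le> K - v" by (rule stop[OF v])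
        finally show ?thesis by (simp add: ac_simps)
      qed
      have far1: "VL h n w \<le> barrier K \<beta> z x w" if w: "x0 \<le> w" "w \<le> x" for w
      proof -
        have ws: "s \<le> w - z" using w x0z by linarith
        have "VL h n w \<le> K - w + \<beta> * s\<^sup>2" unfolding s2 using w x0 xb by (intro near) auto
        also have "\<beta> * s\<^sup>2 \<le> \<beta> * (w - z)\<^sup>2" using ws s \<beta> by (intro mult_left_mono power_mono) auto
        also have "K - w + \<beta> * (w - z)\<^sup>2 = barrier K \<beta> z x w"
          using w ws s by (simp add: barrier_def)
        finally show ?thesis by simp
      qed
      have far: "VL h n w \<le> barrier K \<beta> z x w" if w: "x0 \<le> w" for w
      proof (cases "w \<le> x")
        case True
        then show ?thesis using far1 w by simp
      next
        case False
        have "VL h n w \<le> VL h n x" using False x0 by (intro VL_antimono[OF h]) auto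
        also have "\<dots> \<le> barrier K \<beta> z x x" using x0 by (intro far1) auto
        also have "\<dots> = barrier K \<beta> z x w" using False by (simp add: barrier_def)
        finally show ?thesis .
      qed
      have super: "exp (- r * h) * (\<integral>y. barrier K \<beta> z x (w * exp y) \<partial>levy_law h) \<le> barrier K \<beta> z x w"
        if "0 \<le> w" "w \<le> x0" for w
        using elim(1) that unfolding h_def by blast
      have "VL h n z \<le> barrier K \<beta> z x z"
        by (rule VL_le_barrier[OF h less_imp_le[OF \<beta>] z(1) x0 super far order_refl z(1)])
      also have "\<dots> = K - z" using x0 x0z s by (simp add: barrier_def)
      finally show ?case by (simp add: h_def \<theta>_def)
    qed
  qed

  have main: "0 \<le> critical_price Q K t - critical_price P K t \<and>
      critical_price Q K t - critical_price P K t \<le> C * sqrt (T - t)" if t: "t < T" for t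
  proof -
    define EQ where "EQ = {x. 0 \<le> x \<and> Q t x > max 0 (K - x)}"
    define EP where "EP = {x. 0 \<le> x \<and> P t x > max 0 (K - x)}"
    have KQ: "K \<in> EQ"
    proof -
      have "0 < VB (T - t) 1 K" using t by (intro VB_at_strike_pos) simp
      also have "\<dots> \<le> Q t K" using Q_ge[OF t K0, of 1] by simp
      finally show ?thesis using K by (simp add: EQ_def)
    qed
    have sub: "EQ \<subseteq> EP" using Q_le_P[OF t] by (auto simp: EQ_def EP_def intro: less_le_trans)
    have bQ: "bdd_below EQ" and bP: "bdd_below EP" by (auto simp: EQ_def EP_def intro!: bdd_belowI[of _ 0])
    have le: "Inf EP \<le> Inf EQ" using KQ by (intro cInf_superset_mono[OF _ bP sub]) auto
    have b: "Inf EQ \<le> K" by (rule cInf_lower[OF KQ bQ])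
    have stop: "Q t v \<le> K - v" if "0 \<le> v" "v < Inf EQ" for v
    proof -
      have "v \<notin> EQ" using cInf_lower[OF _ bQ, of v] that by auto
      then show ?thesis using that b by (auto simp: EQ_def)
    qed
    have "Inf EQ - C * sqrt (T - t) \<le> Inf EP"
    proof (rule cInf_greatest)
      show "EP \<noteq> {}" using KQ sub by auto
      fix z assume z: "z \<in> EP"
      show "Inf EQ - C * sqrt (T - t) \<le> z"
      proof (rule ccontr)
        assume "\<not> ?thesis"
        then have "P t z \<le> K - z" using z by (intro P_stop[OF t _ _ b stop]) (auto simp: EP_def)
        then show False using z by (auto simp: EP_def)
      qed
    qed
    then show ?thesis using le by (simp add: critical_price_def EQ_def EP_def)
  qed
  show ?thesis
    unfolding Let_def P_def[symmetric] Q_def[symmetric] using C main by blast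
qed

end

theorem theorem4p1:
  fixes M :: "'a measure" and X B :: "real \<Rightarrow> 'a \<Rightarrow> real" and \<nu> :: "real measure"
    and \<sigma> \<gamma> T K r \<delta> :: real
  assumes triplet: "levy_triplet M X \<sigma> \<gamma> \<nu>"
    and BM: "brownian_motion M (usual_filtration M X) B"
    and T: "T > 0" and K: "K > 0" and r: "r > 0" and \<delta>: "\<delta> \<ge> 0"
    and exp_mom: "integrable \<nu> (\<lambda>y. indicator {y. \<bar>y\<bar> \<ge> 1} y * exp y)"
    and mart: "\<sigma>\<^sup>2 / 2 + \<gamma> + (\<integral>y. exp y - 1 - y * indicator {y. \<bar>y\<bar> \<le> 1} y \<partial>\<nu>) = 0"
    and \<sigma>: "\<sigma> > 0"
    and fin_var: "integrable \<nu> (\<lambda>y. indicator {y. \<bar>y\<bar> \<le> 1} y * \<bar>y\<bar>)"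
    and dplus: "r - \<delta> - (\<integral>y. max 0 (exp y - 1) \<partial>\<nu>) > 0"
  shows "\<exists>C>0. eventually (\<lambda>t.
           let P = american_put M (usual_filtration M X)
                     (\<lambda>x s \<omega>. x * exp ((r - \<delta>) * s + X s \<omega>)) r K T;
               PBS = american_put M (usual_filtration M X)
                     (\<lambda>x s \<omega>. x * exp ((r - \<delta> - \<sigma>\<^sup>2 / 2) * s + \<sigma> * B s \<omega>)) r K T;
               d = critical_price PBS K t - critical_price P K t
           in 0 \<le> d \<and> d \<le> C * sqrt (T - t)) (at_left T)"
proof -
  interpret put_setting \<nu> M X \<sigma> \<gamma> r \<delta> K
    using triplet mart \<sigma> K r \<delta> exp_mom fin_var
    by unfold_locales (auto simp: levy_triplet_def)
  have "0 < r - \<delta> - up_rate" using dplus by (simp add: up_rate_def)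
  from critical_price_gap[OF BM this, of T] obtain C where "C > 0" and C: "\<forall>t<T.
     let P = american_put M (usual_filtration M X) (\<lambda>x s \<omega>. x * exp ((r - \<delta>) * s + X s \<omega>)) r K T;
         PBS = american_put M (usual_filtration M X)
           (\<lambda>x s \<omega>. x * exp ((r - \<delta> - \<sigma>\<^sup>2 / 2) * s + \<sigma> * B s \<omega>)) r K T;
         d = critical_price PBS K t - critical_price P K t
     in 0 \<le> d \<and> d \<le> C * sqrt (T - t)" by blast
  have "eventually (\<lambda>t. t < T) (at_left T)" by (simp add: eventually_at_filter)
  then show ?thesis
    by (intro exI[of _ C] conjI \<open>C > 0\<close>) (rule eventually_mono, assumption, erule C[THEN spec, THEN mp])
qed

end
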